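(* Let $\tau\in T_{\mathbb C}$. Then the following are equivalent: (1) $I_\tau$ is irreducible (as a ${}^{BL}\mathcal H_{\mathbb C}$-module); (2) $I_\tau(\tau)=\mathbb C.(1\otimes_\tau1)$ and $\tau\in\mathcal U_{\mathbb C}$; (3) $\mathrm{End}_{{}^{BL}\mathcal H_{\mathbb C}\text{-mod}}(I_\tau)=\mathbb C.\mathrm{Id}$ and $\tau\in\mathcal U_{\mathbb C}$.
   Context: Let $\mathcal S=(A,X,Y,(\alpha_i)_{i\in I},(\alpha_i^\vee)_{i\in I})$ be a root generating system: $A=(a_{i,j})$ is a Kac–Moody matrix (finite index set $I$, integer entries, $a_{i,i}=2$, $a_{i,j}\le 0$ for $i\ne j$, $a_{i,j}=0\iff a_{j,i}=0$), $X,Y$ are dual free $\mathbb Z$-modules of finite rank, $(\alpha_i)$ and $(\alpha_i^\vee)$ are free families in $X$ and $Y$ with $\alpha_j(\alpha_i^\vee)=a_{i,j}$. Put $\mathbb A=Y\otimes\mathbb R$, $r_i(v)=v-\alpha_i(v)\alpha_i^\vee$, $\mathscr S=\{r_i\}$, $W^v=\langle\mathscr S\rangle\subset GL(\mathbb A)$ (Coxeter group with length $\ell$); for $s=r_i$ write $\alpha_s=\alpha_i$, $\alpha_s^\vee=\alpha_i^\vee$. $\Phi^\vee=\{w.\alpha_s^\vee\mid w\in W^v,s\in\mathscr S\}$. $(\sigma_s)_{s\in\mathscr S},(\sigma'_s)_{s\in\mathscr S}$ are families in $\mathbb C^*$ such that $\sigma_s=\sigma'_s$ if $\alpha_s(Y)=\mathbb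 Z$, and $\sigma_s=\sigma_t=\sigma'_s=\sigma'_t$ for $s\ne t$ with $st$ of finite odd order. Standing assumption: $\sigma'_s\notin\{\sigma_s^{-1},-\sigma_s,-\sigma_s^{-1}\}$ for all $s\in\mathscr S$. ${}^{BL}\mathcal H_{\mathbb C}$ is the $\mathbb C$-vector space with basis $(Z^\lambda H_w)_{\lambda\in Y,w\in W^v}$ ($Z^\lambda=Z^\lambda H_1$, $H_w=Z^0H_w$) with the unique associative product such that $Z^\lambda*H_w=Z^\lambda H_w$; $Z^\lambda*Z^\mu=Z^{\lambda+\mu}$; $H_s*H_w=H_{sw}$ if $\ell(sw)=\ell(w)+1$ and $H_s*H_w=(\sigma_s-\sigma_s^{-1})H_w+H_{sw}$ if $\ell(sw)=\ell(w)-1$; and $H_s*Z^\lambda-Z^{s.\lambda}*H_s=Q_s(Z)(Z^\lambda-Z^{s.\lambda})$ with $Q_s(Z)=\frac{(\sigma_s-\sigma_s^{-1})+(\sigma_s'-\sigma_s'^{-1})Z^{-\alpha_s^\vee}}{1-Z^{-2\alpha_s^\vee}}$. $\mathbb C[Y]=\bigoplus_\lambda\mathbb CZ^\lambda$, with fraction field $\mathbb C(Y)$; $W^v$ acts on both by $(Z^\lambda)^w=Z^{w.\lambda}$. $T_{\mathbb C}=\mathrm{Hom}_{\mathrm{Gr}}(Y,\mathbb C^* )$; $\tau\in T_{\mathbb C}$ is extended to an algebra morphism $\mathbb C[Y]\to\mathbb C$, $Z^\lambda\mapsto\tau(\lambda)$; $I_\tau={}^{BL}\mathcal H_{\mathbb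 C}\otimes_{\mathbb C[Y]}\mathbb C$, $\mathbb C[Y]$ acting on $\mathbb C$ via $\tau$ (the tensor is written $\otimes_\tau$). $I_\tau(\tau)=\{x\in I_\tau\mid P.x=\tau(P)x\ \forall P\in\mathbb C[Y]\}$. For $s\in\mathscr S$, $\zeta_s=-\sigma_sQ_s(Z)+\sigma_s^2\in\mathbb C(Y)$; for $\alpha^\vee=w.\alpha_s^\vee\in\Phi^\vee$, $\zeta_{\alpha^\vee}=(\zeta_s)^w$ (well defined). Write $\zeta_{\alpha^\vee}=\zeta^{\mathrm{num}}_{\alpha^\vee}/\zeta^{\mathrm{den}}_{\alpha^\vee}$ with coprime $\zeta^{\mathrm{num}}_{\alpha^\vee},\zeta^{\mathrm{den}}_{\alpha^\vee}$ in the UFD $\mathbb C[Y]$. $\mathcal U_{\mathbb C}=\{\tau\in T_{\mathbb C}\mid\tau(\zeta^{\mathrm{num}}_{\alpha^\vee})\ne0\ \forall\alpha^\vee\in\Phi^\vee\}$. (If $\sigma_s=\sigma'_s=\sqrt q$ for all $s$, then $\mathcal U_{\mathbb C}=\{\tau\mid\tau(\alpha^\vee)\neq q\ \forall\alpha^\vee\in\Phi^\vee\}$.) *)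

theory Defs
  imports
    Complex_Main
    "HOL-Library.Poly_Mapping"
    "HOL-Library.FuncSet"
    "HOL-Algebra.Module"
    "HOL-Algebra.Bij"
    "HOL-Algebra.Multiplicative_Group"
    "HOL-Algebra.Free_Abelian_Groups"
begin

section \<open>Abelian groups as \<open>\<int>\<close>-modules\<close>

definition zscale :: "int \<Rightarrow> 'y::ab_group_add \<Rightarrow> 'y" where
  "zscale n y = (if 0 \<le> n then (((+) y) ^^ nat n) 0 else - ((((+) y) ^^ nat (- n)) 0))"

definition z_free_family :: "'i set \<Rightarrow> ('i \<Rightarrow> 'y::ab_group_add) \<Rightarrow> bool" where
  "z_free_family I v \<longleftrightarrow>
     (\<forall>n :: 'i \<Rightarrow> int. (\<Sum>i\<in>I. zscale (n i) (v i)) = 0 \<longrightarrow> (\<forall>i\<in>I. n i = 0))"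

definition z_spanning :: "'y::ab_group_add set \<Rightarrow> bool" where
  "z_spanning B \<longleftrightarrow> (\<forall>y. \<exists>n :: 'y \<Rightarrow> int. y = (\<Sum>b\<in>B. zscale (n b) b))"

section \<open>Left modules over rings that need not be commutative\<close>

text \<open>
  The record of modules and the predicate for submodules are those of HOL-Algebra; neither
  requires the ring to be commutative.
\<close>

definition irreducible_module :: "('a, 'k) ring_scheme \<Rightarrow> ('a, 'b, 'l) module_scheme \<Rightarrow> bool" where
  "irreducible_module R M \<longleftrightarrow>
     carrier M \<noteq> {\<zero>\<^bsub>M\<^esub>} \<and>
     (\<forall>N. submodule N R M \<longrightarrow> N = {\<zero>\<^bsub>M\<^esub>} \<or> N = carrier M)"

text \<open>Endomorphisms are represented by functions that are \<^const>\<open>undefined\<close> outside the carrier.\<close>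

definition module_End :: "('a, 'k) ring_scheme \<Rightarrow> ('a, 'b, 'l) module_scheme \<Rightarrow> ('b \<Rightarrow> 'b) set" where
  "module_End R M = {f \<in> carrier M \<rightarrow>\<^sub>E carrier M.
     (\<forall>x\<in>carrier M. \<forall>y\<in>carrier M. f (x \<oplus>\<^bsub>M\<^esub> y) = f x \<oplus>\<^bsub>M\<^esub> f y) \<and>
     (\<forall>h\<in>carrier R. \<forall>x\<in>carrier M. f (h \<odot>\<^bsub>M\<^esub> x) = h \<odot>\<^bsub>M\<^esub> f x)}"

section \<open>Tensor products over a commutative ring\<close>

text \<open>
  Let \<open>H\<close> be a ring on which a commutative ring \<open>'r\<close> acts from the right by \<open>ra\<close>, compatibly
  with left multiplication, and let \<open>'n\<close> be an \<open>'r\<close>-module with action \<open>la\<close>.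
  Then \<open>H \<otimes> 'n\<close> is the quotient of the free abelian group on the pairs \<open>(h, n)\<close> by the
  subgroup generated by the usual relators; its elements are cosets.
\<close>

definition tensor_free ::
  "('a, 'k) ring_scheme \<Rightarrow> (('a \<times> 'n) \<Rightarrow>\<^sub>0 int) monoid" where
  "tensor_free H = free_Abelian_group (carrier H \<times> UNIV)"

definition tensor_relators ::
  "('a, 'k) ring_scheme \<Rightarrow> ('a \<Rightarrow> 'r \<Rightarrow> 'a) \<Rightarrow> ('r \<Rightarrow> 'n \<Rightarrow> 'n::ab_group_add) \<Rightarrow>
     (('a \<times> 'n) \<Rightarrow>\<^sub>0 int) set" where
  "tensor_relators H ra la =
     {frag_of (h \<oplus>\<^bsub>H\<^esub> h', n) - frag_of (h, n) - frag_of (h', n) | h h' n.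
        h \<in> carrier H \<and> h' \<in> carrier H} \<union>
     {frag_of (h, n + n') - frag_of (h, n) - frag_of (h, n') | h n n'. h \<in> carrier H} \<union>
     {frag_of (ra h r, n) - frag_of (h, la r n) | h r n. h \<in> carrier H}"

definition tensor_kernel ::
  "('a, 'k) ring_scheme \<Rightarrow> ('a \<Rightarrow> 'r \<Rightarrow> 'a) \<Rightarrow> ('r \<Rightarrow> 'n \<Rightarrow> 'n::ab_group_add) \<Rightarrow>
     (('a \<times> 'n) \<Rightarrow>\<^sub>0 int) set" where
  "tensor_kernel H ra la = generate (tensor_free H) (tensor_relators H ra la)"

definition pure_tensor ::
  "('a, 'k) ring_scheme \<Rightarrow> ('a \<Rightarrow> 'r \<Rightarrow> 'a) \<Rightarrow> ('r \<Rightarrow> 'n \<Rightarrow> 'n::ab_group_add) \<Rightarrow>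
     'a \<Rightarrow> 'n \<Rightarrow> (('a \<times> 'n) \<Rightarrow>\<^sub>0 int) set" where
  "pure_tensor H ra la h n = tensor_kernel H ra la #>\<^bsub>tensor_free H\<^esub> frag_of (h, n)"

text \<open>
  The left \<open>H\<close>-module structure is \<open>h . (h' \<otimes> n) = (h h') \<otimes> n\<close>: the class of \<open>x\<close> is sent to the
  class of \<open>frag_extend (\<lambda>(h', n). frag_of (h h', n)) x\<close>, and the union below is taken over the
  representatives \<open>x\<close>, which all give the same coset.  The multiplication and unit
  fields of the module record play no role for modules.
\<close>

definition tensor_module ::
  "('a, 'k) ring_scheme \<Rightarrow> ('a \<Rightarrow> 'r \<Rightarrow> 'a) \<Rightarrow> ('r \<Rightarrow> 'n \<Rightarrow> 'n::ab_group_add) \<Rightarrow>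
     ('a, (('a \<times> 'n) \<Rightarrow>\<^sub>0 int) set) module" where
  "tensor_module H ra la =
     (let F = tensor_free H; K = tensor_kernel H ra la in
      \<lparr>carrier = carrier (F Mod K), monoid.mult = undefined, monoid.one = undefined,
       ring.zero = \<one>\<^bsub>F Mod K\<^esub>, ring.add = monoid.mult (F Mod K),
       smult = (\<lambda>h C. \<Union>x\<in>C. K #>\<^bsub>F\<^esub> frag_extend (\<lambda>(h', n). frag_of (h \<otimes>\<^bsub>H\<^esub> h', n)) x)\<rparr>)"

section \<open>The group algebra \<open>\<complex>[Y]\<close>\<close>

text \<open>
  \<open>\<complex>[Y]\<close> is the type \<open>'y \<Rightarrow>\<^sub>0 complex\<close> with the convolution product of the library.
\<close>

definition Zmon :: "'y \<Rightarrow> ('y::ab_group_add \<Rightarrow>\<^sub>0 complex)" where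
  "Zmon \<mu> = Poly_Mapping.single \<mu> 1"

definition gscal :: "complex \<Rightarrow> ('y::ab_group_add \<Rightarrow>\<^sub>0 complex)" where
  "gscal c = Poly_Mapping.single 0 c"

definition galg_act :: "('y \<Rightarrow> 'y) \<Rightarrow> ('y::ab_group_add \<Rightarrow>\<^sub>0 complex) \<Rightarrow> ('y \<Rightarrow>\<^sub>0 complex)" where
  "galg_act w P = (\<Sum>\<mu>\<in>Poly_Mapping.keys P. Poly_Mapping.single (w \<mu>) (Poly_Mapping.lookup P \<mu>))"

definition torus :: "('y::ab_group_add \<Rightarrow> complex) set" where
  "torus = {\<tau>. (\<forall>\<mu>. \<tau> \<mu> \<noteq> 0) \<and> (\<forall>\<mu> \<nu>. \<tau> (\<mu> + \<nu>) = \<tau> \<mu> * \<tau> \<nu>)}"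

definition evalt :: "('y::ab_group_add \<Rightarrow> complex) \<Rightarrow> ('y \<Rightarrow>\<^sub>0 complex) \<Rightarrow> complex" where
  "evalt \<tau> P = (\<Sum>\<mu>\<in>Poly_Mapping.keys P. Poly_Mapping.lookup P \<mu> * \<tau> \<mu>)"

text \<open>
  An element of the fraction field \<open>\<complex>(Y)\<close> is represented by a pair (numerator, denominator) with
  non-zero denominator; two pairs represent the same fraction iff \<open>frac_eq\<close> holds.  (For torsion-free
  \<open>Y\<close> the ring \<open>\<complex>[Y]\<close> is a domain, but there is no type class instance expressing this, so the
  fraction field of the library is not available.  The library's \<^const>\<open>Rings.coprime\<close> is missing
  for the same reason.)
\<close>

definition frac_eq :: "'r::comm_ring_1 \<times> 'r \<Rightarrow> 'r \<times> 'r \<Rightarrow> bool" where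
  "frac_eq p q \<longleftrightarrow> snd p \<noteq> 0 \<and> snd q \<noteq> 0 \<and> fst p * snd q = fst q * snd p"

definition coprime_elts :: "'r::comm_ring_1 \<Rightarrow> 'r \<Rightarrow> bool" where
  "coprime_elts p q \<longleftrightarrow> (\<forall>c. c dvd p \<longrightarrow> c dvd q \<longrightarrow> c dvd 1)"

section \<open>Root generating systems\<close>

text \<open>
  The lattice \<open>Y\<close> is the type \<open>'y\<close>, and \<open>X\<close> is its dual, the additive maps \<open>'y \<Rightarrow> int\<close>.
\<close>

locale root_generating_system =
  fixes I :: "'i set"
    and A :: "'i \<Rightarrow> 'i \<Rightarrow> int"
    and \<alpha> :: "'i \<Rightarrow> 'y::ab_group_add \<Rightarrow> int"
    and \<alpha>v :: "'i \<Rightarrow> 'y"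
  assumes finite_I: "finite I"
    and A_diag: "i \<in> I \<Longrightarrow> A i i = 2"
    and A_nonpos: "i \<in> I \<Longrightarrow> j \<in> I \<Longrightarrow> i \<noteq> j \<Longrightarrow> A i j \<le> 0"
    and A_zero: "i \<in> I \<Longrightarrow> j \<in> I \<Longrightarrow> A i j = 0 \<longleftrightarrow> A j i = 0"
    and Y_free: "\<exists>B :: 'y set. finite B \<and> z_free_family B (\<lambda>b. b) \<and> z_spanning B"
    and root_additive: "i \<in> I \<Longrightarrow> \<alpha> i (\<mu> + \<nu>) = \<alpha> i \<mu> + \<alpha> i \<nu>"
    and roots_free: "\<And>n :: 'i \<Rightarrow> int. (\<And>\<mu>. (\<Sum>i\<in>I. n i * \<alpha> i \<mu>) = 0) \<Longrightarrow> (\<forall>i\<in>I. n i = 0)"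
    and coroots_free: "z_free_family I \<alpha>v"
    and pairing: "i \<in> I \<Longrightarrow> j \<in> I \<Longrightarrow> \<alpha> j (\<alpha>v i) = A i j"
begin

text \<open>
  The reflections preserve \<open>Y\<close>, which spans \<open>Y \<otimes> \<real>\<close>, so \<open>W\<close> is regarded as a group of
  permutations of \<open>Y\<close>.  The map \<open>i \<mapsto> r i\<close> is injective on \<open>I\<close> (the coroots being free), and
  simple reflections are referred to by their index.
\<close>

definition r :: "'i \<Rightarrow> 'y \<Rightarrow> 'y" where
  "r i v = v - zscale (\<alpha> i v) (\<alpha>v i)"

definition W :: "('y \<Rightarrow> 'y) set" where
  "W = generate (BijGroup UNIV) (r ` I)"

definition word :: "'i list \<Rightarrow> 'y \<Rightarrow> 'y" where
  "word ks = foldr (\<lambda>i w. r i \<circ> w) ks id"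

definition len :: "('y \<Rightarrow> 'y) \<Rightarrow> nat" where
  "len w = (LEAST n. \<exists>ks. set ks \<subseteq> I \<and> length ks = n \<and> word ks = w)"

definition coroots :: "'y set" where
  "coroots = {w (\<alpha>v i) | w i. w \<in> W \<and> i \<in> I}"

end

text \<open>
  The order \<^const>\<open>group.ord\<close> of a group element is 0 if the element has infinite order, so that an
  odd order is in particular finite.
\<close>

locale hecke_parameters = root_generating_system I A \<alpha> \<alpha>v
  for I :: "'i set" and A and \<alpha> :: "'i \<Rightarrow> 'y::ab_group_add \<Rightarrow> int" and \<alpha>v +
  fixes \<sigma> \<sigma>' :: "'i \<Rightarrow> complex"
  assumes \<sigma>_nz: "i \<in> I \<Longrightarrow> \<sigma> i \<noteq> 0"
    and \<sigma>'_nz: "i \<in> I \<Longrightarrow> \<sigma>' i \<noteq> 0"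
    and \<sigma>_eq_\<sigma>': "i \<in> I \<Longrightarrow> range (\<alpha> i) = UNIV \<Longrightarrow> \<sigma> i = \<sigma>' i"
    and \<sigma>_odd: "i \<in> I \<Longrightarrow> j \<in> I \<Longrightarrow> r i \<noteq> r j \<Longrightarrow> odd (group.ord (BijGroup UNIV) (r i \<circ> r j)) \<Longrightarrow>
        \<sigma> i = \<sigma> j \<and> \<sigma> j = \<sigma>' i \<and> \<sigma>' i = \<sigma>' j"
    and \<sigma>'_generic: "i \<in> I \<Longrightarrow> \<sigma>' i \<notin> {inverse (\<sigma> i), - \<sigma> i, - inverse (\<sigma> i)}"
begin

text \<open>Numerator and denominator of \<open>Q\<^sub>s(Z)\<close>, \<open>s = r i\<close>.\<close>

definition Qnum :: "'i \<Rightarrow> ('y \<Rightarrow>\<^sub>0 complex)" where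
  "Qnum i = gscal (\<sigma> i - inverse (\<sigma> i)) + gscal (\<sigma>' i - inverse (\<sigma>' i)) * Zmon (- \<alpha>v i)"

definition Qden :: "'i \<Rightarrow> ('y \<Rightarrow>\<^sub>0 complex)" where
  "Qden i = 1 - Zmon (zscale (- 2) (\<alpha>v i))"

text \<open>\<open>\<zeta>\<^sub>s = - \<sigma>\<^sub>s Q\<^sub>s(Z) + \<sigma>\<^sub>s\<^sup>2\<close> as an (unreduced) fraction, and its transform by \<open>w\<close>.\<close>

definition zeta :: "'i \<Rightarrow> ('y \<Rightarrow>\<^sub>0 complex) \<times> ('y \<Rightarrow>\<^sub>0 complex)" where
  "zeta i = (- gscal (\<sigma> i) * Qnum i + gscal ((\<sigma> i)\<^sup>2) * Qden i, Qden i)"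

definition zeta_act :: "('y \<Rightarrow> 'y) \<Rightarrow> 'i \<Rightarrow> ('y \<Rightarrow>\<^sub>0 complex) \<times> ('y \<Rightarrow>\<^sub>0 complex)" where
  "zeta_act w i = (galg_act w (fst (zeta i)), galg_act w (snd (zeta i)))"

text \<open>
  \<open>p / q\<close> is a reduced form of \<open>\<zeta>\<^sub>\<beta>\<close>.  It is unique up to a unit of \<open>\<complex>[Y]\<close>, and units
  \<open>c Z\<^sup>\<mu>\<close> do not vanish at any point of the torus, so the quantification over all reduced forms in
  \<open>U_set\<close> is independent of choices.
\<close>

definition zeta_reduced :: "'y \<Rightarrow> ('y \<Rightarrow>\<^sub>0 complex) \<Rightarrow> ('y \<Rightarrow>\<^sub>0 complex) \<Rightarrow> bool" where
  "zeta_reduced \<beta> p q \<longleftrightarrow>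
     coprime_elts p q \<and> (\<exists>w\<in>W. \<exists>i\<in>I. \<beta> = w (\<alpha>v i) \<and> frac_eq (p, q) (zeta_act w i))"

definition U_set :: "('y \<Rightarrow> complex) set" where
  "U_set = {\<tau> \<in> torus. \<forall>\<beta>\<in>coroots. \<forall>p q. zeta_reduced \<beta> p q \<longrightarrow> evalt \<tau> p \<noteq> 0}"

end

section \<open>The Bernstein--Lusztig--Hecke algebra\<close>

text \<open>
  The vector space with basis \<open>(Z\<^sup>\<mu> H\<^sub>w)\<close> consists of the finitely supported functions
  on pairs \<open>(\<mu>, w)\<close> that are supported on \<open>Y \<times> W\<close>; \<open>bas \<mu> w\<close> is \<open>Z\<^sup>\<mu> H\<^sub>w\<close>.
  The product \<open>mul\<close> is determined by the assumptions, which are the defining relations.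
\<close>

type_synonym 'y hecke = "('y \<times> ('y \<Rightarrow> 'y)) \<Rightarrow>\<^sub>0 complex"

type_synonym 'y induced = "(('y hecke \<times> complex) \<Rightarrow>\<^sub>0 int) set"

definition bas :: "'y \<Rightarrow> ('y \<Rightarrow> 'y) \<Rightarrow> 'y hecke" where
  "bas \<mu> w = Poly_Mapping.single (\<mu>, w) 1"

definition hscale :: "complex \<Rightarrow> ('b \<Rightarrow>\<^sub>0 complex) \<Rightarrow> ('b \<Rightarrow>\<^sub>0 complex)" where
  "hscale c h = Poly_Mapping.map ((*) c) h"

definition emb :: "('y \<Rightarrow>\<^sub>0 complex) \<Rightarrow> 'y hecke" where
  "emb P = (\<Sum>\<mu>\<in>Poly_Mapping.keys P. hscale (Poly_Mapping.lookup P \<mu>) (bas \<mu> id))"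

context root_generating_system
begin

definition Hspace :: "'y hecke set" where
  "Hspace = {h. Poly_Mapping.keys h \<subseteq> UNIV \<times> W}"

end

locale BL_hecke_algebra = hecke_parameters I A \<alpha> \<alpha>v \<sigma> \<sigma>'
  for I :: "'i set" and A and \<alpha> :: "'i \<Rightarrow> 'y::ab_group_add \<Rightarrow> int" and \<alpha>v and \<sigma> \<sigma>' +
  fixes mul :: "'y hecke \<Rightarrow> 'y hecke \<Rightarrow> 'y hecke"
  assumes mul_closed: "h \<in> Hspace \<Longrightarrow> k \<in> Hspace \<Longrightarrow> mul h k \<in> Hspace"
    and mul_add_left: "h \<in> Hspace \<Longrightarrow> h' \<in> Hspace \<Longrightarrow> k \<in> Hspace \<Longrightarrow>
        mul (h + h') k = mul h k + mul h' k"
    and mul_add_right: "h \<in> Hspace \<Longrightarrow> k \<in> Hspace \<Longrightarrow> k' \<in> Hspace \<Longrightarrow>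
        mul h (k + k') = mul h k + mul h k'"
    and mul_scale_left: "h \<in> Hspace \<Longrightarrow> k \<in> Hspace \<Longrightarrow> mul (hscale c h) k = hscale c (mul h k)"
    and mul_scale_right: "h \<in> Hspace \<Longrightarrow> k \<in> Hspace \<Longrightarrow> mul h (hscale c k) = hscale c (mul h k)"
    and mul_assoc: "h \<in> Hspace \<Longrightarrow> k \<in> Hspace \<Longrightarrow> l \<in> Hspace \<Longrightarrow>
        mul (mul h k) l = mul h (mul k l)"
    and mul_Z_H: "w \<in> W \<Longrightarrow> mul (bas \<mu> id) (bas 0 w) = bas \<mu> w"
    and mul_Z_Z: "mul (bas \<mu> id) (bas \<nu> id) = bas (\<mu> + \<nu>) id"
    and mul_H_H_up: "i \<in> I \<Longrightarrow> w \<in> W \<Longrightarrow> len (r i \<circ> w) = len w + 1 \<Longrightarrow>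
        mul (bas 0 (r i)) (bas 0 w) = bas 0 (r i \<circ> w)"
    and mul_H_H_down: "i \<in> I \<Longrightarrow> w \<in> W \<Longrightarrow> len w = len (r i \<circ> w) + 1 \<Longrightarrow>
        mul (bas 0 (r i)) (bas 0 w) =
          hscale (\<sigma> i - inverse (\<sigma> i)) (bas 0 w) + bas 0 (r i \<circ> w)"
    \<comment> \<open>The right-hand side of the next relation is the element \<open>R\<close> of \<open>\<complex>[Y]\<close> equal to the fraction
        \<open>Q\<^sub>s(Z) (Z\<^sup>\<mu> - Z\<^sup>s\<^sup>\<mu>)\<close>.\<close>
    and mul_H_Z: "i \<in> I \<Longrightarrow>
        \<exists>R. frac_eq (R, 1) (Qnum i * (Zmon \<mu> - Zmon (r i \<mu>)), Qden i) \<and>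
            mul (bas 0 (r i)) (bas \<mu> id) - mul (bas (r i \<mu>) id) (bas 0 (r i)) = emb R"
begin

definition H :: "'y hecke ring" where
  "H = \<lparr>carrier = Hspace, monoid.mult = mul, monoid.one = bas 0 id, ring.zero = 0, ring.add = (+)\<rparr>"

text \<open>
  \<open>I_mod \<tau>\<close> is \<open>H \<otimes>\<^bsub>\<complex>[Y]\<^esub> \<complex>\<close>, where \<open>\<complex>[Y]\<close> acts on \<open>\<complex>\<close> through \<open>\<tau>\<close>.
\<close>

definition I_mod :: "('y \<Rightarrow> complex) \<Rightarrow> ('y hecke, 'y induced) module" where
  "I_mod \<tau> = tensor_module H (\<lambda>h P. mul h (emb P)) (\<lambda>P c. evalt \<tau> P * c)"

definition one_tensor_one :: "('y \<Rightarrow> complex) \<Rightarrow> 'y induced" where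
  "one_tensor_one \<tau> =
     pure_tensor H (\<lambda>h P. mul h (emb P)) (\<lambda>P c. evalt \<tau> P * c) \<one>\<^bsub>H\<^esub> 1"

text \<open>The complex vector space structure of \<open>I_mod \<tau>\<close> is given by the scalars \<open>c \<cdot> 1\<close> in \<open>H\<close>.\<close>

definition cscale :: "('y \<Rightarrow> complex) \<Rightarrow> complex \<Rightarrow> 'y induced \<Rightarrow> 'y induced" where
  "cscale \<tau> c x = hscale c \<one>\<^bsub>H\<^esub> \<odot>\<^bsub>I_mod \<tau>\<^esub> x"

definition weight_space :: "('y \<Rightarrow> complex) \<Rightarrow> 'y induced set" where
  "weight_space \<tau> =
     {x \<in> carrier (I_mod \<tau>). \<forall>P. emb P \<odot>\<^bsub>I_mod \<tau>\<^esub> x = cscale \<tau> (evalt \<tau> P) x}"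

definition C_one_tensor_one :: "('y \<Rightarrow> complex) \<Rightarrow> 'y induced set" where
  "C_one_tensor_one \<tau> = {cscale \<tau> c (one_tensor_one \<tau>) | c. True}"

definition scalar_End :: "('y \<Rightarrow> complex) \<Rightarrow> ('y induced \<Rightarrow> 'y induced) set" where
  "scalar_End \<tau> = {\<lambda>x\<in>carrier (I_mod \<tau>). cscale \<tau> c x | c. True}"

end

end

(*
  I_tau is the quotient of the algebra by the left ideal L tau generated by the Z^mu - tau(mu), and
  endomorphisms of I_tau correspond to vectors of weight tau.  Every vector of I_tau generates, over
  C[Y], a vector of some weight tau o w.  Where Q_s is regular, H_s - Q_s(chi) maps weight chi to
  weight chi o s, and going back and forth multiplies by 1 + Q_s(chi) Q_s(chi o s), which is, up to a
  non-zero factor, the product of the values of the numerators of zeta at chi and chi o s; where Q_s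
  is singular, chi o s = chi.

  If tau lies in U, a non-zero submodule therefore contains a non-zero vector of weight tau, hence
  1 (x) 1 when these vectors are scalars.  Conversely, if I_tau is irreducible, Schur's lemma gives the
  scalars, and the modules I_(tau o w) embed into I_tau one reflection at a time: a vanishing
  numerator would make the intertwiner from I_chi to I_(chi o s) neither zero nor injective.
*)

theory Submission
  imports
    Defs
    "Jordan_Normal_Form.Determinant"
    "HOL-Analysis.Continuum_Not_Denumerable"
    "HOL-Computational_Algebra.Fundamental_Theorem_Algebra"
begin

section \<open>Integer multiples and the Weyl group\<close>

text \<open>The relations present the algebra with \<complex>[Y] on the left, while the tensor
  product imposes relations on the right; so it is not visible at the start that
  \<open>L \<tau>\<close> is proper. The map \<open>flip_H\<close>, anti-multiplicative and fixing
  Z^mu and H_s, exchanges the sides and yields functionals vanishing on \<open>L \<tau>\<close>. It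
  needs right-handed multiplication rules, hence that a simple reflection changes the length by
  exactly one; determinants on Y give this.

  For infinite W the module is infinite-dimensional. Weight vectors come instead from each single
  vector being annihilated by a finite product of operators Z^mu - chi(mu), and Schur's lemma from
  setting countable dimension against an uncountable field.

  The factor 1 + Q Q', where Q' is Q at the reflected weight, equals (sigma - Q) (sigma - Q')
  because Q + Q' = sigma - sigma^-1, and sigma - Q is zeta / sigma. The conditions on sigma' ensure
  that the explicit numerator and denominator of zeta have no common zero; the condition for
  alpha_s(Y) = \<int> makes a weight at which Q is singular fixed by s.\<close>

abbreviation winv :: "('a \<Rightarrow> 'b) \<Rightarrow> 'b \<Rightarrow> 'a" where
  "winv w \<equiv> inv_into UNIV w"

lemma zscale_0 [simp]: "zscale 0 y = 0"
  by (simp add: zscale_def)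

lemma zscale_add_1: "zscale (n + 1) y = y + zscale n y"
proof (cases "n \<ge> 0")
  case True
  then have "nat (n + 1) = Suc (nat n)" by simp
  with True show ?thesis by (simp add: zscale_def)
next
  case False
  \<comment> \<open>With n = -(k + 1) both values are negated iterates; n + 1 = -k stays correct at
    k = 0, where the non-negative branch of the definition applies.\<close>
  define k where "k = nat (- n - 1)"
  have k: "n = - int (Suc k)" using False by (simp add: k_def)
  have "zscale (- int k) y = - (((+) y ^^ k) 0)"
    by (simp add: zscale_def)
  then have "zscale (n + 1) y = - (((+) y ^^ k) 0)" by (simp add: k)
  moreover have "zscale n y = - (((+) y ^^ Suc k) 0)"
    unfolding k zscale_def by (simp del: funpow.simps of_nat_Suc)
  ultimately show ?thesis by simp
qed

lemma zscale_1 [simp]: "zscale 1 y = y"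
  using zscale_add_1[of 0 y] by simp

lemma zscale_diff_1: "zscale (n - 1) y = zscale n y - y"
  using zscale_add_1[of "n - 1" y] by simp

lemma zscale_add: "zscale (m + n) y = zscale m y + zscale n y"
proof (induction m rule: int_induct[where k = 0])
  case (step1 i)
  then show ?case using zscale_add_1[of "i + n" y] zscale_add_1[of i y] by (simp add: algebra_simps)
next
  case (step2 i)
  then show ?case using zscale_diff_1[of "i + n" y] zscale_diff_1[of i y] by (simp add: add.commute add.left_commute add_diff_eq diff_add_eq)
qed simp

lemma zscale_minus: "zscale (- n) y = - zscale n y"
  using zscale_add[of "- n" n y] by (simp add: eq_neg_iff_add_eq_0)

lemma zscale_diff: "zscale (m - n) y = zscale m y - zscale n y"
  using zscale_add[of m "- n" y] by (simp add: zscale_minus)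

lemma additive_zscale:
  assumes "Modules.additive f"
  shows "f (zscale n y) = zscale n (f y)"
proof -
  interpret Modules.additive f by fact
  show ?thesis
    by (induction n rule: int_induct[where k = 0]) (simp_all add: zscale_add_1 zscale_diff_1 zero add diff)
qed

lemma zscale_int: "zscale n (k :: int) = n * k"
  by (induction n rule: int_induct[where k = 0])
    (simp_all add: zscale_add_1 zscale_diff_1 algebra_simps)

lemma additive_int_zscale:
  assumes "Modules.additive (f :: 'y::ab_group_add \<Rightarrow> int)"
  shows "f (zscale n y) = n * f y"
  by (simp add: additive_zscale[OF assms] zscale_int)

lemma zscale_add_right: "zscale n (x + y) = zscale n x + zscale n y"
  by (induction n rule: int_induct[where k = 0])
    (simp_all add: zscale_add_1 zscale_diff_1 algebra_simps)

lemma additive_zscale_left: "Modules.additive (\<lambda>n. zscale n y)"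
  by unfold_locales (rule zscale_add)

lemma zscale_sum_left: "zscale (\<Sum>i\<in>S. f i) y = (\<Sum>i\<in>S. zscale (f i) y)"
  by (rule additive.sum[OF additive_zscale_left])

lemma zscale_mult: "zscale (m * n) y = zscale m (zscale n y)"
  by (induction m rule: int_induct[where k = 0])
    (simp_all add: zscale_add_1 zscale_diff_1 zscale_add zscale_diff algebra_simps)

section \<open>Simple reflections, words and the group \<open>W\<close>\<close>

context root_generating_system begin

lemma additive_\<alpha>: "i \<in> I \<Longrightarrow> Modules.additive (\<alpha> i)"
  by unfold_locales (rule root_additive)

lemma \<alpha>_\<alpha>v: "i \<in> I \<Longrightarrow> \<alpha> i (\<alpha>v i) = 2"
  by (simp add: pairing A_diag)

lemma additive_r: "i \<in> I \<Longrightarrow> Modules.additive (r i)"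
  by unfold_locales (simp add: r_def root_additive zscale_add)

lemma r_r: "i \<in> I \<Longrightarrow> r i (r i v) = v"
proof -
  assume i: "i \<in> I"
  have "\<alpha> i (r i v) = - \<alpha> i v"
    using i by (simp add: r_def additive.diff[OF additive_\<alpha>] additive_int_zscale[OF additive_\<alpha>] \<alpha>_\<alpha>v)
  then show ?thesis by (simp add: r_def[of i "r i v"] zscale_minus) (simp add: r_def)
qed

lemma r_comp_r: "i \<in> I \<Longrightarrow> r i \<circ> r i = id"
  by (auto simp: r_r)

lemma r_\<alpha>v: "i \<in> I \<Longrightarrow> r i (\<alpha>v i) = - \<alpha>v i"
  using zscale_add_1[of 1 "\<alpha>v i"] by (simp add: r_def \<alpha>_\<alpha>v)

lemma r_in_Bij: "i \<in> I \<Longrightarrow> r i \<in> Bij UNIV"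
  by (auto simp: Bij_def intro!: o_bij[OF r_comp_r r_comp_r])

lemma BijGroup_UNIV_simps:
  "x \<in> Bij UNIV \<Longrightarrow> y \<in> Bij UNIV \<Longrightarrow> x \<otimes>\<^bsub>BijGroup UNIV\<^esub> y = x \<circ> y"
  "\<one>\<^bsub>BijGroup (UNIV :: 'y set)\<^esub> = id"
  "carrier (BijGroup (UNIV :: 'y set)) = Bij UNIV"
  by (auto simp: BijGroup_def compose_def)

lemma word_simps [simp]: "word [] = id" "word (i # ks) = r i \<circ> word ks"
  by (simp_all add: word_def)

lemma word_append: "word (ks @ ls) = word ks \<circ> word ls"
  by (induction ks) (auto simp: o_assoc)

lemma word_Bij: "set ks \<subseteq> I \<Longrightarrow> word ks \<in> Bij UNIV"
proof (induction ks)
  case Nil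
  show "word [] \<in> Bij UNIV" by (simp add: Bij_def)
next
  case (Cons i ks)
  then show "word (i # ks) \<in> Bij UNIV" using r_in_Bij[of i] by (simp add: Bij_def bij_comp)
qed

lemma word_in_W: "set ks \<subseteq> I \<Longrightarrow> word ks \<in> W"
proof (induction ks)
  case Nil
  then show ?case
    using generate.one[of "BijGroup UNIV" "r ` I"] by (simp only: W_def BijGroup_UNIV_simps word_simps)
next
  case (Cons i ks)
  then show "word (i # ks) \<in> W"
    using generate.eng[of "r i" "BijGroup UNIV" "r ` I" "word ks"]
    by (auto simp: W_def BijGroup_UNIV_simps r_in_Bij word_Bij generate.incl)
qed

text \<open>Inverses produced by \<open>generate\<close> require no letters of their own, because
  each simple reflection is its own inverse.\<close>

lemma W_word: assumes "w \<in> W" shows "\<exists>ks. set ks \<subseteq> I \<and> w = word ks"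
proof -
  interpret B: group "BijGroup (UNIV :: 'y set)" by (rule group_BijGroup)
  from assms show ?thesis unfolding W_def
  proof (induction rule: generate.induct)
    case one
    then show ?case by (intro exI[of _ "[]"]) (simp add: BijGroup_UNIV_simps)
  next
    case (incl h)
    then obtain i where "i \<in> I" "h = r i" by auto
    then show ?case by (intro exI[of _ "[i]"]) simp
  next
    case (inv h)
    then obtain i where i: "i \<in> I" "h = r i" by auto
    then have "inv\<^bsub>BijGroup UNIV\<^esub> h = h"
      by (intro B.inv_equality) (simp_all add: BijGroup_UNIV_simps r_in_Bij r_comp_r)
    then show ?case using i by (intro exI[of _ "[i]"]) simp
  next
    case (eng h1 h2)
    then obtain ks ls where "set ks \<subseteq> I" "h1 = word ks" "set ls \<subseteq> I" "h2 = word ls" by auto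
    then show ?case
      by (intro exI[of _ "ks @ ls"]) (simp add: BijGroup_UNIV_simps word_Bij word_append)
  qed
qed

lemma id_in_W [simp]: "id \<in> W"
  using word_in_W[of "[]"] by simp

lemma r_in_W [simp]: "i \<in> I \<Longrightarrow> r i \<in> W"
  using word_in_W[of "[i]"] by simp

lemma comp_in_W [simp]: "v \<in> W \<Longrightarrow> w \<in> W \<Longrightarrow> v \<circ> w \<in> W"
  using W_word[of v] W_word[of w] word_in_W by (metis set_append sup.boundedI word_append)

lemma additive_word: "set ks \<subseteq> I \<Longrightarrow> Modules.additive (word ks)"
proof (induction ks)
  case Nil
  show ?case by unfold_locales simp
next
  case (Cons i ks)
  interpret a: Modules.additive "r i" using Cons.prems by (simp add: additive_r)
  interpret b: Modules.additive "word ks" using Cons by simp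
  show ?case by unfold_locales (simp add: a.add b.add)
qed

lemma additive_W: "w \<in> W \<Longrightarrow> Modules.additive w"
  using W_word additive_word by blast

lemma word_rev: "set ks \<subseteq> I \<Longrightarrow> word (rev ks) \<circ> word ks = id"
proof (induction ks)
  case (Cons i ks)
  have "word (rev (i # ks)) \<circ> word (i # ks) = word (rev ks) \<circ> (r i \<circ> r i) \<circ> word ks"
    by (simp add: word_append o_assoc)
  also have "\<dots> = word (rev ks) \<circ> word ks" using Cons.prems by (simp only: r_comp_r list.set insert_subset o_id)
  finally show "word (rev (i # ks)) \<circ> word (i # ks) = id" using Cons by (simp add: fun_eq_iff)
qed simp

lemma bij_W: "w \<in> W \<Longrightarrow> bij w"
  using W_word[of w] word_Bij by (auto simp: Bij_def)

lemma inv_word: assumes "set ks \<subseteq> I" shows "winv (word ks) = word (rev ks)"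
proof (rule inv_unique_comp)
  show "word ks \<circ> word (rev ks) = id" using word_rev[of "rev ks"] assms by simp
qed (rule word_rev[OF assms])

lemma inv_in_W [simp]: "w \<in> W \<Longrightarrow> winv w \<in> W"
  using W_word[of w] inv_word word_in_W by (metis set_rev)

lemma inv_r [simp]: "i \<in> I \<Longrightarrow> winv (r i) = r i"
  using inv_word[of "[i]"] by simp

lemma inv_comp_W: "v \<in> W \<Longrightarrow> w \<in> W \<Longrightarrow> winv (v \<circ> w) = winv w \<circ> winv v"
  by (simp add: o_inv_distrib bij_W)

lemma inv_inv_W: "w \<in> W \<Longrightarrow> winv (winv w) = w"
  by (simp add: inv_inv_eq bij_W)

section \<open>The length function\<close>

lemma len_le: "set ks \<subseteq> I \<Longrightarrow> len (word ks) \<le> length ks"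
  unfolding len_def by (rule Least_le) auto

lemma reduced_word: assumes "w \<in> W" obtains ks where "set ks \<subseteq> I" "w = word ks" "length ks = len w"
proof -
  have "\<exists>n ks. set ks \<subseteq> I \<and> length ks = n \<and> word ks = w" using W_word[OF assms] by auto
  from LeastI_ex[OF this] show ?thesis using that unfolding len_def by auto
qed

lemma len_inv_le: assumes "w \<in> W" shows "len (winv w) \<le> len w"
proof -
  obtain ks where "set ks \<subseteq> I" "w = word ks" "length ks = len w" using reduced_word[OF assms] .
  then show ?thesis using len_le[of "rev ks"] by (simp add: inv_word)
qed

lemma len_inv: "w \<in> W \<Longrightarrow> len (winv w) = len w"
  using len_inv_le[of w] len_inv_le[of "winv w"] by (simp add: inv_inv_W)

lemma len_r_comp_le: assumes "i \<in> I" "w \<in> W" shows "len (r i \<circ> w) \<le> len w + 1"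
proof -
  obtain ks where "set ks \<subseteq> I" "w = word ks" "length ks = len w" using reduced_word[OF assms(2)] .
  then show ?thesis using len_le[of "i # ks"] assms by simp
qed

end

section \<open>Parity of the length\<close>

text \<open>The matrix determinant lemma. With U, V the column and row of u and v, the products
  [M U; 0 1] [1 0; V 1] and [1 0; V 1] [1 U; 0 1 - V U] agree, and the common factor has determinant
  1.\<close>

lemma det_one_minus_rank_one:
  fixes u v :: "nat \<Rightarrow> int"
  shows "det (mat n n (\<lambda>(j, k). (if j = k then 1 else 0) - u j * v k)) = 1 - (\<Sum>k<n. v k * u k)"
proof -
  define U where "U = mat n 1 (\<lambda>(j, k). u j)"
  define V where "V = mat 1 n (\<lambda>(j, k). v k)"
  define M where "M = mat n n (\<lambda>(j, k). (if j = k then 1 else 0) - u j * v k)"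
  define S where "S = mat 1 1 (\<lambda>_. 1 - (\<Sum>k<n. v k * u k))"
  have c [simp]: "U \<in> carrier_mat n 1" "V \<in> carrier_mat 1 n" "M \<in> carrier_mat n n" "S \<in> carrier_mat 1 1"
    by (simp_all add: U_def V_def M_def S_def)
  \<comment> \<open>The simplifier turns the dimension \<open>1\<close> into \<open>Suc 0\<close>,
    so the carrier facts are kept in both shapes.\<close>
  note c' [simp] = c[unfolded One_nat_def]
  let ?L = "four_block_mat (1\<^sub>m n) (0\<^sub>m n 1) V (1\<^sub>m 1)"
  have "four_block_mat M U (0\<^sub>m 1 n) (1\<^sub>m 1) * ?L
      = four_block_mat (M * 1\<^sub>m n + U * V) (M * 0\<^sub>m n 1 + U * 1\<^sub>m 1)
          (0\<^sub>m 1 n * 1\<^sub>m n + 1\<^sub>m 1 * V) (0\<^sub>m 1 n * 0\<^sub>m n 1 + 1\<^sub>m 1 * 1\<^sub>m 1)"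
    by (rule mult_four_block_mat[of _ n n _ 1 _ 1 _ _ n _ 1]) (auto simp: U_def V_def)
  also have "M * 1\<^sub>m n + U * V = 1\<^sub>m n * 1\<^sub>m n + 0\<^sub>m n 1 * 0\<^sub>m 1 n"
    by (rule eq_matI) (auto simp: M_def U_def V_def scalar_prod_def)
  also have "M * 0\<^sub>m n 1 + U * 1\<^sub>m 1 = 1\<^sub>m n * U + 0\<^sub>m n 1 * S"
    by (rule eq_matI) (auto simp: M_def U_def S_def scalar_prod_def)
  also have "0\<^sub>m 1 n * 1\<^sub>m n + 1\<^sub>m 1 * V = V * 1\<^sub>m n + 1\<^sub>m 1 * 0\<^sub>m 1 n"
    by (rule eq_matI) (auto simp: V_def S_def scalar_prod_def)
  also have "0\<^sub>m 1 n * 0\<^sub>m n 1 + 1\<^sub>m 1 * 1\<^sub>m 1 = V * U + 1\<^sub>m 1 * S"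
    by (rule eq_matI) (auto simp: U_def V_def S_def scalar_prod_def lessThan_atLeast0)
  also have "four_block_mat (1\<^sub>m n * 1\<^sub>m n + 0\<^sub>m n 1 * 0\<^sub>m 1 n) (1\<^sub>m n * U + 0\<^sub>m n 1 * S)
      (V * 1\<^sub>m n + 1\<^sub>m 1 * 0\<^sub>m 1 n) (V * U + 1\<^sub>m 1 * S)
      = ?L * four_block_mat (1\<^sub>m n) U (0\<^sub>m 1 n) S"
    by (rule mult_four_block_mat[of _ n n _ 1 _ 1 _ _ n _ 1, symmetric]) auto
  finally have "four_block_mat M U (0\<^sub>m 1 n) (1\<^sub>m 1) * ?L = ?L * four_block_mat (1\<^sub>m n) U (0\<^sub>m 1 n) S" .
  then have "det (four_block_mat M U (0\<^sub>m 1 n) (1\<^sub>m 1)) * det ?L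
           = det ?L * det (four_block_mat (1\<^sub>m n) U (0\<^sub>m 1 n) S)"
    using four_block_carrier_mat[of M n n "1\<^sub>m 1" 1 1] four_block_carrier_mat[of "1\<^sub>m n" n n S 1 1]
    by (subst (1 2) det_mult[symmetric, where n = "n + 1"]) auto
  then show ?thesis
    by (simp add: det_four_block_mat_upper_right_zero[of _ n _ 1] det_four_block_mat_lower_left_zero[of _ n _ 1]
        M_def[symmetric]) (simp add: S_def det_single)
qed

text \<open>Numbers the basis by an initial segment of the naturals so that matrices can be used.
  Uniqueness is phrased for arbitrary coefficients: any expansion that can be exhibited determines
  the coordinates.\<close>

lemma (in root_generating_system) ex_coordinates:
  "\<exists>n (e :: nat \<Rightarrow> 'y) co. (\<forall>y. y = (\<Sum>j<n. zscale (co y j) (e j))) \<and>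
     (\<forall>y c. y = (\<Sum>j<n. zscale (c j) (e j)) \<longrightarrow> (\<forall>j<n. c j = co y j))"
proof -
  obtain B :: "'y set" where B: "finite B" "z_free_family B (\<lambda>b. b)" "z_spanning B" using Y_free by blast
  obtain e where e: "bij_betw e {..<card B} B"
    using B(1) ex_bij_betw_nat_finite[of B] by (auto simp: lessThan_atLeast0)
  define f where "f = inv_into {..<card B} e"
  have fe: "f (e j) = j" if "j < card B" for j
    using e that by (auto simp: f_def bij_betw_def)
  have sum_B: "(\<Sum>b\<in>B. zscale (c b) b) = (\<Sum>j<card B. zscale (c (e j)) (e j))" for c
    by (rule sum.reindex_bij_betw[OF e, symmetric])
  have "\<exists>c :: nat \<Rightarrow> int. y = (\<Sum>j<card B. zscale (c j) (e j))" for y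
  proof -
    obtain c where "y = (\<Sum>b\<in>B. zscale (c b) b)" using B(3) unfolding z_spanning_def by blast
    then show ?thesis by (intro exI[of _ "c \<circ> e"]) (simp add: sum_B)
  qed
  then obtain co where co: "\<And>y. y = (\<Sum>j<card B. zscale (co y j) (e j))" by metis
  have "c j = d j" if "(\<Sum>j<card B. zscale (c j) (e j)) = (\<Sum>j<card B. zscale (d j) (e j))" "j < card B"
    for c d :: "nat \<Rightarrow> int" and j
  proof -
    have "(\<Sum>b\<in>B. zscale (c (f b) - d (f b)) b) = 0"
      using that by (simp add: sum_B fe zscale_diff sum_subtractf)
    then have "\<forall>b\<in>B. c (f b) - d (f b) = 0"
      using B(2)[unfolded z_free_family_def, rule_format, of "\<lambda>b. c (f b) - d (f b)"] by blast
    moreover have "e j \<in> B" using e that by (auto simp: bij_betw_def)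
    ultimately have "c (f (e j)) - d (f (e j)) = 0" by blast
    then show ?thesis using that(2) by (simp add: fe)
  qed
  then show ?thesis using co by (intro exI[of _ "card B"] exI[of _ e] exI[of _ co]) metis
qed

context root_generating_system begin

text \<open>The determinant on \<open>Y\<close>: it makes the parity of the length of a word well defined.\<close>

lemma ex_sign: "\<exists>d :: ('y \<Rightarrow> 'y) \<Rightarrow> int. \<forall>ks. set ks \<subseteq> I \<longrightarrow> d (word ks) = (-1) ^ length ks"
proof -
  obtain n and e :: "nat \<Rightarrow> 'y" and co where
    co: "\<And>y. y = (\<Sum>j<n. zscale (co y j) (e j))" and
    uniq: "\<And>y c j. y = (\<Sum>j<n. zscale (c j) (e j)) \<Longrightarrow> j < n \<Longrightarrow> c j = co y j"
    using ex_coordinates by metis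
  have co_eqI: "co y j = c j" if "y = (\<Sum>j<n. zscale (c j) (e j))" "j < n" for y c j
    using uniq[OF that] by simp
  have co_lin: "co (\<Sum>l<n. zscale (a l) (g l)) j = (\<Sum>l<n. a l * co (g l) j)" if "j < n" for a g j
  proof (rule co_eqI[OF _ that])
    have "(\<Sum>l<n. zscale (a l) (g l)) = (\<Sum>l<n. zscale (a l) (\<Sum>j<n. zscale (co (g l) j) (e j)))"
      using co by simp
    also have "\<dots> = (\<Sum>l<n. \<Sum>j<n. zscale (a l * co (g l) j) (e j))"
      by (subst additive.sum[of "zscale _"]) (auto simp: zscale_mult zscale_add_right Modules.additive_def)
    also have "\<dots> = (\<Sum>j<n. \<Sum>l<n. zscale (a l * co (g l) j) (e j))"
      by (rule sum.swap)
    finally show "(\<Sum>l<n. zscale (a l) (g l)) = (\<Sum>j<n. zscale (\<Sum>l<n. a l * co (g l) j) (e j))"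
      by (simp add: zscale_sum_left)
  qed
  define M where "M w = mat n n (\<lambda>(j, k). co (w (e k)) j)" for w
  have M_carrier [simp]: "M w \<in> carrier_mat n n" for w by (simp add: M_def)
  have co_e: "co (e k) j = (if j = k then 1 else 0)" if "j < n" "k < n" for j k
  proof (rule co_eqI[OF _ that(1)])
    have "(\<Sum>j<n. zscale (if j = k then 1 else 0) (e j)) = (\<Sum>j<n. if j = k then e k else 0)"
      by (rule sum.cong) auto
    then show "e k = (\<Sum>j<n. zscale (if j = k then 1 else 0) (e j))"
      using that by simp
  qed
  have M_comp: "M (u \<circ> v) = M u * M v" if "Modules.additive u" for u v
  proof (rule eq_matI)
    fix j k assume "j < dim_row (M u * M v)" "k < dim_col (M u * M v)"
    then have jk: "j < n" "k < n" by (auto simp: M_def)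
    have "u (v (e k)) = u (\<Sum>l<n. zscale (co (v (e k)) l) (e l))" using co by simp
    also have "\<dots> = (\<Sum>l<n. zscale (co (v (e k)) l) (u (e l)))"
      by (simp add: additive.sum[OF that] additive_zscale[OF that])
    finally have "co (u (v (e k))) j = (\<Sum>l<n. co (v (e k)) l * co (u (e l)) j)"
      using co_lin[OF jk(1)] by simp
    then show "M (u \<circ> v) $$ (j, k) = (M u * M v) $$ (j, k)"
      using jk by (simp add: M_def scalar_prod_def lessThan_atLeast0 mult.commute)
  qed (auto simp: M_def)
  \<comment> \<open>In coordinates r_i is the identity minus a rank-one matrix built from
    \<open>\<alpha>v i\<close> and \<open>\<alpha> i\<close>; the determinant is 1 -
    \<open>\<alpha> i (\<alpha>v i)\<close>, that is, 1 - 2.\<close>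
  have det_r: "det (M (r i)) = -1" if i: "i \<in> I" for i
  proof -
    have "co (r i (e k)) j = (if j = k then 1 else 0) - co (\<alpha>v i) j * \<alpha> i (e k)" if "j < n" "k < n" for j k
    proof -
      have "co (r i (e k)) j = co (e k) j - \<alpha> i (e k) * co (\<alpha>v i) j"
      proof (rule co_eqI[OF _ that(1)])
        have "r i (e k) = (\<Sum>j<n. zscale (co (e k) j) (e j)) - zscale (\<alpha> i (e k)) (\<Sum>j<n. zscale (co (\<alpha>v i) j) (e j))"
          using co by (simp add: r_def)
        also have "zscale (\<alpha> i (e k)) (\<Sum>j<n. zscale (co (\<alpha>v i) j) (e j)) = (\<Sum>j<n. zscale (\<alpha> i (e k) * co (\<alpha>v i) j) (e j))"
          by (subst additive.sum[of "zscale _"]) (auto simp: zscale_mult zscale_add_right Modules.additive_def)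
        finally show "r i (e k) = (\<Sum>j<n. zscale (co (e k) j - \<alpha> i (e k) * co (\<alpha>v i) j) (e j))"
          by (simp add: zscale_diff sum_subtractf)
      qed
      then show ?thesis using that by (simp add: co_e)
    qed
    then have "M (r i) = mat n n (\<lambda>(j, k). (if j = k then 1 else 0) - co (\<alpha>v i) j * \<alpha> i (e k))"
      unfolding M_def by (intro eq_matI) auto
    then have "det (M (r i)) = 1 - (\<Sum>k<n. \<alpha> i (e k) * co (\<alpha>v i) k)"
      by (simp only: det_one_minus_rank_one)
    also have "(\<Sum>k<n. \<alpha> i (e k) * co (\<alpha>v i) k) = \<alpha> i (\<Sum>k<n. zscale (co (\<alpha>v i) k) (e k))"
      using i by (simp add: additive.sum[OF additive_\<alpha>] additive_int_zscale[OF additive_\<alpha>] mult.commute)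
    also have "\<dots> = 2" using co[of "\<alpha>v i"] i by (simp add: \<alpha>_\<alpha>v)
    finally show ?thesis by simp
  qed
  have M_id: "M id = 1\<^sub>m n"
    by (rule eq_matI) (auto simp: M_def co_e)
  have "det (M (word ks)) = (-1) ^ length ks" if "set ks \<subseteq> I" for ks
    using that
  proof (induction ks)
    case Nil
    show "det (M (word [])) = (-1) ^ length []" by (simp add: M_id)
  next
    case (Cons i ks)
    then have "det (M (word (i # ks))) = det (M (r i)) * det (M (word ks))"
      by (simp add: M_comp additive_r det_mult[of _ n])
    then show "det (M (word (i # ks))) = (-1) ^ length (i # ks)" using Cons det_r by simp
  qed
  then show ?thesis by (intro exI[of _ "\<lambda>w. det (M w)"]) blast
qed

text \<open>The length moves by at most one, and the determinant excludes that it stays. So the two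
  assumed rules for H_s H_w cover every case.\<close>

lemma len_r_comp: assumes "i \<in> I" "w \<in> W"
  shows "len (r i \<circ> w) = len w + 1 \<or> len w = len (r i \<circ> w) + 1"
proof -
  obtain d :: "('y \<Rightarrow> 'y) \<Rightarrow> int" where d: "\<And>ks. set ks \<subseteq> I \<Longrightarrow> d (word ks) = (-1) ^ length ks"
    using ex_sign by blast
  have parity: "d v = (-1) ^ len v" if v: "v \<in> W" for v
    using reduced_word[OF v] d by metis
  obtain ks where ks: "set ks \<subseteq> I" "w = word ks" using W_word[OF assms(2)] by blast
  then have "d (r i \<circ> w) = - d w" using d[of "i # ks"] d[of ks] assms by simp
  then have "len (r i \<circ> w) \<noteq> len w" using parity assms by auto
  moreover have "len (r i \<circ> w) \<le> len w + 1" by (rule len_r_comp_le[OF assms])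
  moreover have "len w \<le> len (r i \<circ> w) + 1"
    using len_r_comp_le[of i "r i \<circ> w"] assms by (simp add: o_assoc r_comp_r)
  ultimately show ?thesis by linarith
qed

lemma len_comp_r: assumes "i \<in> I" "w \<in> W"
  shows "len (w \<circ> r i) = len w + 1 \<or> len w = len (w \<circ> r i) + 1"
proof -
  have "len (r i \<circ> winv w) = len (w \<circ> r i)"
    using assms len_inv[of "w \<circ> r i"] by (simp add: inv_comp_W)
  then show ?thesis using len_r_comp[of i "winv w"] assms by (simp add: len_inv)
qed

lemma len_id [simp]: "len id = 0"
  using len_le[of "[]"] by simp

lemma len_r: "i \<in> I \<Longrightarrow> len (r i) = 1"
  using len_r_comp[of i id] by simp

lemma reduced_word_Cons:
  assumes "i \<in> I" "set ks \<subseteq> I" "len (word (i # ks)) = length (i # ks)"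
  shows "len (word ks) = length ks" "len (word (i # ks)) = len (word ks) + 1"
  using assms len_r_comp_le[of i "word ks"] len_le[of ks] by (simp_all add: word_in_W)

end

section \<open>The group algebra and the reduced form of \<open>\<zeta>\<close>\<close>

lemma poly_mapping_induct [case_names zero single add]:
  fixes f :: "'a \<Rightarrow>\<^sub>0 'b::comm_monoid_add"
  assumes "P 0" "\<And>k c. P (Poly_Mapping.single k c)" "\<And>f g. P f \<Longrightarrow> P g \<Longrightarrow> P (f + g)"
  shows "P f"
proof -
  have "P (\<Sum>k\<in>K. Poly_Mapping.single k (Poly_Mapping.lookup f k))" if "finite K" for K
    using that by (induction K) (simp_all add: assms)
  moreover have "f = (\<Sum>k\<in>Poly_Mapping.keys f. Poly_Mapping.single k (Poly_Mapping.lookup f k))"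
    by (rule poly_mapping_eqI) (simp add: lookup_sum lookup_single when_def in_keys_iff)
  ultimately show ?thesis by (metis finite_keys)
qed

lemma evalt_add: "evalt \<tau> (P + Q) = evalt \<tau> P + evalt \<tau> Q"
  unfolding evalt_def by (rule setsum_keys_plus_distrib) (auto simp: algebra_simps)

lemma evalt_single [simp]: "evalt \<tau> (Poly_Mapping.single \<mu> c) = c * \<tau> \<mu>"
  by (auto simp: evalt_def)

lemma additive_evalt: "Modules.additive (evalt \<tau>)"
  by unfold_locales (rule evalt_add)

lemmas evalt_diff = additive.diff[OF additive_evalt]
  and evalt_zero [simp] = additive.zero[OF additive_evalt]

lemma torus_add: "\<tau> \<in> torus \<Longrightarrow> \<tau> (\<mu> + \<nu>) = \<tau> \<mu> * \<tau> \<nu>"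
  by (simp add: torus_def)

lemma torus_nz: "\<tau> \<in> torus \<Longrightarrow> \<tau> \<mu> \<noteq> 0"
  by (simp add: torus_def)

lemma torus_0 [simp]: "\<tau> \<in> torus \<Longrightarrow> \<tau> 0 = 1"
  using torus_add[of \<tau> 0 0] torus_nz[of \<tau> 0] by simp

lemma torus_minus: "\<tau> \<in> torus \<Longrightarrow> \<tau> (- \<mu>) = inverse (\<tau> \<mu>)"
  using torus_add[of \<tau> "- \<mu>" \<mu>] by (simp add: field_simps torus_nz)

lemma torus_zscale: assumes "\<tau> \<in> torus" shows "\<tau> (zscale n \<mu>) = \<tau> \<mu> powi n"
proof (induction n rule: int_induct[where k = 0])
  case (step1 n)
  then show ?case using assms by (simp add: zscale_add_1 torus_add power_int_add_1' torus_nz)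
next
  case (step2 n)
  have "\<tau> (zscale (n - 1) \<mu> + \<mu>) = \<tau> (zscale n \<mu>)" by (simp add: zscale_diff_1)
  then show ?case using step2 assms
    by (simp add: torus_add power_int_diff torus_nz field_simps)
qed (use assms in simp)

lemma torus_comp: "\<tau> \<in> torus \<Longrightarrow> Modules.additive w \<Longrightarrow> \<tau> \<circ> w \<in> torus"
  by (simp add: torus_def Modules.additive_def)

lemma evalt_mult: assumes "\<tau> \<in> torus" shows "evalt \<tau> (P * Q) = evalt \<tau> P * evalt \<tau> Q"
proof (induction P rule: poly_mapping_induct)
  case (single k c)
  show ?case
  proof (induction Q rule: poly_mapping_induct)
    case (single k c)
    show ?case using assms by (simp add: mult_single torus_add)
  qed (simp_all add: evalt_add algebra_simps)
qed (simp_all add: evalt_add algebra_simps)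

lemma evalt_one [simp]: "\<tau> \<in> torus \<Longrightarrow> evalt \<tau> 1 = 1"
  by (simp flip: single_one)

lemma evalt_unit: assumes "\<tau> \<in> torus" "e dvd 1" shows "evalt \<tau> e \<noteq> 0"
  using assms by (metis dvdE evalt_mult evalt_one mult_zero_left zero_neq_one)

lemma evalt_Zmon [simp]: "evalt \<tau> (Zmon \<mu>) = \<tau> \<mu>"
  by (simp add: Zmon_def)

lemma evalt_gscal [simp]: "\<tau> \<in> torus \<Longrightarrow> evalt \<tau> (gscal c) = c"
  by (simp add: gscal_def)

lemma Zmon_mult: "Zmon \<mu> * Zmon \<nu> = Zmon (\<mu> + \<nu>)"
  by (simp add: Zmon_def mult_single)

lemma gscal_hom: "gscal (a * b) = gscal a * gscal b" "gscal (a + b) = gscal a + gscal b"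
  "gscal (a - b) = gscal a - gscal b" "gscal (- a) = - gscal a" "gscal 1 = 1" "gscal 0 = 0"
  by (simp_all add: gscal_def mult_single single_add single_diff single_uminus)

lemma galg_act_add: "galg_act w (P + Q) = galg_act w P + galg_act w Q"
  unfolding galg_act_def by (rule setsum_keys_plus_distrib) (auto simp: single_add)

lemma galg_act_single [simp]: "galg_act w (Poly_Mapping.single \<mu> c) = Poly_Mapping.single (w \<mu>) c"
  by (auto simp: galg_act_def)

lemma additive_galg_act: "Modules.additive (galg_act w)"
  by unfold_locales (rule galg_act_add)

lemmas galg_act_diff = additive.diff[OF additive_galg_act]
  and galg_act_minus = additive.minus[OF additive_galg_act]
  and galg_act_zero [simp] = additive.zero[OF additive_galg_act]

lemma galg_act_mult: assumes "Modules.additive w" shows "galg_act w (P * Q) = galg_act w P * galg_act w Q"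
proof (induction P rule: poly_mapping_induct)
  case (single k c)
  show ?case
  proof (induction Q rule: poly_mapping_induct)
    case (single k c)
    show ?case by (simp add: mult_single additive.add[OF assms])
  qed (simp_all add: galg_act_add algebra_simps)
qed (simp_all add: galg_act_add algebra_simps)

lemma galg_act_Zmon: "galg_act w (Zmon \<mu>) = Zmon (w \<mu>)"
  by (simp add: Zmon_def)

lemma galg_act_gscal: "Modules.additive w \<Longrightarrow> galg_act w (gscal c) = gscal c"
  by (simp add: gscal_def additive.zero)

lemma galg_act_one: "Modules.additive w \<Longrightarrow> galg_act w 1 = 1"
  using galg_act_gscal[of w 1] by (simp add: gscal_hom)

lemma lookup_mult_single:
  fixes P :: "'y::ab_group_add \<Rightarrow>\<^sub>0 complex"
  shows "Poly_Mapping.lookup (P * Poly_Mapping.single \<mu> c) k = Poly_Mapping.lookup P (k - \<mu>) * c"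
proof (induction P rule: poly_mapping_induct)
  case (single l d)
  then show ?case by (auto simp: mult_single lookup_single when_def)
qed (simp_all add: lookup_add algebra_simps)

text \<open>A leading-term argument: in the grading by \<open>f\<close>, the top term of P, once
  multiplied by c Z^mu, meets nothing that could cancel it.\<close>

lemma one_plus_monomial_regular:
  fixes P :: "'y::ab_group_add \<Rightarrow>\<^sub>0 complex"
  assumes f: "Modules.additive (f :: 'y \<Rightarrow> int)" "f \<mu> \<noteq> 0" and c: "c \<noteq> 0"
    and zero: "P * (1 + gscal c * Zmon \<mu>) = 0"
  shows "P = 0"
proof -
  \<comment> \<open>The sign makes translation by mu strictly increase the grading, whichever sign
    \<open>f \<mu>\<close> has.\<close>
  define g where "g k = sgn (f \<mu>) * f k" for k
  have g_add: "g (k + \<mu>) > g k" for k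
    using f by (simp add: g_def additive.add algebra_simps sgn_if)
  show ?thesis
  proof (rule ccontr)
    assume "P \<noteq> 0"
    then have ne: "Poly_Mapping.keys P \<noteq> {}" by simp
    obtain k where k: "k \<in> Poly_Mapping.keys P" "\<And>l. l \<in> Poly_Mapping.keys P \<Longrightarrow> g l \<le> g k"
    proof -
      have "Max (g ` Poly_Mapping.keys P) \<in> g ` Poly_Mapping.keys P" using ne by (intro Max_in) auto
      then obtain k where "k \<in> Poly_Mapping.keys P" "Max (g ` Poly_Mapping.keys P) = g k" by blast
      then show ?thesis using that[of k] Max_ge[of "g ` Poly_Mapping.keys P"] by auto
    qed
    have "Poly_Mapping.lookup P (k + \<mu>) = 0"
      using k(2)[of "k + \<mu>"] g_add[of k] by (auto simp: in_keys_iff)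
    moreover have "P * (1 + gscal c * Zmon \<mu>) = P + P * Poly_Mapping.single \<mu> c"
      by (simp add: gscal_def Zmon_def mult_single algebra_simps)
    ultimately have "Poly_Mapping.lookup (P * (1 + gscal c * Zmon \<mu>)) (k + \<mu>) = Poly_Mapping.lookup P k * c"
      by (simp add: lookup_add lookup_mult_single)
    then show False using zero k(1) c by (simp add: in_keys_iff)
  qed
qed

text \<open>Cancelling D gives p d = n q; the Bezout relation then exhibits e = u p + v q as the
  common quotient of p by n and of q by d. As e divides the coprime p and q, it is a unit.\<close>

lemma reduced_fraction_unique:
  fixes n d p q N D :: "'r::comm_ring_1"
  assumes bez: "u * n + v * d = 1" and "coprime_elts p q"
    and eq: "p * D = N * q" "N * d = n * D" and reg: "\<And>x. x * D = 0 \<Longrightarrow> x = 0"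
  shows "\<exists>e. e dvd 1 \<and> p = n * e"
proof -
  have "(p * d - n * q) * D = (p * D) * d - (n * D) * q" by (simp add: algebra_simps)
  also have "\<dots> = 0" by (simp only: eq(1) eq(2)[symmetric]) (simp add: algebra_simps)
  finally have pd: "p * d = n * q" using reg by fastforce
  define e where "e = u * p + v * q"
  have "p = p * (u * n + v * d)" by (simp add: bez)
  also have "\<dots> = n * (u * p) + v * (p * d)" by (simp add: algebra_simps)
  also have "\<dots> = n * e" unfolding pd e_def by (simp add: algebra_simps)
  finally have p: "p = n * e" .
  have "q = q * (u * n + v * d)" by (simp add: bez)
  also have "\<dots> = u * (n * q) + d * (v * q)" by (simp add: algebra_simps)
  also have "\<dots> = d * e" unfolding pd[symmetric] e_def by (simp add: algebra_simps)
  finally have "q = d * e" .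
  with p have "e dvd p" "e dvd q" by simp_all
  then have "e dvd 1" using assms(2) unfolding coprime_elts_def by blast
  then show ?thesis using p by blast
qed

section \<open>The fractions Q_s and zeta_s evaluated at points of the torus\<close>

context hecke_parameters begin

text \<open>With z = chi(-alpha_s^v), zeta_s is (1 - sigma sigma' z) (1 + (sigma / sigma') z) over 1
  - z^2; if sigma = sigma' the factor 1 + z cancels. This is the value of the numerator so
  reduced.\<close>

definition Nval :: "'i \<Rightarrow> ('y \<Rightarrow> complex) \<Rightarrow> complex" where
  "Nval i \<chi> = (let z = \<chi> (- \<alpha>v i) in if \<sigma> i = \<sigma>' i then 1 - (\<sigma> i)\<^sup>2 * z
     else (1 - \<sigma> i * \<sigma>' i * z) * (1 + \<sigma> i / \<sigma>' i * z))"

definition Qregular :: "'i \<Rightarrow> ('y \<Rightarrow> complex) \<Rightarrow> bool" where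
  "Qregular i \<chi> \<longleftrightarrow> (let z = \<chi> (- \<alpha>v i) in if \<sigma> i = \<sigma>' i then z \<noteq> 1 else z\<^sup>2 \<noteq> 1)"

text \<open>Q_s(chi) after the same cancellation of 1 + z. Outside \<open>Qregular\<close> the
  division by zero returns 0, which carries no meaning.\<close>

definition Qval :: "'i \<Rightarrow> ('y \<Rightarrow> complex) \<Rightarrow> complex" where
  "Qval i \<chi> = (let z = \<chi> (- \<alpha>v i) in if \<sigma> i = \<sigma>' i then (\<sigma> i - inverse (\<sigma> i)) / (1 - z)
     else ((\<sigma> i - inverse (\<sigma> i)) + (\<sigma>' i - inverse (\<sigma>' i)) * z) / (1 - z\<^sup>2))"

lemma parameter_nz: assumes "i \<in> I"
  shows "\<sigma> i \<noteq> 0" "\<sigma>' i \<noteq> 0" "\<sigma> i * \<sigma>' i \<noteq> 1" "\<sigma> i * \<sigma>' i \<noteq> -1" "\<sigma>' i \<noteq> - \<sigma> i"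
proof -
  show nz: "\<sigma> i \<noteq> 0" "\<sigma>' i \<noteq> 0" using assms by (simp_all add: \<sigma>_nz \<sigma>'_nz)
  show "\<sigma>' i \<noteq> - \<sigma> i" using \<sigma>'_generic[OF assms] by simp
  show "\<sigma> i * \<sigma>' i \<noteq> 1" using \<sigma>'_generic[OF assms] nz by (auto simp: field_simps)
  show "\<sigma> i * \<sigma>' i \<noteq> -1" using \<sigma>'_generic[OF assms] nz by (auto simp: field_simps)
qed

text \<open>Coprimality of numerator and denominator. For sigma = sigma' only z = 1 is singular,
  with value 1 - sigma^2. Otherwise the values are (1 - sigma sigma') (1 + sigma / sigma') at z = 1
  and (1 + sigma sigma') (1 - sigma / sigma') at z = -1, and the parameter conditions exclude their
  zeros.\<close>

lemma Nval_nz_of_singular: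
  assumes i: "i \<in> I" and "\<not> Qregular i \<chi>"
  shows "Nval i \<chi> \<noteq> 0"
proof -
  note p = parameter_nz[OF i]
  define z where "z = \<chi> (- \<alpha>v i)"
  show ?thesis
  proof (cases "\<sigma> i = \<sigma>' i")
    case True
    then show ?thesis using assms p by (auto simp: Nval_def Qregular_def Let_def power2_eq_square)
  next
    case False
    then have "z\<^sup>2 = 1" using assms by (simp add: Qregular_def z_def Let_def)
    then have "z = 1 \<or> z = -1" by (simp add: power2_eq_1_iff)
    moreover have "1 - \<sigma> i / \<sigma>' i \<noteq> 0" "1 + \<sigma> i / \<sigma>' i \<noteq> 0"
      using p False by (auto simp: field_simps eq_neg_iff_add_eq_0)
    moreover have "1 - \<sigma> i * \<sigma>' i \<noteq> 0" "- (\<sigma> i * \<sigma>' i) \<noteq> 1"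
      using p by (auto simp: minus_equation_iff)
    ultimately show ?thesis using False
      by (auto simp: Nval_def Let_def simp flip: z_def)
  qed
qed

text \<open>chi(s mu) = chi(mu) z^(alpha_s(mu)). Singularity leaves z = 1, or also z = -1 if sigma
  and sigma' differ; in that case alpha_s takes only even values on Y, so the power is 1.\<close>

lemma singular_fixed:
  assumes i: "i \<in> I" and \<chi>: "\<chi> \<in> torus" and "\<not> Qregular i \<chi>"
  shows "\<chi> \<circ> r i = \<chi>"
proof
  fix \<mu>
  define z where "z = \<chi> (- \<alpha>v i)"
  have z: "\<chi> (\<alpha>v i) = inverse z" using \<chi> by (simp add: z_def torus_minus)
  have "\<chi> (r i \<mu>) = \<chi> \<mu> * z powi (\<alpha> i \<mu>)"
    using \<chi> torus_add[OF \<chi>, of \<mu> "- zscale (\<alpha> i \<mu>) (\<alpha>v i)"]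
    by (simp add: r_def torus_minus torus_zscale z power_int_inverse)
  also have "z powi (\<alpha> i \<mu>) = 1"
  proof (cases "\<sigma> i = \<sigma>' i")
    case True
    then show ?thesis using assms by (simp add: Qregular_def z_def Let_def)
  next
    case False
    then have z1: "z = 1 \<or> z = -1" using assms by (simp add: Qregular_def z_def Let_def power2_eq_1_iff)
    have "even (\<alpha> i \<mu>)"
    proof (rule ccontr)
      assume "odd (\<alpha> i \<mu>)"
      then obtain m where m: "\<alpha> i \<mu> = 2 * m + 1" by (elim oddE)
      have "n \<in> range (\<alpha> i)" for n
      proof
        \<comment> \<open>If \<open>\<alpha> i \<mu>\<close> = 2 m + 1, subtracting m coroots leaves
          a vector on which \<open>\<alpha> i\<close> is 1, and its multiples reach all integers.
          The parameters would then agree.\<close>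
        show "n = \<alpha> i (zscale n (\<mu> - zscale m (\<alpha>v i)))"
          using i m by (simp add: additive.diff[OF additive_\<alpha>] additive_int_zscale[OF additive_\<alpha>] \<alpha>_\<alpha>v)
      qed simp
      then have "range (\<alpha> i) = UNIV" by blast
      then show False using \<sigma>_eq_\<sigma>'[OF i] False by simp
    qed
    then obtain m where "\<alpha> i \<mu> = 2 * m" by (elim evenE)
    then show ?thesis using z1 by (auto simp: power_int_mult)
  qed
  finally show "(\<chi> \<circ> r i) \<mu> = \<chi> \<mu>" by simp
qed

lemma reflect_z: "i \<in> I \<Longrightarrow> \<chi> \<in> torus \<Longrightarrow> (\<chi> \<circ> r i) (- \<alpha>v i) = inverse (\<chi> (- \<alpha>v i))"
  by (simp add: additive.minus[OF additive_r] r_\<alpha>v torus_minus)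

lemma Qregular_reflect: "i \<in> I \<Longrightarrow> \<chi> \<in> torus \<Longrightarrow> Qregular i (\<chi> \<circ> r i) \<longleftrightarrow> Qregular i \<chi>"
  using reflect_z[of i \<chi>] torus_nz[of \<chi>]
  by (auto simp: Qregular_def Let_def power_inverse inverse_eq_1_iff)

text \<open>The identity Q_s + s(Q_s) = sigma - sigma^-1 at the point chi, where reflection replaces
  z by 1/z. It matches the linear coefficient in H_s^2 = (sigma - sigma^-1) H_s + 1, which makes the
  product of two opposite intertwiners scalar.\<close>

lemma Qval_sum:
  assumes "i \<in> I" "\<chi> \<in> torus" "Qregular i \<chi>"
  shows "Qval i \<chi> + Qval i (\<chi> \<circ> r i) = \<sigma> i - inverse (\<sigma> i)"
proof -
  define z where "z = \<chi> (- \<alpha>v i)"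
  have z: "z \<noteq> 0" using assms by (simp add: z_def torus_nz)
  note rz = reflect_z[OF assms(1,2), folded z_def]
  show ?thesis
  proof (cases "\<sigma> i = \<sigma>' i")
    case True
    then have "z \<noteq> 1" using assms by (simp add: Qregular_def Let_def z_def)
    have "a / (1 - z) + a / (1 - inverse z) = a" for a
      using z \<open>z \<noteq> 1\<close> by (simp add: divide_simps) (simp add: algebra_simps)
    then show ?thesis using True by (simp add: Qval_def Let_def rz del: o_apply flip: z_def)
  next
    case False
    then have "z\<^sup>2 \<noteq> 1" using assms by (simp add: Qregular_def Let_def z_def)
    have "(a + b * z) / (1 - z\<^sup>2) + (a + b * inverse z) / (1 - (inverse z)\<^sup>2) = a" for a b
      using z \<open>z\<^sup>2 \<noteq> 1\<close> by (simp add: divide_simps) (simp add: algebra_simps power2_eq_square)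
    then show ?thesis using False by (simp add: Qval_def Let_def rz del: o_apply flip: z_def)
  qed
qed

lemma Nval_Qval:
  assumes "i \<in> I" "\<chi> \<in> torus" "Qregular i \<chi>"
  shows "\<exists>c. c \<noteq> 0 \<and> \<sigma> i - Qval i \<chi> = c * Nval i \<chi>"
proof -
  define z where "z = \<chi> (- \<alpha>v i)"
  note p = parameter_nz[OF assms(1)]
  show ?thesis
  proof (cases "\<sigma> i = \<sigma>' i")
    case True
    then have "z \<noteq> 1" using assms by (simp add: Qregular_def Let_def z_def)
    then have "\<sigma> i - Qval i \<chi> = inverse (\<sigma> i * (1 - z)) * Nval i \<chi>"
      using True p(1) by (simp add: Qval_def Nval_def Let_def flip: z_def) (simp add: field_simps power2_eq_square)
    then show ?thesis using p(1) \<open>z \<noteq> 1\<close> by (intro exI[of _ "inverse (\<sigma> i * (1 - z))"]) simp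
  next
    case False
    then have "1 - z\<^sup>2 \<noteq> 0" using assms by (simp add: Qregular_def Let_def z_def)
    then have "\<sigma> i - Qval i \<chi> = inverse (\<sigma> i * (1 - z\<^sup>2)) * Nval i \<chi>"
      using False p(1,2) by (simp add: Qval_def Nval_def Let_def flip: z_def) (simp add: field_simps power2_eq_square)
    then show ?thesis using p(1) \<open>1 - z\<^sup>2 \<noteq> 0\<close> by (intro exI[of _ "inverse (\<sigma> i * (1 - z\<^sup>2))"]) simp
  qed
qed

text \<open>Expanding (sigma - Q) (sigma - Q') with Q + Q' = sigma - sigma^-1 gives 1 + Q Q', while
  each factor is a non-zero multiple of a numerator by \<open>Nval_Qval\<close>.\<close>

lemma Qval_prod_zero_iff:
  assumes "i \<in> I" "\<chi> \<in> torus" "Qregular i \<chi>"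
  shows "1 + Qval i \<chi> * Qval i (\<chi> \<circ> r i) = 0 \<longleftrightarrow> Nval i \<chi> = 0 \<or> Nval i (\<chi> \<circ> r i) = 0"
proof -
  let ?\<chi>' = "\<chi> \<circ> r i"
  have t: "?\<chi>' \<in> torus" using assms by (simp add: torus_comp additive_r)
  obtain c where c: "c \<noteq> 0" "\<sigma> i - Qval i \<chi> = c * Nval i \<chi>" using Nval_Qval[OF assms] by blast
  obtain d where d: "d \<noteq> 0" "\<sigma> i - Qval i ?\<chi>' = d * Nval i ?\<chi>'"
    using Nval_Qval[OF assms(1) t] assms by (auto simp: Qregular_reflect)
  have "(\<sigma> i - Qval i \<chi>) * (\<sigma> i - Qval i ?\<chi>')
      = \<sigma> i * (\<sigma> i - (Qval i \<chi> + Qval i ?\<chi>')) + Qval i \<chi> * Qval i ?\<chi>'"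
    by (simp add: algebra_simps)
  also have "\<dots> = 1 + Qval i \<chi> * Qval i ?\<chi>'"
    using parameter_nz[OF assms(1)] by (simp add: Qval_sum[OF assms])
  finally show ?thesis using c d by auto
qed

lemma Qden_eq: "Qden i = (1 - Zmon (- \<alpha>v i)) * (1 + Zmon (- \<alpha>v i))"
  using zscale_add_1[of 1 "\<alpha>v i"] by (simp add: Qden_def algebra_simps Zmon_mult zscale_minus)

text \<open>\<open>R\<close> is known only through R Qden = Qnum (Z^mu - Z^(s mu)). If sigma =
  sigma', evaluating this at z = -1 gives 0 = 0 although Q_s is regular there, so the factor 1 +
  Z^(-alpha_s^v) is first cancelled inside \<complex>[Y].\<close>

lemma Q_element_eval:
  assumes i: "i \<in> I" and \<chi>: "\<chi> \<in> torus" and reg: "Qregular i \<chi>"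
    and R: "frac_eq (R, 1) (Qnum i * (Zmon \<mu> - Zmon (r i \<mu>)), Qden i)"
  shows "evalt \<chi> R = Qval i \<chi> * (\<chi> \<mu> - \<chi> (r i \<mu>))"
proof -
  define z where "z = \<chi> (- \<alpha>v i)"
  have R: "R * Qden i = Qnum i * (Zmon \<mu> - Zmon (r i \<mu>))" using R by (simp add: frac_eq_def)
  show ?thesis
  proof (cases "\<sigma> i = \<sigma>' i")
    case True
    let ?a = "gscal (\<sigma> i - inverse (\<sigma> i))"
    have "Qnum i = ?a * (1 + Zmon (- \<alpha>v i))" using True by (simp add: Qnum_def algebra_simps)
    then have "R * ((1 - Zmon (- \<alpha>v i)) * (1 + Zmon (- \<alpha>v i)))
        - (?a * (1 + Zmon (- \<alpha>v i))) * (Zmon \<mu> - Zmon (r i \<mu>)) = 0"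
      using R by (simp add: Qden_eq)
    moreover have "(R * (1 - z) - a * D) * (1 + 1 * z) = R * ((1 - z) * (1 + z)) - (a * (1 + z)) * D"
      for a z D :: "'y \<Rightarrow>\<^sub>0 complex" by (simp add: algebra_simps)
    ultimately have "(R * (1 - Zmon (- \<alpha>v i)) - ?a * (Zmon \<mu> - Zmon (r i \<mu>))) * (1 + gscal 1 * Zmon (- \<alpha>v i)) = 0"
      by (simp only: gscal_hom)
    moreover have "\<alpha> i (- \<alpha>v i) \<noteq> 0" using i by (simp add: additive.minus[OF additive_\<alpha>] \<alpha>_\<alpha>v)
    ultimately have "R * (1 - Zmon (- \<alpha>v i)) - ?a * (Zmon \<mu> - Zmon (r i \<mu>)) = 0"
      using one_plus_monomial_regular[OF additive_\<alpha>[OF i]] one_neq_zero by blast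
    then have "evalt \<chi> (R * (1 - Zmon (- \<alpha>v i))) = evalt \<chi> (?a * (Zmon \<mu> - Zmon (r i \<mu>)))" by simp
    then have "evalt \<chi> R * (1 - z) = (\<sigma> i - inverse (\<sigma> i)) * (\<chi> \<mu> - \<chi> (r i \<mu>))"
      using \<chi> by (simp add: evalt_mult evalt_diff z_def)
    moreover have "1 - z \<noteq> 0" using True reg by (simp add: Qregular_def Let_def z_def)
    ultimately show ?thesis using True by (simp add: Qval_def Let_def z_def[symmetric] field_simps)
  next
    case False
    have "evalt \<chi> (R * Qden i) = evalt \<chi> (Qnum i * (Zmon \<mu> - Zmon (r i \<mu>)))" by (simp only: R)
    then have "evalt \<chi> R * (1 - z\<^sup>2) = ((\<sigma> i - inverse (\<sigma> i)) + (\<sigma>' i - inverse (\<sigma>' i)) * z) * (\<chi> \<mu> - \<chi> (r i \<mu>))"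
      using \<chi> by (simp add: Qden_eq Qnum_def evalt_mult evalt_diff evalt_add z_def algebra_simps power2_eq_square)
    moreover have "1 - z\<^sup>2 \<noteq> 0" using False reg by (simp add: Qregular_def Let_def z_def)
    ultimately show ?thesis using False by (simp add: Qval_def Let_def z_def[symmetric] field_simps)
  qed
qed

text \<open>The grading is alpha_s composed with w^-1, which takes the value -2 on
  w(-alpha_s^v).\<close>

lemma galg_act_regular:
  assumes "i \<in> I" "w \<in> W" "c \<noteq> 0" "P * (1 + gscal c * Zmon (w (- \<alpha>v i))) = 0"
  shows "P = 0"
proof (rule one_plus_monomial_regular[where f = "\<alpha> i \<circ> winv w", OF _ _ assms(3,4)])
  show "Modules.additive (\<alpha> i \<circ> winv w)"
    using additive_W[of "winv w"] additive_\<alpha> assms by (simp add: Modules.additive_def)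
  show "(\<alpha> i \<circ> winv w) (w (- \<alpha>v i)) \<noteq> 0"
    using assms bij_W[OF assms(2)] by (simp add: bij_is_inj additive.minus[OF additive_\<alpha>] \<alpha>_\<alpha>v)
qed

lemma Qden_act_regular:
  assumes "i \<in> I" "w \<in> W" "P * galg_act w (Qden i) = 0"
  shows "P = 0"
proof -
  let ?z = "Zmon (w (- \<alpha>v i))"
  have "(P * (1 + gscal (-1) * ?z)) * (1 + gscal 1 * ?z) = 0"
    using assms by (simp add: Qden_eq galg_act_mult additive_W galg_act_diff galg_act_add galg_act_one
        galg_act_Zmon gscal_hom algebra_simps)
  then have "P * (1 + gscal (-1) * ?z) = 0" using galg_act_regular[OF assms(1,2), of 1] by simp
  then show ?thesis using galg_act_regular[OF assms(1,2), of "-1"] by simp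
qed

lemma Qden_regular: "i \<in> I \<Longrightarrow> P * Qden i = 0 \<Longrightarrow> P = 0"
proof (rule Qden_act_regular[of i id])
  assume "P * Qden i = 0"
  moreover have "galg_act id Q = Q" for Q :: "'y \<Rightarrow>\<^sub>0 complex"
    by (induction Q rule: poly_mapping_induct) (simp_all add: galg_act_add)
  ultimately show "P * galg_act id (Qden i) = 0" by simp
qed simp_all

text \<open>Reduces the condition on all reduced forms to one explicit form per pair (w, i). Its
  coprimality comes with a Bezout relation, so every other reduced form has the same numerator up to
  a unit, and units do not vanish on the torus.\<close>

lemma U_set_iff:
  assumes \<tau>: "\<tau> \<in> torus"
  shows "\<tau> \<in> U_set \<longleftrightarrow> (\<forall>w\<in>W. \<forall>i\<in>I. Nval i (\<tau> \<circ> w) \<noteq> 0)"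
proof -
  have key: "\<exists>n d u v. u * n + v * d = 1 \<and> fst (zeta_act w i) * d = n * snd (zeta_act w i) \<and>
       evalt \<tau> n = Nval i (\<tau> \<circ> w) \<and> d \<noteq> 0 \<and> snd (zeta_act w i) \<noteq> 0" if w: "w \<in> W" and i: "i \<in> I" for w i
  proof -
    note p = parameter_nz[OF i]
    note act = galg_act_mult[OF additive_W[OF w]] galg_act_diff galg_act_add galg_act_minus
      galg_act_one[OF additive_W[OF w]] galg_act_gscal[OF additive_W[OF w]] galg_act_Zmon
    let ?z = "Zmon (w (- \<alpha>v i))"
    have snd: "snd (zeta_act w i) = (1 - ?z) * (1 + ?z)"
      by (simp add: zeta_act_def zeta_def Qden_eq act)
    have snd_nz: "snd (zeta_act w i) \<noteq> 0"
      using Qden_act_regular[OF i w, of 1] by (auto simp: zeta_act_def zeta_def)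
    \<comment> \<open>The numerator 1 - (a + b) z + a b z^2 factors as (1 - a z) (1 - b z) for these
      two numbers.\<close>
    let ?a = "\<sigma> i * \<sigma>' i" and ?b = "- (\<sigma> i / \<sigma>' i)"
    have ab: "?a + ?b = \<sigma> i * (\<sigma>' i - inverse (\<sigma>' i))" "?a * ?b = - ((\<sigma> i)\<^sup>2)"
      using p(1,2) by (simp_all add: right_diff_distrib divide_inverse power2_eq_square)
    have one: "\<sigma> i * (\<sigma> i - inverse (\<sigma> i)) = (\<sigma> i)\<^sup>2 - 1"
      using p by (simp add: field_simps power2_eq_square)
    have "fst (zeta_act w i) = - gscal (\<sigma> i * (\<sigma> i - inverse (\<sigma> i)))
        - gscal (\<sigma> i * (\<sigma>' i - inverse (\<sigma>' i))) * ?z + gscal ((\<sigma> i)\<^sup>2) * (1 - ?z * ?z)"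
      by (simp add: zeta_act_def zeta_def Qnum_def Qden_eq act)
        (simp only: gscal_hom(1) distrib_left mult.assoc, simp add: algebra_simps)
    also have "\<dots> = 1 - gscal (?a + ?b) * ?z + gscal (?a * ?b) * (?z * ?z)"
      unfolding one ab by (simp add: gscal_hom algebra_simps)
    also have "\<dots> = (1 - gscal ?a * ?z) * (1 - gscal ?b * ?z)"
      unfolding gscal_hom(1,2) by (simp add: algebra_simps)
    finally have fst: "fst (zeta_act w i) = (1 - gscal ?a * ?z) * (1 - gscal ?b * ?z)" .
    show ?thesis
    proof (cases "\<sigma> i = \<sigma>' i")
      case True
      \<comment> \<open>(1 - a z) - a (1 - z) = 1 - a, a non-zero constant because sigma sigma' is
        not 1.\<close>
      let ?k = "1 - ?a"
      have "gscal (inverse ?k) * (1 - gscal ?a * ?z) + (- gscal (inverse ?k) * gscal ?a) * (1 - ?z)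
          = gscal (inverse ?k * ?k)"
        unfolding gscal_hom(1,3,5) by (simp add: algebra_simps)
      also have "\<dots> = 1" using p(3) by (simp add: gscal_hom(5))
      finally have bez: "gscal (inverse ?k) * (1 - gscal ?a * ?z) + (- gscal (inverse ?k) * gscal ?a) * (1 - ?z) = 1" .
      have b: "?b = -1" using True p by simp
      have "1 - ?z \<noteq> 0" using snd_nz snd by auto
      moreover have "evalt \<tau> (1 - gscal ?a * ?z) = Nval i (\<tau> \<circ> w)"
        using \<tau> True by (simp add: Nval_def Let_def evalt_diff evalt_mult power2_eq_square)
      moreover have "fst (zeta_act w i) * (1 - ?z) = (1 - gscal ?a * ?z) * snd (zeta_act w i)"
        unfolding fst snd b by (simp add: gscal_hom mult_ac)
      ultimately show ?thesis using bez snd_nz by blast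
    next
      case False
      let ?n = "(1 - gscal ?a * ?z) * (1 - gscal ?b * ?z)" and ?d = "(1 - ?z) * (1 + ?z)"
      let ?k = "(1 - ?a * ?a) * (1 - ?b * ?b)"
      have "?a * ?a \<noteq> 1" using p by (simp add: power2_eq_1_iff flip: power2_eq_square)
      moreover have "?b * ?b \<noteq> 1" using p False by (auto simp: field_simps power2_eq_iff simp flip: power2_eq_square)
      ultimately have k: "?k \<noteq> 0" by simp
      \<comment> \<open>The right-hand side is n(1) n(-1), up to sign the resultant of n = (1 - A z)
        (1 - B z) with 1 - z^2; the first cofactor is n(-z) reduced modulo 1 - z^2.\<close>
      have id: "(1 + A * B + (A + B) * z) * ((1 - A * z) * (1 - B * z))
           + (A * B * (1 + A * B + (A + B) * z) - (A + B) * (A + B)) * ((1 - z) * (1 + z))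
           = (1 - A * A) * (1 - B * B)" for A B z :: "'y \<Rightarrow>\<^sub>0 complex"
        by (simp add: algebra_simps)
      have dist: "x * P * n + x * Q * d = x * (P * n + Q * d)" for x P n Q d :: "'y \<Rightarrow>\<^sub>0 complex"
        by (simp add: algebra_simps)
      let ?P = "1 + gscal ?a * gscal ?b + (gscal ?a + gscal ?b) * ?z"
      let ?Q = "gscal ?a * gscal ?b * ?P - (gscal ?a + gscal ?b) * (gscal ?a + gscal ?b)"
      have "gscal (inverse ?k) * ?P * ?n + gscal (inverse ?k) * ?Q * ?d = gscal (inverse ?k) * (?P * ?n + ?Q * ?d)"
        by (rule dist)
      also have "\<dots> = gscal (inverse ?k * ?k)"
        unfolding id gscal_hom(1,3,5) ..
      also have "\<dots> = 1" unfolding left_inverse[OF k] by (rule gscal_hom(5))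
      finally have bez: "gscal (inverse ?k) * ?P * ?n + gscal (inverse ?k) * ?Q * ?d = 1" .
      moreover have "evalt \<tau> ?n = Nval i (\<tau> \<circ> w)"
        using \<tau> False by (simp add: Nval_def Let_def evalt_diff evalt_mult)
      moreover have "?d \<noteq> 0" using snd snd_nz by simp
      ultimately show ?thesis using fst snd snd_nz
        by (intro exI[of _ ?n] exI[of _ ?d] exI[of _ "gscal (inverse ?k) * ?P"] exI[of _ "gscal (inverse ?k) * ?Q"] conjI)
           (simp_all only: )
    qed
  qed
  show ?thesis
  proof
    assume U: "\<tau> \<in> U_set"
    show "\<forall>w\<in>W. \<forall>i\<in>I. Nval i (\<tau> \<circ> w) \<noteq> 0"
    proof (intro ballI)
      fix w i assume wi: "w \<in> W" "i \<in> I"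
      obtain n d u v where k: "u * n + v * d = 1" "fst (zeta_act w i) * d = n * snd (zeta_act w i)"
         "evalt \<tau> n = Nval i (\<tau> \<circ> w)" "d \<noteq> 0" "snd (zeta_act w i) \<noteq> 0" using key[OF wi] by blast
      have "c dvd 1" if "c dvd n" "c dvd d" for c
        using that k(1) by (metis dvd_add dvd_mult)
      then have "zeta_reduced (w (\<alpha>v i)) n d"
        unfolding zeta_reduced_def coprime_elts_def frac_eq_def using wi k
        by (intro conjI bexI[of _ w] bexI[of _ i]) simp_all
      moreover have "w (\<alpha>v i) \<in> coroots" using wi by (auto simp: coroots_def)
      ultimately have "evalt \<tau> n \<noteq> 0"
        using U unfolding U_set_def mem_Collect_eq by (elim conjE, drule_tac bspec) (assumption, elim allE impE)
      then show "Nval i (\<tau> \<circ> w) \<noteq> 0" using k(3) by simp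
    qed
  next
    assume N: "\<forall>w\<in>W. \<forall>i\<in>I. Nval i (\<tau> \<circ> w) \<noteq> 0"
    have "evalt \<tau> p \<noteq> 0" if red: "zeta_reduced \<beta> p q" for \<beta> p q
    proof -
      obtain w i where wi: "w \<in> W" "i \<in> I" and f: "frac_eq (p, q) (zeta_act w i)" and c: "coprime_elts p q"
        using red by (auto simp: zeta_reduced_def)
      obtain n d u v where k: "u * n + v * d = 1" "fst (zeta_act w i) * d = n * snd (zeta_act w i)"
         "evalt \<tau> n = Nval i (\<tau> \<circ> w)" using key[OF wi] by blast
      have "\<exists>e. e dvd 1 \<and> p = n * e"
      proof (rule reduced_fraction_unique[OF k(1) c _ k(2)])
        show "p * snd (zeta_act w i) = fst (zeta_act w i) * q" using f by (simp add: frac_eq_def)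
        show "x = 0" if "x * snd (zeta_act w i) = 0" for x
          using Qden_act_regular[OF wi(2,1)] that by (simp add: zeta_act_def zeta_def)
      qed
      then show ?thesis using N wi k(3) \<tau> by (auto simp: evalt_mult evalt_unit)
    qed
    then show "\<tau> \<in> U_set" using \<tau> unfolding U_set_def by blast
  qed
qed

end

section \<open>The Hecke algebra and its anti-involution\<close>

text \<open>Undoes the eta-expansion of \<open>id\<close> produced by the induction methods.\<close>

lemma id_eta [simp]: "(\<lambda>a. a) = id"
  by (simp add: id_def)

lemma lookup_hscale [simp]: "Poly_Mapping.lookup (hscale c h) k = c * Poly_Mapping.lookup h k"
  by (simp add: hscale_def Poly_Mapping.map.rep_eq when_def)

lemma hscale_hscale [simp]: "hscale a (hscale b h) = hscale (a * b) h"
  by (rule poly_mapping_eqI) simp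

lemma hscale_1 [simp]: "hscale 1 h = h"
  by (rule poly_mapping_eqI) simp

lemma hscale_0 [simp]: "hscale 0 h = 0"
  by (rule poly_mapping_eqI) simp

lemma hscale_zero [simp]: "hscale a 0 = 0"
  by (rule poly_mapping_eqI) simp

lemma hscale_add: "hscale a (h + k) = hscale a h + hscale a k"
  by (rule poly_mapping_eqI) (simp add: lookup_add algebra_simps)

lemma hscale_diff: "hscale a (h - k) = hscale a h - hscale a k"
  by (rule poly_mapping_eqI) (simp add: lookup_minus algebra_simps)

lemma hscale_minus: "hscale a (- h) = - hscale a h"
  by (rule poly_mapping_eqI) simp

lemma hscale_add_left: "hscale (a + b) h = hscale a h + hscale b h"
  by (rule poly_mapping_eqI) (simp add: lookup_add algebra_simps)

lemma hscale_diff_left: "hscale (a - b) h = hscale a h - hscale b h"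
  by (rule poly_mapping_eqI) (simp add: lookup_minus algebra_simps)

lemma hscale_minus_left: "hscale (- a) h = - hscale a h"
  by (rule poly_mapping_eqI) simp

lemma hscale_single: "hscale a (Poly_Mapping.single k c) = Poly_Mapping.single k (a * c)"
  by (rule poly_mapping_eqI) (simp add: lookup_single when_def)

lemma single_eq_bas: "Poly_Mapping.single (\<mu>, w) c = hscale c (bas \<mu> w)"
  by (simp add: bas_def hscale_single)

lemma emb_add: "emb (P + Q) = emb P + emb Q"
  unfolding emb_def by (rule setsum_keys_plus_distrib) (auto simp: hscale_add_left)

lemma emb_single [simp]: "emb (Poly_Mapping.single \<mu> c) = hscale c (bas \<mu> id)"
  by (simp add: emb_def)

lemma additive_emb: "Modules.additive emb"
  by unfold_locales (rule emb_add)

lemmas emb_zero [simp] = additive.zero[OF additive_emb]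
  and emb_minus = additive.minus[OF additive_emb]

lemma emb_gscal: "emb (gscal c) = hscale c (bas 0 id)"
  by (simp add: gscal_def)

lemma emb_Zmon: "emb (Zmon \<mu>) = bas \<mu> id"
  by (simp add: Zmon_def)

context root_generating_system begin

lemma Hspace_zero [simp, intro]: "0 \<in> Hspace"
  by (simp add: Hspace_def)

lemma Hspace_add [simp, intro]: "h \<in> Hspace \<Longrightarrow> k \<in> Hspace \<Longrightarrow> h + k \<in> Hspace"
  using Poly_Mapping.keys_add[of h k] by (auto simp: Hspace_def)

lemma Hspace_hscale [simp, intro]: "h \<in> Hspace \<Longrightarrow> hscale c h \<in> Hspace"
  by (auto simp: Hspace_def in_keys_iff)

lemma Hspace_minus [simp, intro]: "h \<in> Hspace \<Longrightarrow> - h \<in> Hspace"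
  by (auto simp: Hspace_def in_keys_iff)

lemma Hspace_diff [simp, intro]: "h \<in> Hspace \<Longrightarrow> k \<in> Hspace \<Longrightarrow> h - k \<in> Hspace"
  using Hspace_add[of h "- k"] by simp

lemma Hspace_bas [simp, intro]: "w \<in> W \<Longrightarrow> bas \<mu> w \<in> Hspace"
  by (simp add: Hspace_def bas_def)

lemma Hspace_sum [simp, intro]: "(\<And>x. x \<in> S \<Longrightarrow> f x \<in> Hspace) \<Longrightarrow> (\<Sum>x\<in>S. f x) \<in> Hspace"
  by (induction S rule: infinite_finite_induct) auto

lemma Hspace_emb [simp, intro]: "emb P \<in> Hspace"
  by (simp add: emb_def)

lemma Hspace_induct [consumes 1, case_names zero bas add]:
  assumes "h \<in> Hspace" "P 0" "\<And>\<mu> w c. w \<in> W \<Longrightarrow> P (hscale c (bas \<mu> w))"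
    "\<And>h k. h \<in> Hspace \<Longrightarrow> k \<in> Hspace \<Longrightarrow> P h \<Longrightarrow> P k \<Longrightarrow> P (h + k)"
  shows "P h"
proof -
  let ?s = "\<lambda>k. Poly_Mapping.single k (Poly_Mapping.lookup h k)"
  have s: "?s k \<in> Hspace \<and> P (?s k)" if "k \<in> Poly_Mapping.keys h" for k
  proof (cases k)
    case (Pair \<mu> w)
    then have "w \<in> W" using that assms(1) by (auto simp: Hspace_def)
    then show ?thesis using Pair assms(3) by (simp add: single_eq_bas)
  qed
  have "(\<Sum>k\<in>K. ?s k) \<in> Hspace \<and> P (\<Sum>k\<in>K. ?s k)" if "finite K" "K \<subseteq> Poly_Mapping.keys h" for K
    using that s by (induction K) (simp_all add: assms)
  moreover have "h = (\<Sum>k\<in>Poly_Mapping.keys h. ?s k)"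
    by (rule poly_mapping_eqI) (simp add: lookup_sum lookup_single when_def in_keys_iff)
  ultimately show ?thesis by (metis finite_keys order_refl)
qed

end

section \<open>Consequences of the defining relations\<close>

context BL_hecke_algebra begin

abbreviation Z :: "'y \<Rightarrow> 'y hecke" where "Z \<mu> \<equiv> bas \<mu> id"
abbreviation T :: "'i \<Rightarrow> 'y hecke" where "T i \<equiv> bas 0 (r i)"
abbreviation unit_H :: "'y hecke" where "unit_H \<equiv> bas 0 id"

lemma mul_in [simp, intro]: "h \<in> Hspace \<Longrightarrow> k \<in> Hspace \<Longrightarrow> mul h k \<in> Hspace"
  by (rule mul_closed)

lemma mul_zero_left [simp]: "k \<in> Hspace \<Longrightarrow> mul 0 k = 0"
  using mul_scale_left[of 0 k 0] by simp

lemma mul_zero_right [simp]: "k \<in> Hspace \<Longrightarrow> mul k 0 = 0"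
  using mul_scale_right[of k 0 0] by simp

lemma mul_minus_left: "h \<in> Hspace \<Longrightarrow> k \<in> Hspace \<Longrightarrow> mul (- h) k = - mul h k"
  using mul_scale_left[of h k "-1"] by (simp add: hscale_minus_left)

lemma mul_minus_right: "h \<in> Hspace \<Longrightarrow> k \<in> Hspace \<Longrightarrow> mul h (- k) = - mul h k"
  using mul_scale_right[of h k "-1"] by (simp add: hscale_minus_left)

lemma mul_diff_left: "h \<in> Hspace \<Longrightarrow> h' \<in> Hspace \<Longrightarrow> k \<in> Hspace \<Longrightarrow> mul (h - h') k = mul h k - mul h' k"
  using mul_add_left[of h "- h'" k] by (simp add: mul_minus_left)

lemma mul_diff_right: "h \<in> Hspace \<Longrightarrow> k' \<in> Hspace \<Longrightarrow> k \<in> Hspace \<Longrightarrow> mul h (k - k') = mul h k - mul h k'"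
  using mul_add_right[of h k "- k'"] by (simp add: mul_minus_right)

lemmas mul_simps = mul_add_left mul_add_right mul_diff_left mul_diff_right mul_minus_left mul_minus_right
  mul_scale_left mul_scale_right

lemma mul_Z_bas: assumes "w \<in> W" shows "mul (Z \<mu>) (bas \<nu> w) = bas (\<mu> + \<nu>) w"
proof -
  have "mul (Z \<mu>) (bas \<nu> w) = mul (Z \<mu>) (mul (Z \<nu>) (bas 0 w))" by (simp add: mul_Z_H assms)
  also have "\<dots> = mul (mul (Z \<mu>) (Z \<nu>)) (bas 0 w)" using assms by (simp add: mul_assoc)
  finally show ?thesis by (simp add: mul_Z_Z mul_Z_H assms)
qed

lemma mul_word_Cons:
  assumes "i \<in> I" "set ks \<subseteq> I" "len (word (i # ks)) = length (i # ks)"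
  shows "bas 0 (word (i # ks)) = mul (T i) (bas 0 (word ks))"
  using mul_H_H_up[of i "word ks"] reduced_word_Cons[OF assms] assms by (simp add: word_in_W)

lemma mul_unit_left [simp]: "h \<in> Hspace \<Longrightarrow> mul unit_H h = h"
  by (induction rule: Hspace_induct) (simp_all add: mul_Z_bas mul_simps)

text \<open>That \<open>unit_H\<close> is also a right unit is not among the relations; it starts
  from Z^0 Z^0 = Z^0 and passes along a reduced word by associativity.\<close>

lemma bas_mul_unit: assumes "set ks \<subseteq> I" "len (word ks) = length ks"
  shows "mul (bas 0 (word ks)) unit_H = bas 0 (word ks)"
  using assms
proof (induction ks)
  case Nil
  show ?case by (simp add: mul_Z_Z)
next
  case (Cons i ks)
  have l: "len (word (i # ks)) = length (i # ks)" by (rule Cons.prems(2))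
  have "len (word ks) = length ks" using reduced_word_Cons(1)[OF _ _ l] Cons.prems(1) by simp
  then have IH: "mul (bas 0 (word ks)) unit_H = bas 0 (word ks)" using Cons.IH Cons.prems(1) by simp
  have eq: "bas 0 (word (i # ks)) = mul (T i) (bas 0 (word ks))" using mul_word_Cons[OF _ _ l] Cons.prems(1) by simp
  show "mul (bas 0 (word (i # ks))) unit_H = bas 0 (word (i # ks))"
    unfolding eq using Cons.prems IH by (simp add: mul_assoc word_in_W)
qed

lemma mul_unit_right [simp]: "h \<in> Hspace \<Longrightarrow> mul h unit_H = h"
proof (induction rule: Hspace_induct)
  case (bas \<mu> w c)
  obtain ks where ks: "set ks \<subseteq> I" "w = word ks" "length ks = len w" using reduced_word[OF bas] .
  then have "mul (bas 0 w) unit_H = bas 0 w" using bas_mul_unit[of ks] by simp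
  moreover have "bas \<mu> w = mul (Z \<mu>) (bas 0 w)" using bas by (simp add: mul_Z_H)
  ultimately show ?case using bas by (simp add: mul_simps mul_assoc)
qed (simp_all add: mul_simps)

text \<open>The Z^mu and H_s generate the algebra from the left, since each H_w is a product along a
  reduced word.\<close>

lemma H_induct [consumes 1, case_names unit Z T add scale]:
  assumes "h \<in> Hspace" "P unit_H"
    "\<And>\<mu> h. h \<in> Hspace \<Longrightarrow> P h \<Longrightarrow> P (mul (Z \<mu>) h)"
    "\<And>i h. i \<in> I \<Longrightarrow> h \<in> Hspace \<Longrightarrow> P h \<Longrightarrow> P (mul (T i) h)"
    "\<And>h k. h \<in> Hspace \<Longrightarrow> k \<in> Hspace \<Longrightarrow> P h \<Longrightarrow> P k \<Longrightarrow> P (h + k)"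
    "\<And>c h. h \<in> Hspace \<Longrightarrow> P h \<Longrightarrow> P (hscale c h)"
  shows "P h"
proof -
  have w: "P (bas 0 (word ks))" if "set ks \<subseteq> I" "len (word ks) = length ks" for ks
    using that
  proof (induction ks)
    case Nil
    then show ?case using assms(2) by simp
  next
    case (Cons i ks)
    have l: "len (word (i # ks)) = length (i # ks)" by (rule Cons.prems(2))
    have "len (word ks) = length ks" using reduced_word_Cons(1)[OF _ _ l] Cons.prems(1) by simp
    then have "P (bas 0 (word ks))" using Cons.IH Cons.prems(1) by simp
    moreover have eq: "bas 0 (word (i # ks)) = mul (T i) (bas 0 (word ks))" using mul_word_Cons[OF _ _ l] Cons.prems(1) by simp
    ultimately show "P (bas 0 (word (i # ks)))"
      unfolding eq using assms(4)[of i] Cons.prems by (simp add: word_in_W)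
  qed
  have b: "P (bas \<mu> w)" if "w \<in> W" for \<mu> w
    using reduced_word[OF that] w assms(3)[of "bas 0 w" \<mu>] that by (metis mul_Z_H Hspace_bas)
  from assms(1) show ?thesis
  proof (induction rule: Hspace_induct)
    case zero
    show ?case using assms(6)[of unit_H 0] assms(2) by simp
  qed (simp_all add: assms b)
qed

lemma T_sq: "i \<in> I \<Longrightarrow> mul (T i) (T i) = hscale (\<sigma> i - inverse (\<sigma> i)) (T i) + unit_H"
  using mul_H_H_down[of i "r i"] by (simp add: len_r r_comp_r)

text \<open>\<open>Bern i \<mu>\<close> is \<open>Q\<^sub>s(Z) (Z\<^sup>\<mu> - Z\<^sup>s\<^sup>\<mu>)\<close>, \<open>s = r i\<close>.\<close>

definition Bern :: "'i \<Rightarrow> 'y \<Rightarrow> ('y \<Rightarrow>\<^sub>0 complex)" where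
  "Bern i \<mu> = (SOME R. frac_eq (R, 1) (Qnum i * (Zmon \<mu> - Zmon (r i \<mu>)), Qden i) \<and>
     mul (T i) (Z \<mu>) - mul (Z (r i \<mu>)) (T i) = emb R)"

lemma Bern: assumes "i \<in> I"
  shows Bern_frac: "frac_eq (Bern i \<mu>, 1) (Qnum i * (Zmon \<mu> - Zmon (r i \<mu>)), Qden i)"
    and Bern_mul: "mul (T i) (Z \<mu>) = mul (Z (r i \<mu>)) (T i) + emb (Bern i \<mu>)"
  using someI_ex[OF mul_H_Z[OF assms, of \<mu>]] by (auto simp: Bern_def algebra_simps)

lemma Bern_reflect: assumes "i \<in> I" shows "Bern i (r i \<mu>) = - Bern i \<mu>"
proof -
  have "Bern i \<mu> * Qden i = Qnum i * (Zmon \<mu> - Zmon (r i \<mu>))"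
    "Bern i (r i \<mu>) * Qden i = Qnum i * (Zmon (r i \<mu>) - Zmon \<mu>)"
    using Bern_frac[OF assms, of \<mu>] Bern_frac[OF assms, of "r i \<mu>"] assms by (simp_all add: frac_eq_def r_r)
  then have "(Bern i (r i \<mu>) + Bern i \<mu>) * Qden i = 0"
    by (simp only: distrib_right) (simp add: algebra_simps)
  then show ?thesis using Qden_regular[OF assms] by (metis add_eq_0_iff add.commute)
qed

text \<open>Replace mu by s mu in \<open>Bern_mul\<close>: the sign from \<open>Bern_reflect\<close>
  leaves the correction term unchanged, so the Bernstein relation is its own mirror image and
  \<open>flip_H\<close> can respect it.\<close>

lemma Z_T: "i \<in> I \<Longrightarrow> mul (Z \<mu>) (T i) = mul (T i) (Z (r i \<mu>)) + emb (Bern i \<mu>)"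
  using Bern_mul[of i "r i \<mu>"] by (simp add: r_r Bern_reflect emb_minus)

text \<open>The rules are given for left factors only; peeling letters off the left end of a reduced
  word carries them over to a new letter at the right end.\<close>

lemma mul_H_H_right_up:
  assumes "set ks \<subseteq> I" "i \<in> I" "len (word (ks @ [i])) = length (ks @ [i])"
  shows "mul (bas 0 (word ks)) (T i) = bas 0 (word (ks @ [i]))"
  using assms
proof (induction ks)
  case Nil
  then show ?case by simp
next
  case (Cons j ks)
  have l: "len (word (j # ks @ [i])) = length (j # ks @ [i])" using Cons.prems(3) unfolding append_Cons .
  have "len (word (ks @ [i])) = length (ks @ [i])"
    using reduced_word_Cons(1)[OF _ _ l] Cons.prems(1,2) by simp
  then have IH: "mul (bas 0 (word ks)) (T i) = bas 0 (word (ks @ [i]))" using Cons.IH Cons.prems(1,2) by simp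
  \<comment> \<open>Without its last letter the word is still reduced: otherwise appending that
    letter could not restore the full length.\<close>
  have "len (word (j # ks)) = length (j # ks)"
  proof (rule ccontr)
    assume "len (word (j # ks)) \<noteq> length (j # ks)"
    then have "len (word (j # ks)) < length (j # ks)" using len_le[of "j # ks"] Cons.prems by simp
    then show False
      using len_comp_r[of i "word (j # ks)"] Cons.prems(1,2) l word_in_W[of "j # ks"]
        word_append[of "j # ks" "[i]"] by (simp add: o_assoc)
  qed
  then have eq: "bas 0 (word (j # ks)) = mul (T j) (bas 0 (word ks))"
    using mul_word_Cons[of j ks] Cons.prems by simp
  have "mul (bas 0 (word (j # ks))) (T i) = mul (T j) (bas 0 (word (ks @ [i])))"
    unfolding eq using Cons.prems IH by (simp add: mul_assoc word_in_W)
  also have "\<dots> = bas 0 (word (j # ks @ [i]))"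
    using mul_word_Cons[OF _ _ l] Cons.prems(1,2) by simp
  finally show "mul (bas 0 (word (j # ks))) (T i) = bas 0 (word ((j # ks) @ [i]))"
    by simp
qed

text \<open>The descending case reduces to the ascending one: split H_s off the right end of H_w and
  use the quadratic relation.\<close>

lemma mul_H_T:
  assumes i: "i \<in> I" and w: "w \<in> W"
  shows mul_H_T_up: "len (w \<circ> r i) = len w + 1 \<Longrightarrow> mul (bas 0 w) (T i) = bas 0 (w \<circ> r i)"
    and mul_H_T_down: "len w = len (w \<circ> r i) + 1 \<Longrightarrow>
      mul (bas 0 w) (T i) = hscale (\<sigma> i - inverse (\<sigma> i)) (bas 0 w) + bas 0 (w \<circ> r i)"
proof -
  have up: "mul (bas 0 w) (T i) = bas 0 (w \<circ> r i)" if u: "len (w \<circ> r i) = len w + 1" "w \<in> W" for w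
  proof -
    obtain ks where ks: "set ks \<subseteq> I" "w = word ks" "length ks = len w" using reduced_word[OF u(2)] .
    then show ?thesis using mul_H_H_right_up[of ks i] u(1) i by (simp add: word_append)
  qed
  then show "len (w \<circ> r i) = len w + 1 \<Longrightarrow> mul (bas 0 w) (T i) = bas 0 (w \<circ> r i)" using w by simp
  assume down: "len w = len (w \<circ> r i) + 1"
  have u: "w \<circ> r i \<in> W" "(w \<circ> r i) \<circ> r i = w" using i w by (simp_all add: r_comp_r flip: o_assoc)
  then have eq: "bas 0 w = mul (bas 0 (w \<circ> r i)) (T i)" using up[of "w \<circ> r i"] down by simp
  have "mul (bas 0 w) (T i) = mul (bas 0 (w \<circ> r i)) (mul (T i) (T i))"
    unfolding eq using u i by (simp add: mul_assoc)
  then show "mul (bas 0 w) (T i) = hscale (\<sigma> i - inverse (\<sigma> i)) (bas 0 w) + bas 0 (w \<circ> r i)"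
    using u i by (simp add: T_sq mul_simps flip: eq)
qed

text \<open>The anti-involution fixing every \<open>Z\<^sup>\<mu>\<close> and every \<open>H\<^sub>s\<close>.  It exchanges the basis \<open>Z\<^sup>\<mu> H\<^sub>w\<close> over
  \<open>\<complex>[Y]\<close> acting from the left with the family \<open>H\<^sub>w Z\<^sup>\<mu>\<close>, on which \<open>\<complex>[Y]\<close> acts from the right.\<close>

definition flip_H :: "'y hecke \<Rightarrow> 'y hecke" where
  "flip_H h = (\<Sum>k\<in>Poly_Mapping.keys h.
     hscale (Poly_Mapping.lookup h k) (mul (bas 0 (winv (snd k))) (Z (fst k))))"

lemma flip_add: "flip_H (h + k) = flip_H h + flip_H k"
  unfolding flip_H_def by (rule setsum_keys_plus_distrib) (auto simp: hscale_add_left)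

lemma flip_diff: "flip_H (h - k) = flip_H h - flip_H k"
  using flip_add[of "h - k" k] by (simp add: eq_diff_eq)

lemma flip_zero [simp]: "flip_H 0 = 0"
  by (simp add: flip_H_def)

lemma flip_hscale_bas: "flip_H (hscale c (bas \<mu> w)) = hscale c (mul (bas 0 (winv w)) (Z \<mu>))"
  by (simp add: flip_H_def bas_def hscale_single)

lemma flip_bas: "flip_H (bas \<mu> w) = mul (bas 0 (winv w)) (Z \<mu>)"
  using flip_hscale_bas[of 1] by simp

lemma flip_in [simp, intro]: "h \<in> Hspace \<Longrightarrow> flip_H h \<in> Hspace"
  by (induction rule: Hspace_induct) (simp_all add: flip_add flip_hscale_bas)

lemma flip_hscale: "h \<in> Hspace \<Longrightarrow> flip_H (hscale c h) = hscale c (flip_H h)"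
  by (induction rule: Hspace_induct) (simp_all add: flip_add flip_hscale_bas hscale_add)

lemma flip_Z: "flip_H (Z \<mu>) = Z \<mu>"
  by (simp add: flip_bas inv_id)

lemma flip_T: "i \<in> I \<Longrightarrow> flip_H (T i) = T i"
  by (simp add: flip_bas)

lemma flip_Z_mul: assumes "h \<in> Hspace" shows "flip_H (mul (Z \<mu>) h) = mul (flip_H h) (Z \<mu>)"
  using assms
proof (induction rule: Hspace_induct)
  case (bas \<nu> w c)
  have "flip_H (mul (Z \<mu>) (hscale c (bas \<nu> w))) = hscale c (mul (bas 0 (winv w)) (Z (\<mu> + \<nu>)))"
    using bas by (simp add: mul_simps mul_Z_bas flip_hscale_bas)
  also have "Z (\<mu> + \<nu>) = mul (Z \<nu>) (Z \<mu>)" by (simp add: mul_Z_Z add.commute)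
  finally show ?case using bas by (simp add: mul_simps flip_hscale_bas mul_assoc)
qed (simp_all add: mul_simps flip_add)

lemma flip_emb_mul: assumes "h \<in> Hspace" shows "flip_H (mul (emb P) h) = mul (flip_H h) (emb P)"
proof (induction P rule: poly_mapping_induct)
  case (single k c)
  then show ?case using assms by (simp add: mul_simps flip_hscale flip_Z_mul)
qed (use assms in \<open>simp_all add: emb_add mul_simps flip_add\<close>)

text \<open>Inversion preserves length, so the left rule for w and the right rule for w^-1 fall into
  the same case with the same coefficients.\<close>

lemma flip_T_H: assumes i: "i \<in> I" and w: "w \<in> W"
  shows "flip_H (mul (T i) (bas 0 w)) = mul (bas 0 (winv w)) (T i)"
proof -
  have l: "len (winv w \<circ> r i) = len (r i \<circ> w)"
    using len_inv[of "r i \<circ> w"] i w by (simp add: inv_comp_W)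
  from len_r_comp[OF i w] show ?thesis
  proof
    assume "len (r i \<circ> w) = len w + 1"
    then show ?thesis
      using i w mul_H_T_up[of i "winv w"] l by (simp add: mul_H_H_up flip_bas inv_comp_W len_inv)
  next
    assume "len w = len (r i \<circ> w) + 1"
    then show ?thesis
      using i w mul_H_T_down[of i "winv w"] l
      by (simp add: mul_H_H_down flip_add flip_hscale_bas flip_bas inv_comp_W len_inv)
  qed
qed

text \<open>\<open>Bern_mul\<close> moves H_s past Z^mu, the pieces are flipped, and the mirrored
  relation \<open>Z_T\<close> puts them together again.\<close>

lemma flip_T_mul: assumes i: "i \<in> I" and "h \<in> Hspace" shows "flip_H (mul (T i) h) = mul (flip_H h) (T i)"
  using assms(2)
proof (induction rule: Hspace_induct)
  case (bas \<mu> w c)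
  have "mul (T i) (bas \<mu> w) = mul (mul (T i) (Z \<mu>)) (bas 0 w)"
    using i bas by (simp add: mul_assoc mul_Z_H)
  also have "\<dots> = mul (Z (r i \<mu>)) (mul (T i) (bas 0 w)) + mul (emb (Bern i \<mu>)) (bas 0 w)"
    using i bas by (simp add: Bern_mul mul_simps mul_assoc)
  finally have "flip_H (mul (T i) (bas \<mu> w))
      = mul (mul (bas 0 (winv w)) (T i)) (Z (r i \<mu>)) + mul (bas 0 (winv w)) (emb (Bern i \<mu>))"
    using i bas by (simp add: flip_add flip_Z_mul flip_emb_mul flip_T_H flip_bas)
  also have "\<dots> = mul (bas 0 (winv w)) (mul (T i) (Z (r i \<mu>)) + emb (Bern i \<mu>))"
    using i bas by (simp add: mul_simps mul_assoc)
  also have "\<dots> = mul (flip_H (bas \<mu> w)) (T i)"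
    using i bas by (simp add: flip_bas mul_assoc Z_T)
  finally show ?case using i bas by (simp add: mul_simps flip_hscale)
qed (use i in \<open>simp_all add: mul_simps flip_add\<close>)

lemma flip_mul: assumes "h \<in> Hspace" "k \<in> Hspace" shows "flip_H (mul h k) = mul (flip_H k) (flip_H h)"
  using assms
proof (induction arbitrary: k rule: H_induct)
  case unit
  then show ?case by (simp add: flip_Z)
next
  case (Z \<mu> h)
  then show ?case by (simp add: mul_assoc flip_Z_mul)
next
  case (T i h)
  then show ?case by (simp add: mul_assoc flip_T_mul)
next
  case (add h h')
  then show ?case by (simp add: mul_simps flip_add)
next
  case (scale c h)
  then show ?case by (simp add: mul_simps flip_hscale)
qed

end

section \<open>Left ideals and weight vectors\<close>

context BL_hecke_algebra begin

definition left_ideal :: "'y hecke set \<Rightarrow> bool" where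
  "left_ideal N \<longleftrightarrow> N \<subseteq> Hspace \<and> 0 \<in> N \<and> (\<forall>h\<in>N. \<forall>k\<in>N. h + k \<in> N) \<and>
     (\<forall>h\<in>Hspace. \<forall>k\<in>N. mul h k \<in> N)"

lemma left_idealI:
  assumes "N \<subseteq> Hspace" "0 \<in> N" "\<And>h k. h \<in> N \<Longrightarrow> k \<in> N \<Longrightarrow> h + k \<in> N"
    "\<And>h k. h \<in> Hspace \<Longrightarrow> k \<in> N \<Longrightarrow> mul h k \<in> N"
  shows "left_ideal N"
  using assms by (simp add: left_ideal_def)

lemma left_ideal_subset: "left_ideal N \<Longrightarrow> h \<in> N \<Longrightarrow> h \<in> Hspace"
  by (auto simp: left_ideal_def)

lemma left_ideal_zero: "left_ideal N \<Longrightarrow> 0 \<in> N"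
  by (simp add: left_ideal_def)

lemma left_ideal_add: "left_ideal N \<Longrightarrow> h \<in> N \<Longrightarrow> k \<in> N \<Longrightarrow> h + k \<in> N"
  by (simp add: left_ideal_def)

lemma left_ideal_mul: "left_ideal N \<Longrightarrow> h \<in> Hspace \<Longrightarrow> k \<in> N \<Longrightarrow> mul h k \<in> N"
  by (simp add: left_ideal_def)

lemma left_ideal_hscale: assumes "left_ideal N" "h \<in> N" shows "hscale c h \<in> N"
  using left_ideal_mul[OF assms(1) _ assms(2), of "hscale c unit_H"] left_ideal_subset[OF assms]
  by (simp add: mul_simps)

lemma left_ideal_hscale_iff: "left_ideal N \<Longrightarrow> c \<noteq> 0 \<Longrightarrow> hscale c h \<in> N \<longleftrightarrow> h \<in> N"
  using left_ideal_hscale[of N "hscale c h" "inverse c"] left_ideal_hscale[of N h c] by auto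

lemma left_ideal_diff: assumes "left_ideal N" "h \<in> N" "k \<in> N" shows "h - k \<in> N"
  using left_ideal_add[OF assms(1,2) left_ideal_hscale[OF assms(1,3), of "-1"]]
  by (simp add: hscale_minus_left)

lemma left_ideal_sum: "left_ideal N \<Longrightarrow> (\<And>x. x \<in> S \<Longrightarrow> f x \<in> N) \<Longrightarrow> (\<Sum>x\<in>S. f x) \<in> N"
  by (induction S rule: infinite_finite_induct) (auto intro: left_ideal_zero left_ideal_add)

lemma left_ideal_unit: assumes "left_ideal N" "unit_H \<in> N" shows "N = Hspace"
proof
  show "N \<subseteq> Hspace" using assms(1) by (simp add: left_ideal_def)
  show "Hspace \<subseteq> N" using left_ideal_mul[OF assms(1) _ assms(2)] by auto
qed

definition wt :: "'y hecke set \<Rightarrow> ('y \<Rightarrow> complex) \<Rightarrow> 'y hecke \<Rightarrow> bool" where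
  "wt N \<chi> v \<longleftrightarrow> v \<in> Hspace \<and> (\<forall>\<mu>. mul (Z \<mu>) v - hscale (\<chi> \<mu>) v \<in> N)"

text \<open>\<open>L \<tau>\<close> is the annihilator of \<open>1 \<otimes>\<^sub>\<tau> 1\<close>, so that \<open>I\<^sub>\<tau>\<close> is the quotient of the algebra by \<open>L \<tau>\<close>, and
  \<open>wt (L \<tau>) \<chi> v\<close> says that the class of \<open>v\<close> is a weight vector of weight \<open>\<chi>\<close>.\<close>

definition L :: "('y \<Rightarrow> complex) \<Rightarrow> 'y hecke set" where
  "L \<tau> = {h \<in> Hspace. \<forall>N. left_ideal N \<longrightarrow> wt N \<tau> unit_H \<longrightarrow> h \<in> N}"

lemma left_ideal_L: "left_ideal (L \<tau>)"
  by (rule left_idealI) (auto simp: L_def left_ideal_zero left_ideal_add left_ideal_mul)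

lemma wt_L: "wt (L \<tau>) \<tau> unit_H"
  by (auto simp: wt_def L_def)

text \<open>Universal property of I_chi: the elements sending \<open>v\<close> into \<open>N\<close>
  form a left ideal containing every Z^mu - chi(mu), hence \<open>L \<chi>\<close>. So right
  multiplication by \<open>v\<close> is defined on I_chi.\<close>

lemma L_mul_wt:
  assumes N: "left_ideal N" and v: "wt N \<chi> v" and h: "h \<in> L \<chi>"
  shows "mul h v \<in> N"
proof -
  have vH: "v \<in> Hspace" using v by (simp add: wt_def)
  let ?N = "{h \<in> Hspace. mul h v \<in> N}"
  have "left_ideal ?N"
    using N vH by (intro left_idealI) (auto simp: mul_simps mul_assoc left_ideal_zero left_ideal_add left_ideal_mul)
  moreover have "wt ?N \<chi> unit_H" using v by (simp add: wt_def mul_simps)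
  ultimately show ?thesis using h by (auto simp: L_def)
qed

text \<open>Value at tau of the \<complex>[Y]-coefficient of H_w in the left basis. Composed with
  \<open>flip_H\<close> it becomes a functional that sees relations imposed from the right.\<close>

definition weight_coeff :: "('y \<Rightarrow> complex) \<Rightarrow> ('y \<Rightarrow> 'y) \<Rightarrow> 'y hecke \<Rightarrow> complex" where
  "weight_coeff \<tau> w h = (\<Sum>k\<in>Poly_Mapping.keys h. if snd k = w then Poly_Mapping.lookup h k * \<tau> (fst k) else 0)"

lemma weight_coeff_add: "weight_coeff \<tau> w (h + k) = weight_coeff \<tau> w h + weight_coeff \<tau> w k"
  unfolding weight_coeff_def by (rule setsum_keys_plus_distrib) (auto simp: algebra_simps)

lemma weight_coeff_hscale_bas: "weight_coeff \<tau> w (hscale c (bas \<mu> v)) = (if v = w then c * \<tau> \<mu> else 0)"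
  by (simp add: weight_coeff_def bas_def hscale_single)

lemma weight_coeff_bas: "weight_coeff \<tau> w (bas \<mu> v) = (if v = w then \<tau> \<mu> else 0)"
  using weight_coeff_hscale_bas[of \<tau> w 1] by simp

lemma weight_coeff_zero [simp]: "weight_coeff \<tau> w 0 = 0"
  by (simp add: weight_coeff_def)

lemma weight_coeff_hscale: "h \<in> Hspace \<Longrightarrow> weight_coeff \<tau> w (hscale c h) = c * weight_coeff \<tau> w h"
  by (induction rule: Hspace_induct)
    (simp_all add: weight_coeff_hscale_bas weight_coeff_add hscale_add algebra_simps)

lemma weight_coeff_diff: "weight_coeff \<tau> w (h - k) = weight_coeff \<tau> w h - weight_coeff \<tau> w k"
  using weight_coeff_add[of \<tau> w "h - k" k] by simp

lemma weight_coeff_Z_mul: assumes "\<tau> \<in> torus" "h \<in> Hspace"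
  shows "weight_coeff \<tau> w (mul (Z \<mu>) h) = \<tau> \<mu> * weight_coeff \<tau> w h"
  using assms(2)
proof (induction rule: Hspace_induct)
  case (bas \<nu> v c)
  then show ?case using assms(1) by (simp add: mul_simps mul_Z_bas weight_coeff_hscale_bas torus_add)
qed (simp_all add: mul_simps weight_coeff_add algebra_simps)

text \<open>Bounds \<open>L \<tau>\<close> from above. Flipping moves the factor Z^mu - tau(mu) from
  the right end to the left, where evaluation at tau kills it.\<close>

lemma L_weight_coeff: assumes \<tau>: "\<tau> \<in> torus" and h: "h \<in> L \<tau>"
  shows "weight_coeff \<tau> w (flip_H h) = 0"
proof -
  \<comment> \<open>Quantifying over all left multiples makes this a left ideal; the multiplier 1
    gives the claim at the end.\<close>
  let ?N = "{h \<in> Hspace. \<forall>k\<in>Hspace. weight_coeff \<tau> w (flip_H (mul k h)) = 0}"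
  have "left_ideal ?N"
  proof (rule left_idealI)
    fix h x assume h: "h \<in> Hspace" and x: "x \<in> ?N"
    then have "weight_coeff \<tau> w (flip_H (mul (mul k h) x)) = 0" if "k \<in> Hspace" for k
      using that mul_in by blast
    then show "mul h x \<in> ?N" using h x by (simp add: mul_assoc)
  qed (simp_all add: mul_add_right flip_add weight_coeff_add subset_iff)
  moreover have "wt ?N \<tau> unit_H"
  proof -
    have "weight_coeff \<tau> w (flip_H (mul k (Z \<mu> - hscale (\<tau> \<mu>) unit_H))) = 0" if k: "k \<in> Hspace" for k \<mu>
    proof -
      have "flip_H (Z \<mu> - hscale (\<tau> \<mu>) unit_H) = Z \<mu> - hscale (\<tau> \<mu>) unit_H"
        by (simp add: flip_diff flip_hscale flip_Z)
      note eq = this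
      have "flip_H (mul k (Z \<mu> - hscale (\<tau> \<mu>) unit_H)) = mul (Z \<mu> - hscale (\<tau> \<mu>) unit_H) (flip_H k)"
        using flip_mul[OF k, of "Z \<mu> - hscale (\<tau> \<mu>) unit_H"] unfolding eq by auto
      moreover have "weight_coeff \<tau> w (mul (Z \<mu> - hscale (\<tau> \<mu>) unit_H) (flip_H k)) = 0"
        using k \<tau> by (simp add: mul_diff_left mul_scale_left)
          (simp add: weight_coeff_diff weight_coeff_hscale weight_coeff_Z_mul)
      ultimately show ?thesis by (simp only:)
    qed
    then show ?thesis by (simp add: wt_def)
  qed
  ultimately have "h \<in> ?N" using h unfolding L_def by blast
  then have "\<forall>k\<in>Hspace. weight_coeff \<tau> w (flip_H (mul k h)) = 0" by simp
  from bspec[OF this Hspace_bas[OF id_in_W, of 0]] show ?thesis using left_ideal_subset[OF left_ideal_L h] by simp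
qed

lemma unit_notin_L: assumes "\<tau> \<in> torus" shows "unit_H \<notin> L \<tau>"
  using L_weight_coeff[OF assms, of unit_H id] assms by (auto simp: flip_Z weight_coeff_bas)

text \<open>The H_s-coefficient is 1, so an intertwiner has non-zero class for every scalar c, even
  when its product with the opposite one vanishes.\<close>

lemma T_notin_L: assumes "\<tau> \<in> torus" "i \<in> I" shows "T i - hscale c unit_H \<notin> L \<tau>"
proof
  assume "T i - hscale c unit_H \<in> L \<tau>"
  then have "weight_coeff \<tau> (r i) (flip_H (T i - hscale c unit_H)) = 0" by (rule L_weight_coeff[OF assms(1)])
  moreover have "flip_H (T i - hscale c unit_H) = T i - hscale c unit_H"
    using assms by (simp add: flip_diff flip_hscale flip_Z flip_T)
  moreover have "id \<noteq> r i" using len_r[OF assms(2)] by auto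
  ultimately show False using assms by (simp add: weight_coeff_diff weight_coeff_hscale_bas weight_coeff_bas)
qed

lemma wt_emb:
  assumes N: "left_ideal N" and v: "wt N \<chi> v"
  shows "mul (emb P) v - hscale (evalt \<chi> P) v \<in> N"
proof (induction P rule: poly_mapping_induct)
  case zero
  then show ?case using v N by (simp add: wt_def left_ideal_zero)
next
  case (single \<mu> c)
  have "hscale c (mul (Z \<mu>) v - hscale (\<chi> \<mu>) v) \<in> N"
    using v N by (intro left_ideal_hscale) (simp_all add: wt_def)
  then show ?case using v by (simp add: wt_def mul_simps hscale_diff)
next
  case (add P Q)
  have "mul (emb (P + Q)) v - hscale (evalt \<chi> (P + Q)) v
     = (mul (emb P) v - hscale (evalt \<chi> P) v) + (mul (emb Q) v - hscale (evalt \<chi> Q) v)"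
    using v by (simp add: wt_def emb_add evalt_add mul_simps hscale_add_left)
  then show ?case using left_ideal_add[OF N add] by simp
qed

section \<open>Intertwining elements\<close>

definition intertwiner :: "'i \<Rightarrow> ('y \<Rightarrow> complex) \<Rightarrow> 'y hecke" where
  "intertwiner i \<chi> = T i - hscale (Qval i \<chi>) unit_H"

lemma intertwiner_in [simp, intro]: "i \<in> I \<Longrightarrow> intertwiner i \<chi> \<in> Hspace"
  by (simp add: intertwiner_def)

lemma Z_T_mul: "i \<in> I \<Longrightarrow> v \<in> Hspace \<Longrightarrow>
   mul (Z \<mu>) (mul (T i) v) = mul (T i) (mul (Z (r i \<mu>)) v) + mul (emb (Bern i \<mu>)) v"
  by (simp add: Z_T mul_simps flip: mul_assoc)

lemma wt_intertwiner:
  assumes N: "left_ideal N" and v: "wt N \<chi> v" and i: "i \<in> I" and \<chi>: "\<chi> \<in> torus" "Qregular i \<chi>"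
  shows "wt N (\<chi> \<circ> r i) (mul (intertwiner i \<chi>) v)"
  unfolding wt_def
proof (intro conjI allI)
  have vH: "v \<in> Hspace" using v by (simp add: wt_def)
  then show "mul (intertwiner i \<chi>) v \<in> Hspace" using i by simp
  fix \<mu>
  let ?q = "Qval i \<chi>"
  \<comment> \<open>The errors made when Z^(s mu), the Bernstein term and Z^mu act on
    \<open>v\<close> through chi; all lie in \<open>N\<close>. Since the Bernstein term has value Q
    (chi(mu) - chi(s mu)), the combination H_s x + y - Q z is the weight defect of the
    image.\<close>
  define x where "x = mul (Z (r i \<mu>)) v - hscale (\<chi> (r i \<mu>)) v"
  define y where "y = mul (emb (Bern i \<mu>)) v - hscale (evalt \<chi> (Bern i \<mu>)) v"
  define z where "z = mul (Z \<mu>) v - hscale (\<chi> \<mu>) v"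
  have xyz: "x \<in> N" "y \<in> N" "z \<in> N" using v wt_emb[OF N v] by (auto simp: wt_def x_def y_def z_def)
  have "mul (T i) x + y - hscale ?q z \<in> N"
    using xyz N i by (intro left_ideal_add left_ideal_diff left_ideal_mul left_ideal_hscale) auto
  also have "mul (T i) x + y - hscale ?q z = mul (Z \<mu>) (mul (intertwiner i \<chi>) v)
      - hscale ((\<chi> \<circ> r i) \<mu>) (mul (intertwiner i \<chi>) v)"
    using vH i by (simp add: x_def y_def z_def intertwiner_def mul_simps Z_T_mul
        Q_element_eval[OF i \<chi> Bern_frac[OF i]] hscale_diff hscale_diff_left right_diff_distrib mult.commute)
  finally show "mul (Z \<mu>) (mul (intertwiner i \<chi>) v) - hscale ((\<chi> \<circ> r i) \<mu>) (mul (intertwiner i \<chi>) v) \<in> N" .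
qed

text \<open>(H_s - a) (H_s - b) = 1 + a b as soon as a + b is the linear coefficient of the
  quadratic relation.\<close>

lemma intertwiner_mul:
  assumes i: "i \<in> I" and \<chi>: "\<chi> \<in> torus" "Qregular i \<chi>"
  defines "c \<equiv> 1 + Qval i \<chi> * Qval i (\<chi> \<circ> r i)"
  shows "mul (intertwiner i (\<chi> \<circ> r i)) (intertwiner i \<chi>) = hscale c unit_H"
    and "mul (intertwiner i \<chi>) (intertwiner i (\<chi> \<circ> r i)) = hscale c unit_H"
proof -
  have "mul (T i - hscale a unit_H) (T i - hscale b unit_H) = hscale (1 + a * b) unit_H"
    if "a + b = \<sigma> i - inverse (\<sigma> i)" for a b
    using i by (simp add: mul_simps T_sq hscale_diff hscale_add_left mult.commute flip: that)
  from this[of "Qval i (\<chi> \<circ> r i)" "Qval i \<chi>"] this[of "Qval i \<chi>" "Qval i (\<chi> \<circ> r i)"]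
  show "mul (intertwiner i (\<chi> \<circ> r i)) (intertwiner i \<chi>) = hscale c unit_H"
    "mul (intertwiner i \<chi>) (intertwiner i (\<chi> \<circ> r i)) = hscale c unit_H"
    using Qval_sum[OF assms(1-3)] by (simp_all add: intertwiner_def c_def add.commute mult.commute)
qed

text \<open>Generalised weight vectors: this replaces the decomposition of finite-dimensional
  \<open>\<complex>[Y]\<close>-stable subspaces into generalised weight spaces.\<close>

primrec killed :: "'y hecke set \<Rightarrow> ('y \<Rightarrow> complex) list \<Rightarrow> 'y hecke set" where
  "killed N [] = N"
| "killed N (\<chi> # cs) = {x \<in> Hspace. \<forall>\<mu>. mul (Z \<mu>) x - hscale (\<chi> \<mu>) x \<in> killed N cs}"

context
  fixes N assumes N: "left_ideal N"
begin

lemma killed_Hspace: "x \<in> killed N cs \<Longrightarrow> x \<in> Hspace"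
  by (cases cs) (auto intro: left_ideal_subset[OF N])

lemma killed_zero: "0 \<in> killed N cs"
  by (induction cs) (auto simp: left_ideal_zero[OF N])

lemma killed_add: "x \<in> killed N cs \<Longrightarrow> y \<in> killed N cs \<Longrightarrow> x + y \<in> killed N cs"
proof (induction cs arbitrary: x y)
  case (Cons \<chi> cs)
  have "mul (Z \<mu>) (x + y) - hscale (\<chi> \<mu>) (x + y)
      = (mul (Z \<mu>) x - hscale (\<chi> \<mu>) x) + (mul (Z \<mu>) y - hscale (\<chi> \<mu>) y)" for \<mu>
    using Cons.prems by (simp add: mul_simps hscale_add)
  then show ?case using Cons by simp
qed (simp add: left_ideal_add[OF N])

lemma killed_hscale: "x \<in> killed N cs \<Longrightarrow> hscale c x \<in> killed N cs"
proof (induction cs arbitrary: x)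
  case (Cons \<chi> cs)
  have "mul (Z \<mu>) (hscale c x) - hscale (\<chi> \<mu>) (hscale c x) = hscale c (mul (Z \<mu>) x - hscale (\<chi> \<mu>) x)" for \<mu>
    using Cons.prems by (simp add: mul_simps hscale_diff mult.commute)
  then show ?case using Cons by simp
qed (simp add: left_ideal_hscale[OF N])

lemma killed_diff: "x \<in> killed N cs \<Longrightarrow> y \<in> killed N cs \<Longrightarrow> x - y \<in> killed N cs"
  using killed_add[of x cs "hscale (-1) y"] killed_hscale[of y cs "-1"] by (simp add: hscale_minus_left)

lemma killed_Z: "x \<in> killed N cs \<Longrightarrow> mul (Z \<nu>) x \<in> killed N cs"
proof (induction cs arbitrary: x)
  case (Cons \<chi> cs)
  have "mul (Z \<mu>) (mul (Z \<nu>) x) - hscale (\<chi> \<mu>) (mul (Z \<nu>) x) = mul (Z \<nu>) (mul (Z \<mu>) x - hscale (\<chi> \<mu>) x)" for \<mu>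
    using Cons.prems by (simp add: mul_simps mul_Z_Z add.commute flip: mul_assoc)
  then show ?case using Cons by simp
qed (simp add: left_ideal_mul[OF N])

lemma killed_emb: assumes "x \<in> killed N cs" shows "mul (emb P) x \<in> killed N cs"
  by (induction P rule: poly_mapping_induct)
    (use assms killed_Hspace[OF assms] in \<open>simp_all add: killed_zero emb_add mul_simps killed_add killed_hscale killed_Z\<close>)

lemma killed_Cons: "x \<in> killed N cs \<Longrightarrow> x \<in> killed N (\<chi> # cs)"
  by (simp add: killed_Hspace killed_diff killed_Z killed_hscale)

lemma killed_append_right: "x \<in> killed N bs \<Longrightarrow> x \<in> killed N (as @ bs)"
  by (induction as) (simp_all add: killed_Cons del: killed.simps)

text \<open>An extra factor is harmless at any depth, since each \<open>killed\<close> set is stable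
  under \<complex>[Y]. This aligns the two lists in \<open>killed_T\<close>.\<close>

lemma killed_insert: "x \<in> killed N (as @ bs) \<Longrightarrow> x \<in> killed N (as @ \<chi> # bs)"
proof (induction as arbitrary: x)
  case Nil
  then show ?case using killed_Cons by simp
qed simp

lemma killed_append_left: "x \<in> killed N as \<Longrightarrow> x \<in> killed N (as @ bs)"
proof (induction as arbitrary: x)
  case Nil
  then show ?case using killed_append_right[of x "[]" bs] by simp
qed simp

text \<open>Moving Z^mu past H_s reflects it and adds a \<complex>[Y]-multiple of x. The first part
  is treated by the reflected weights, the second is still killed by the original list; hence both
  lists, one after the other.\<close>

lemma killed_T: "i \<in> I \<Longrightarrow> x \<in> killed N cs \<Longrightarrow> mul (T i) x \<in> killed N (map (\<lambda>\<chi>. \<chi> \<circ> r i) cs @ cs)"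
proof (induction cs arbitrary: x)
  case (Cons \<chi> cs)
  have xH: "x \<in> Hspace" using killed_Hspace[OF Cons.prems(2)] .
  let ?cs = "map (\<lambda>\<chi>. \<chi> \<circ> r i) cs"
  have "mul (Z \<mu>) (mul (T i) x) - hscale (\<chi> (r i \<mu>)) (mul (T i) x) \<in> killed N (?cs @ \<chi> # cs)" for \<mu>
  proof -
    have "mul (Z (r i \<mu>)) x - hscale (\<chi> (r i \<mu>)) x \<in> killed N cs" using Cons.prems by simp
    then have "mul (T i) (mul (Z (r i \<mu>)) x - hscale (\<chi> (r i \<mu>)) x) \<in> killed N (?cs @ \<chi> # cs)"
      using Cons.IH Cons.prems(1) killed_insert by blast
    moreover have "mul (emb (Bern i \<mu>)) x \<in> killed N (?cs @ \<chi> # cs)"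
      by (intro killed_append_right killed_emb) (rule Cons.prems(2))
    ultimately have "mul (T i) (mul (Z (r i \<mu>)) x - hscale (\<chi> (r i \<mu>)) x) + mul (emb (Bern i \<mu>)) x
        \<in> killed N (?cs @ \<chi> # cs)" by (rule killed_add)
    then show ?thesis using xH Cons.prems(1) by (simp add: Z_T_mul mul_simps diff_add_eq)
  qed
  then show ?case using xH Cons.prems(1) by (simp add: comp_def)
qed (simp add: left_ideal_mul[OF N])

text \<open>Either x already has the first weight, or some (Z^mu - chi(mu)) x is non-zero modulo
  \<open>N\<close> and is killed by the remaining list. The empty list cannot occur, as x is not in
  \<open>N\<close>.\<close>

lemma killed_weight_vector:
  assumes "x \<in> killed N cs" "x \<notin> N"
  shows "\<exists>h\<in>Hspace. \<exists>\<chi>\<in>set cs. mul h x \<notin> N \<and> wt N \<chi> (mul h x)"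
  using assms
proof (induction cs arbitrary: x)
  case (Cons \<chi> cs)
  have xH: "x \<in> Hspace" using killed_Hspace[OF Cons.prems(1)] .
  show ?case
  proof (cases "wt N \<chi> x")
    case True
    then show ?thesis using Cons.prems(2) xH by (intro bexI[of _ unit_H] bexI[of _ \<chi>]) simp_all
  next
    case False
    then obtain \<mu> where \<mu>: "mul (Z \<mu>) x - hscale (\<chi> \<mu>) x \<notin> N" using xH by (auto simp: wt_def)
    moreover have "mul (Z \<mu>) x - hscale (\<chi> \<mu>) x \<in> killed N cs" using Cons.prems by simp
    moreover have eq: "mul (Z \<mu>) x - hscale (\<chi> \<mu>) x = mul (Z \<mu> - hscale (\<chi> \<mu>) unit_H) x"
      using xH by (simp add: mul_simps)
    ultimately obtain h \<psi> where h: "h \<in> Hspace" "\<psi> \<in> set cs"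
      "mul h (mul (Z \<mu> - hscale (\<chi> \<mu>) unit_H) x) \<notin> N"
      "wt N \<psi> (mul h (mul (Z \<mu> - hscale (\<chi> \<mu>) unit_H) x))"
      using Cons.IH by metis
    then show ?thesis using xH
      by (intro bexI[of _ "mul h (Z \<mu> - hscale (\<chi> \<mu>) unit_H)"] bexI[of _ \<psi>]) (simp_all add: mul_assoc)
  qed
qed simp

end

text \<open>The class of 1 is killed by the single weight tau, Z^mu keeps the list, H_s adds the
  reflected weights, and sums concatenate lists.\<close>

lemma all_killed:
  assumes "h \<in> Hspace"
  shows "\<exists>cs. set cs \<subseteq> {\<tau> \<circ> w | w. w \<in> W} \<and> h \<in> killed (L \<tau>) cs"
  using assms
proof (induction rule: H_induct)
  case unit
  show ?case using wt_L[of \<tau>]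
    by (intro exI[of _ "[\<tau>]"]) (auto simp: wt_def intro!: exI[of _ id])
next
  case (Z \<mu> h)
  then show ?case using killed_Z[OF left_ideal_L] by blast
next
  case (T i h)
  then obtain cs where cs: "set cs \<subseteq> {\<tau> \<circ> w | w. w \<in> W}" "h \<in> killed (L \<tau>) cs" by blast
  have "set (map (\<lambda>\<chi>. \<chi> \<circ> r i) cs @ cs) \<subseteq> {\<tau> \<circ> w | w. w \<in> W}"
  proof
    fix \<chi> assume "\<chi> \<in> set (map (\<lambda>\<chi>. \<chi> \<circ> r i) cs @ cs)"
    then consider \<psi> where "\<psi> \<in> set cs" "\<chi> = \<psi> \<circ> r i" | "\<chi> \<in> set cs" by auto
    then show "\<chi> \<in> {\<tau> \<circ> w | w. w \<in> W}"
    proof cases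
      case 1
      then obtain w where w: "w \<in> W" "\<psi> = \<tau> \<circ> w" using cs(1) by blast
      have "\<chi> = \<tau> \<circ> (w \<circ> r i)" using 1 w by (simp add: o_assoc)
      then show ?thesis using w(1) T(1) comp_in_W r_in_W by blast
    qed (use cs(1) in blast)
  qed
  then show ?case using killed_T[OF left_ideal_L T(1) cs(2)] by blast
next
  case (add h k)
  then obtain cs ds where "set cs \<subseteq> {\<tau> \<circ> w | w. w \<in> W}" "h \<in> killed (L \<tau>) cs"
     "set ds \<subseteq> {\<tau> \<circ> w | w. w \<in> W}" "k \<in> killed (L \<tau>) ds" by blast
  then have "h \<in> killed (L \<tau>) (cs @ ds)" "k \<in> killed (L \<tau>) (cs @ ds)" "set (cs @ ds) \<subseteq> {\<tau> \<circ> w | w. w \<in> W}"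
    using killed_append_left[OF left_ideal_L] killed_append_right[OF left_ideal_L] by auto
  then show ?case using killed_add[OF left_ideal_L] by blast
next
  case (scale c h)
  then show ?case using killed_hscale[OF left_ideal_L] by blast
qed

text \<open>Each step removes the last letter of the word. \<open>N\<close> holds the relations;
  \<open>M\<close> is the submodule that the vector must not leave.\<close>

lemma weight_vector_descend:
  assumes N: "left_ideal N" "left_ideal M" and \<tau>: "\<tau> \<in> torus"
    and U: "\<forall>w\<in>W. \<forall>i\<in>I. Nval i (\<tau> \<circ> w) \<noteq> 0"
    and "set ks \<subseteq> I" "v \<in> M" "v \<notin> N" "wt N (\<tau> \<circ> word ks) v"
  shows "\<exists>v'\<in>M. v' \<notin> N \<and> wt N \<tau> v'"
  using assms(5-)
proof (induction ks arbitrary: v rule: rev_induct)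
  case Nil
  then show ?case by auto
next
  case (snoc i ks)
  have i: "i \<in> I" "set ks \<subseteq> I" using snoc.prems by auto
  define \<chi> where "\<chi> = \<tau> \<circ> (word ks \<circ> r i)"
  have "wt N (\<tau> \<circ> word (ks @ [i])) v" by (rule snoc.prems(4))
  then have v: "wt N \<chi> v" by (simp add: \<chi>_def word_append)
  then have vH: "v \<in> Hspace" by (simp add: wt_def)
  have refl: "\<chi> \<circ> r i = \<tau> \<circ> word ks" using i by (simp add: \<chi>_def r_comp_r flip: o_assoc)
  have t: "\<chi> \<in> torus" unfolding \<chi>_def using i by (intro torus_comp \<tau> additive_W) (simp add: word_in_W)
  show ?case
  proof (cases "Qregular i \<chi>")
    case False
    have "\<chi> = \<tau> \<circ> word ks" using trans[OF sym[OF singular_fixed[OF i(1) t False]] refl] .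
    then have "wt N (\<tau> \<circ> word ks) v" using v by (simp only:)
    then show ?thesis by (rule snoc.IH[OF i(2) snoc.prems(2,3)])
  next
    case reg: True
    let ?a = "intertwiner i \<chi>" and ?b = "intertwiner i (\<chi> \<circ> r i)"
    let ?c = "1 + Qval i \<chi> * Qval i (\<chi> \<circ> r i)"
    have "Nval i \<chi> \<noteq> 0" "Nval i (\<chi> \<circ> r i) \<noteq> 0"
      using U i unfolding refl by (auto simp: \<chi>_def word_in_W)
    then have c: "?c \<noteq> 0" using Qval_prod_zero_iff[OF i(1) t reg] by blast
    have "mul ?b (mul ?a v) = hscale ?c v"
      using i vH intertwiner_mul(1)[OF i(1) t reg] by (simp add: mul_simps flip: mul_assoc)
    then have "mul ?a v \<notin> N"
      using left_ideal_mul[OF N(1), of ?b "mul ?a v"] left_ideal_hscale_iff[OF N(1) c] snoc.prems(3) i by auto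
    moreover have "mul ?a v \<in> M" using left_ideal_mul[OF N(2)] snoc.prems(2) i by simp
    moreover have "wt N (\<tau> \<circ> word ks) (mul ?a v)" using wt_intertwiner[OF N(1) v i(1) t reg] refl by simp
    ultimately show ?thesis using snoc.IH[OF i(2)] by blast
  qed
qed

text \<open>Irreducibility of the algebra modulo \<open>L \<tau>\<close>; non-triviality of that
  quotient is supplied by \<open>unit_notin_L\<close>.\<close>

definition irr :: "('y \<Rightarrow> complex) \<Rightarrow> bool" where
  "irr \<tau> \<longleftrightarrow> (\<forall>N. left_ideal N \<longrightarrow> L \<tau> \<subseteq> N \<longrightarrow> N = L \<tau> \<or> N = Hspace)"

lemma irr_if_U_and_scalar:
  assumes \<tau>: "\<tau> \<in> torus" and U: "\<tau> \<in> U_set"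
    and scalar: "\<And>v. wt (L \<tau>) \<tau> v \<Longrightarrow> \<exists>c. v - hscale c unit_H \<in> L \<tau>"
  shows "irr \<tau>"
  unfolding irr_def
proof (intro allI impI)
  fix N assume N: "left_ideal N" "L \<tau> \<subseteq> N"
  show "N = L \<tau> \<or> N = Hspace"
  proof (cases "N = L \<tau>")
    case False
    then obtain x where x: "x \<in> N" "x \<notin> L \<tau>" using N by blast
    have xH: "x \<in> Hspace" using left_ideal_subset[OF N(1) x(1)] .
    obtain cs where cs: "set cs \<subseteq> {\<tau> \<circ> w | w. w \<in> W}" "x \<in> killed (L \<tau>) cs" using all_killed[OF xH] by blast
    obtain h w where h: "h \<in> Hspace" "w \<in> W" "mul h x \<notin> L \<tau>" "wt (L \<tau>) (\<tau> \<circ> w) (mul h x)"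
      using killed_weight_vector[OF left_ideal_L cs(2) x(2)] cs(1) by blast
    obtain ks where "set ks \<subseteq> I" "w = word ks" using W_word[OF h(2)] by blast
    then obtain v where v: "v \<in> N" "v \<notin> L \<tau>" "wt (L \<tau>) \<tau> v"
      using weight_vector_descend[OF left_ideal_L N(1) \<tau>, of ks "mul h x"] h left_ideal_mul[OF N(1) h(1) x(1)]
        U_set_iff[OF \<tau>] U by blast
    then obtain c where c: "v - hscale c unit_H \<in> L \<tau>" using scalar by blast
    have "c \<noteq> 0" using c v(2) by auto
    have "v - (v - hscale c unit_H) \<in> N" using left_ideal_diff[OF N(1) v(1)] c N(2) by blast
    then have "unit_H \<in> N" using left_ideal_hscale_iff[OF N(1) \<open>c \<noteq> 0\<close>] by simp
    then show ?thesis using left_ideal_unit[OF N(1)] by blast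
  qed simp
qed

text \<open>The map \<open>h \<otimes>\<^sub>\<chi> 1 \<mapsto> h x\<close> from \<open>I\<^sub>\<chi>\<close> to \<open>I\<^sub>\<tau>\<close> is injective for some \<open>x\<close>.\<close>

definition embeds :: "('y \<Rightarrow> complex) \<Rightarrow> ('y \<Rightarrow> complex) \<Rightarrow> bool" where
  "embeds \<tau> \<chi> \<longleftrightarrow> (\<exists>x. wt (L \<tau>) \<chi> x \<and> (\<forall>h\<in>Hspace. mul h x \<in> L \<tau> \<longrightarrow> h \<in> L \<chi>))"

text \<open>In the regular case the new embedding sends 1 to a x. Right multiplication by b maps
  I_chi to I_psi, and a b = c turns h a = 0 in I_chi into c h = 0 in I_psi; so all depends on c
  being non-zero.\<close>

lemma irr_embeds_step:
  assumes irr: "irr \<tau>" and \<chi>: "\<chi> \<in> torus" and emb: "embeds \<tau> \<chi>" and i: "i \<in> I"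
  shows "Nval i \<chi> \<noteq> 0 \<and> embeds \<tau> (\<chi> \<circ> r i)"
proof (cases "Qregular i \<chi>")
  case False
  then show ?thesis using Nval_nz_of_singular[OF i False] singular_fixed[OF i \<chi> False] emb by simp
next
  case reg: True
  obtain x where x: "wt (L \<tau>) \<chi> x" "\<And>h. h \<in> Hspace \<Longrightarrow> mul h x \<in> L \<tau> \<Longrightarrow> h \<in> L \<chi>"
    using emb unfolding embeds_def by blast
  have xH: "x \<in> Hspace" using x(1) by (simp add: wt_def)
  define \<psi> where "\<psi> = \<chi> \<circ> r i"
  have \<psi>: "\<psi> \<in> torus" using \<chi> i by (simp add: \<psi>_def torus_comp additive_r)
  define a where "a = intertwiner i \<chi>"
  define b where "b = intertwiner i \<psi>"
  define c where "c = 1 + Qval i \<chi> * Qval i \<psi>"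
  have ab: "a \<in> Hspace" "b \<in> Hspace" "a \<notin> L \<chi>" "b \<notin> L \<psi>"
    using i T_notin_L[OF \<chi> i] T_notin_L[OF \<psi> i] by (simp_all add: a_def b_def) (simp_all add: intertwiner_def)
  have ab_mul: "mul a b = hscale c unit_H"
    using intertwiner_mul(2)[OF i \<chi> reg] by (simp add: a_def b_def c_def \<psi>_def)
  have b_wt: "wt (L \<psi>) \<chi> b"
  proof -
    have "Qregular i \<psi>" using Qregular_reflect[OF i \<chi>] reg by (simp add: \<psi>_def)
    then have "wt (L \<psi>) (\<psi> \<circ> r i) (mul b unit_H)"
      unfolding b_def using wt_intertwiner[OF left_ideal_L wt_L i \<psi>] by blast
    then show ?thesis using ab i by (simp add: \<psi>_def r_comp_r flip: o_assoc)
  qed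
  have c: "c \<noteq> 0"
  proof
    assume c0: "c = 0"
    \<comment> \<open>The image in I_tau of the kernel of right multiplication by b on I_chi. For c
      = 0 it contains a x, so irreducibility makes it everything; then 1 lies in that kernel, that
      is, b vanishes in I_psi.\<close>
    define N where "N = {z \<in> Hspace. \<exists>h\<in>Hspace. mul h b \<in> L \<psi> \<and> z - mul h x \<in> L \<tau>}"
    have "left_ideal N"
    proof (rule left_idealI)
      show "N \<subseteq> Hspace" by (auto simp: N_def)
      show "0 \<in> N" unfolding N_def using ab xH left_ideal_zero[OF left_ideal_L] by (auto intro!: bexI[of _ 0])
      fix z k assume k: "k \<in> N"
      then obtain h' where h': "k \<in> Hspace" "h' \<in> Hspace" "mul h' b \<in> L \<psi>" "k - mul h' x \<in> L \<tau>"
        by (auto simp: N_def)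
      {
        assume "z \<in> N"
        then obtain h where h: "z \<in> Hspace" "h \<in> Hspace" "mul h b \<in> L \<psi>" "z - mul h x \<in> L \<tau>"
          by (auto simp: N_def)
        have "mul (h + h') b \<in> L \<psi>"
          using left_ideal_add[OF left_ideal_L h(3) h'(3)] ab h h' by (simp add: mul_simps)
        moreover have "z + k - mul (h + h') x \<in> L \<tau>"
          using left_ideal_add[OF left_ideal_L h(4) h'(4)] xH h h' by (simp add: mul_simps algebra_simps)
        ultimately show "z + k \<in> N" unfolding N_def using h h' by blast
      next
        assume z: "z \<in> Hspace"
        have "mul (mul z h') b \<in> L \<psi>"
          using left_ideal_mul[OF left_ideal_L z h'(3)] ab h' z by (simp add: mul_assoc)
        moreover have "mul z k - mul (mul z h') x \<in> L \<tau>"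
          using left_ideal_mul[OF left_ideal_L z h'(4)] xH h' z by (simp add: mul_simps mul_assoc)
        ultimately show "mul z k \<in> N" unfolding N_def using h' z by blast
      }
    qed
    moreover have "L \<tau> \<subseteq> N"
      unfolding N_def using ab xH left_ideal_zero[OF left_ideal_L] left_ideal_subset[OF left_ideal_L]
      by (auto intro!: bexI[of _ 0])
    moreover have "mul a x \<in> N" "mul a x \<notin> L \<tau>"
      using ab xH x(2)[of a] ab_mul c0 left_ideal_zero[OF left_ideal_L]
      by (auto simp: N_def intro!: bexI[of _ a])
    ultimately have "N = Hspace" using irr unfolding irr_def by blast
    then obtain h where h: "h \<in> Hspace" "mul h b \<in> L \<psi>" "x - mul h x \<in> L \<tau>" using xH by (auto simp: N_def)
    then have "unit_H - h \<in> L \<chi>" using x(2)[of "unit_H - h"] xH by (simp add: mul_simps)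
    then have "mul (unit_H - h) b \<in> L \<psi>" by (rule L_mul_wt[OF left_ideal_L b_wt])
    then have "b - mul h b \<in> L \<psi>" using ab h by (simp add: mul_simps)
    then have "(b - mul h b) + mul h b \<in> L \<psi>" using h(2) by (rule left_ideal_add[OF left_ideal_L])
    then show False using ab(4) by simp
  qed
  then have "Nval i \<chi> \<noteq> 0" using Qval_prod_zero_iff[OF i \<chi> reg] by (simp add: c_def \<psi>_def)
  moreover have "embeds \<tau> \<psi>"
    unfolding embeds_def
  proof (intro exI[of _ "mul a x"] conjI ballI impI)
    show "wt (L \<tau>) \<psi> (mul a x)"
      using wt_intertwiner[OF left_ideal_L x(1) i \<chi> reg] by (simp add: a_def \<psi>_def)
    fix h assume h: "h \<in> Hspace" "mul h (mul a x) \<in> L \<tau>"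
    then have "mul h a \<in> L \<chi>" using x(2)[of "mul h a"] ab xH by (simp add: mul_assoc)
    then have "mul (mul h a) b \<in> L \<psi>" by (rule L_mul_wt[OF left_ideal_L b_wt])
    then have "hscale c h \<in> L \<psi>" using h ab ab_mul by (simp add: mul_assoc mul_simps)
    then show "h \<in> L \<psi>" using left_ideal_hscale_iff[OF left_ideal_L c] by simp
  qed
  ultimately show ?thesis by (simp add: \<psi>_def)
qed

lemma irr_imp_U: assumes irr: "irr \<tau>" and \<tau>: "\<tau> \<in> torus" shows "\<tau> \<in> U_set"
proof -
  have emb: "embeds \<tau> (\<tau> \<circ> word ks)" if "set ks \<subseteq> I" for ks
    using that
  proof (induction ks rule: rev_induct)
    case Nil
    show ?case unfolding embeds_def using wt_L by (intro exI[of _ unit_H]) auto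
  next
    case (snoc i ks)
    have IH: "embeds \<tau> (\<tau> \<circ> word ks)" by (rule snoc.IH) (use snoc.prems in simp)
    have "\<tau> \<circ> word ks \<in> torus" using snoc.prems by (intro torus_comp \<tau> additive_word) simp
    then have "embeds \<tau> ((\<tau> \<circ> word ks) \<circ> r i)"
      using irr_embeds_step[OF irr _ IH] snoc.prems by simp
    then show "embeds \<tau> (\<tau> \<circ> word (ks @ [i]))" by (simp add: word_append o_assoc)
  qed
  show ?thesis unfolding U_set_iff[OF \<tau>]
  proof (intro ballI)
    fix w i assume "w \<in> W" "i \<in> I"
    then show "Nval i (\<tau> \<circ> w) \<noteq> 0"
      using W_word[of w] emb irr_embeds_step[OF irr, of "\<tau> \<circ> w" i] torus_comp[OF \<tau> additive_W] by blast
  qed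
qed

end

section \<open>Schur's lemma in countable dimension\<close>

text \<open>Gaussian elimination: with a pivot c0 for the coordinate f, subtract multiples of its
  row and induct on the remaining coordinates.\<close>

lemma linear_dependence:
  fixes g :: "'c \<Rightarrow> 'f \<Rightarrow> 'k::field"
  assumes "finite F" "finite C" "card F < card C"
  shows "\<exists>a. (\<exists>c\<in>C. a c \<noteq> 0) \<and> (\<forall>f\<in>F. (\<Sum>c\<in>C. a c * g c f) = 0)"
  using assms
proof (induction F arbitrary: C g rule: finite_induct)
  case empty
  then have "C \<noteq> {}" by auto
  then show ?case by (intro exI[of _ "\<lambda>_. 1"]) auto
next
  case (insert f F)
  show ?case
  proof (cases "\<forall>c\<in>C. g c f = 0")
    case True
    obtain a where "\<exists>c\<in>C. a c \<noteq> 0" "\<forall>f\<in>F. (\<Sum>c\<in>C. a c * g c f) = 0"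
      using insert.IH[of C g] insert.prems insert.hyps by auto
    then show ?thesis using True by (intro exI[of _ a]) auto
  next
    case False
    then obtain c0 where c0: "c0 \<in> C" "g c0 f \<noteq> 0" by blast
    define C' where "C' = C - {c0}"
    have C': "finite C'" "C = insert c0 C'" "c0 \<notin> C'" using c0 insert.prems by (auto simp: C'_def)
    have "card F < card C'" using insert.prems insert.hyps C' by simp
    then obtain a where a: "\<exists>c\<in>C'. a c \<noteq> 0"
      "\<forall>k\<in>F. (\<Sum>c\<in>C'. a c * (g c k - g c f / g c0 f * g c0 k)) = 0"
      using insert.IH[of C' "\<lambda>c k. g c k - g c f / g c0 f * g c0 k"] C' by blast
    define s where "s = (\<Sum>c\<in>C'. a c * g c f)"
    define b where "b = a(c0 := - s / g c0 f)"
    have sum_b: "(\<Sum>c\<in>C. b c * g c k) = (\<Sum>c\<in>C'. a c * g c k) - s / g c0 f * g c0 k" for k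
    proof -
      have "(\<Sum>c\<in>C'. b c * g c k) = (\<Sum>c\<in>C'. a c * g c k)"
        using C' by (intro sum.cong) (auto simp: b_def)
      then show ?thesis using C' by (simp add: b_def)
    qed
    have "(\<Sum>c\<in>C. b c * g c k) = 0" if "k \<in> insert f F" for k
    proof (cases "k = f")
      case True
      then show ?thesis using c0 by (simp add: sum_b s_def)
    next
      case False
      then have "0 = (\<Sum>c\<in>C'. a c * (g c k - g c f / g c0 f * g c0 k))" using a that by simp
      also have "\<dots> = (\<Sum>c\<in>C'. a c * g c k) - (\<Sum>c\<in>C'. a c * g c f * (g c0 k / g c0 f))"
        by (simp add: right_diff_distrib sum_subtractf mult.assoc)
      also have "\<dots> = (\<Sum>c\<in>C. b c * g c k)"
        by (simp add: sum_b s_def sum_distrib_right sum_divide_distrib)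
      finally show ?thesis by simp
    qed
    moreover have "\<exists>c\<in>C. b c \<noteq> 0" using a(1) C' by (auto simp: b_def)
    ultimately show ?thesis by blast
  qed
qed

lemma (in root_generating_system) countable_Y: "countable (UNIV :: 'y set)"
proof -
  obtain n and e :: "nat \<Rightarrow> 'y" and co where co: "\<And>y. y = (\<Sum>j<n. zscale (co y j) (e j))"
    using ex_coordinates by metis
  define f where "f l = (\<Sum>j<n. zscale (l ! j) (e j))" for l :: "int list"
  have "y \<in> range f" for y
  proof
    show "y = f (map (co y) [0..<n])" unfolding f_def using co[of y] by simp
  qed simp
  then have "range f = UNIV" by blast
  then show ?thesis using countable_image[of UNIV f] by simp
qed

lemma (in root_generating_system) countable_W: "countable W"
proof -
  have "W \<subseteq> word ` lists I" using W_word by (fastforce simp: lists_eq_set)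
  moreover have "countable (lists I)" using finite_I by (intro countable_lists countable_finite)
  ultimately show ?thesis by (metis countable_image countable_subset)
qed

section \<open>Polynomials in one element, and Schur's lemma\<close>

context BL_hecke_algebra begin

definition pev :: "'y hecke \<Rightarrow> complex poly \<Rightarrow> 'y hecke" where
  "pev v p = fold_coeffs (\<lambda>a h. hscale a unit_H + mul v h) p 0"

context
  fixes v assumes v: "v \<in> Hspace"
begin

lemma pev_0 [simp]: "pev v 0 = 0"
  by (simp add: pev_def)

lemma pev_pCons: "pev v (pCons a p) = hscale a unit_H + mul v (pev v p)"
proof (cases "a = 0 \<and> p = 0")
  case True
  then show ?thesis using v by simp
next
  case False
  then show ?thesis unfolding pev_def by (cases "p = 0") simp_all
qed

lemma pev_in [simp, intro]: "pev v p \<in> Hspace"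
  by (induction p) (simp_all add: pev_pCons v)

lemma pev_add: "pev v (p + q) = pev v p + pev v q"
  by (induction p q rule: poly_induct2) (simp_all add: pev_pCons v mul_simps hscale_add_left)

lemma pev_smult: "pev v (smult c p) = hscale c (pev v p)"
  by (induction p) (simp_all add: pev_pCons v mul_simps hscale_add)

lemma pev_sum: "pev v (\<Sum>x\<in>S. f x) = (\<Sum>x\<in>S. pev v (f x))"
  by (induction S rule: infinite_finite_induct) (simp_all add: pev_add)

lemma pev_commute: "mul v (pev v p) = mul (pev v p) v"
proof (induction p)
  case (pCons a p)
  have "mul v (pev v (pCons a p)) = hscale a v + mul v (mul v (pev v p))"
    using v by (simp add: pev_pCons mul_simps)
  also have "\<dots> = mul (pev v (pCons a p)) v"
    unfolding pCons.IH using v by (simp add: pev_pCons mul_simps mul_assoc)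
  finally show ?case .
qed (simp add: v)

lemma pev_linear_mult: "pev v ([:-c, 1:] * p) = mul (v - hscale c unit_H) (pev v p)"
  using v by (simp add: pev_add pev_smult pev_pCons mul_simps hscale_minus_left del: smult_minus_left)

text \<open>Both positions of the linear factor are wanted: on the right it is cancelled by
  \<open>irr_mul_cancel\<close>, on the left it meets the left inverses of v - c.\<close>

lemma pev_linear_mult': "pev v ([:-c, 1:] * p) = mul (pev v p) (v - hscale c unit_H)"
  using v by (simp add: pev_linear_mult mul_simps pev_commute del: mult_pCons_left)

end

text \<open>Injective half of Schur's lemma: the kernel of right multiplication by \<open>v\<close>
  is a submodule, and not everything because 1 is mapped to v.\<close>

lemma irr_mul_cancel:
  assumes irr: "irr \<tau>" and \<tau>: "\<tau> \<in> torus" and v: "wt (L \<tau>) \<tau> v" "v \<notin> L \<tau>"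
    and h: "h \<in> Hspace" "mul h v \<in> L \<tau>"
  shows "h \<in> L \<tau>"
proof -
  have vH: "v \<in> Hspace" using v by (simp add: wt_def)
  let ?K = "{h \<in> Hspace. mul h v \<in> L \<tau>}"
  have "left_ideal ?K"
    using vH left_ideal_L[of \<tau>]
    by (intro left_idealI) (auto simp: mul_simps mul_assoc left_ideal_zero left_ideal_add left_ideal_mul)
  moreover have "L \<tau> \<subseteq> ?K"
    using L_mul_wt[OF left_ideal_L v(1)] left_ideal_subset[OF left_ideal_L] by blast
  moreover have "?K \<noteq> Hspace"
  proof
    assume "?K = Hspace"
    moreover have "unit_H \<in> Hspace" by simp
    ultimately have "mul unit_H v \<in> L \<tau>" by blast
    then show False using v(2) vH by simp
  qed
  ultimately have "?K = L \<tau>" using irr unfolding irr_def by blast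
  then show ?thesis using h by blast
qed

text \<open>The submodule generated by the class of \<open>v\<close> is everything, so it contains
  the class of 1.\<close>

lemma irr_left_inverse:
  assumes irr: "irr \<tau>" and v: "v \<in> Hspace" "v \<notin> L \<tau>"
  shows "\<exists>h\<in>Hspace. mul h v - unit_H \<in> L \<tau>"
proof -
  let ?N = "{z \<in> Hspace. \<exists>h\<in>Hspace. mul h v - z \<in> L \<tau>}"
  have "left_ideal ?N"
  proof (rule left_idealI)
    show "0 \<in> ?N" using v left_ideal_zero[OF left_ideal_L] by (auto intro!: bexI[of _ 0])
    fix z k assume "k \<in> ?N"
    then obtain h' where h': "k \<in> Hspace" "h' \<in> Hspace" "mul h' v - k \<in> L \<tau>" by blast
    {
      assume "z \<in> ?N"
      then obtain h where h: "z \<in> Hspace" "h \<in> Hspace" "mul h v - z \<in> L \<tau>" by blast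
      have "mul (h + h') v - (z + k) \<in> L \<tau>"
        using left_ideal_add[OF left_ideal_L h(3) h'(3)] v h h' by (simp add: mul_simps algebra_simps)
      then show "z + k \<in> ?N" using h h' Hspace_add by blast
    next
      assume z: "z \<in> Hspace"
      have "mul (mul z h') v - mul z k \<in> L \<tau>"
        using left_ideal_mul[OF left_ideal_L z h'(3)] v h' z by (simp add: mul_simps mul_assoc)
      then show "mul z k \<in> ?N" using h' z mul_in by blast
    }
  qed auto
  moreover have "L \<tau> \<subseteq> ?N"
  proof
    fix z assume z: "z \<in> L \<tau>"
    have "mul 0 v - z \<in> L \<tau>"
      using left_ideal_diff[OF left_ideal_L left_ideal_zero[OF left_ideal_L] z] v by simp
    then show "z \<in> ?N" using left_ideal_subset[OF left_ideal_L z] Hspace_zero by blast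
  qed
  moreover have "v \<in> ?N" using v left_ideal_zero[OF left_ideal_L] by (auto intro!: bexI[of _ unit_H])
  ultimately have "?N = Hspace" using irr v(2) unfolding irr_def by blast
  then have "unit_H \<in> ?N" by simp
  then show ?thesis by blast
qed

text \<open>Dixmier's form of Schur's lemma: if \<open>v\<close> is not a scalar, the elements \<open>(v - c)\<^sup>-\<^sup>1\<close>, \<open>c \<in> \<complex>\<close>,
  are linearly independent, but the algebra has countable dimension.\<close>

lemma irr_imp_scalar:
  assumes irr: "irr \<tau>" and \<tau>: "\<tau> \<in> torus" and v: "wt (L \<tau>) \<tau> v"
  shows "\<exists>c. v - hscale c unit_H \<in> L \<tau>"
proof (rule ccontr)
  assume "\<not> ?thesis"
  then have nonscalar: "v - hscale c unit_H \<notin> L \<tau>" for c by blast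
  have vH: "v \<in> Hspace" using v by (simp add: wt_def)
  have v_c: "wt (L \<tau>) \<tau> (v - hscale c unit_H)" for c
    unfolding wt_def
  proof (intro conjI allI)
    fix \<mu>
    have "mul (Z \<mu>) v - hscale (\<tau> \<mu>) v \<in> L \<tau>" "mul (Z \<mu>) unit_H - hscale (\<tau> \<mu>) unit_H \<in> L \<tau>"
      using v wt_L[of \<tau>] unfolding wt_def by blast+
    from left_ideal_diff[OF left_ideal_L this(1) left_ideal_hscale[OF left_ideal_L this(2), of c]]
    show "mul (Z \<mu>) (v - hscale c unit_H) - hscale (\<tau> \<mu>) (v - hscale c unit_H) \<in> L \<tau>"
      using vH by (simp add: mul_simps hscale_diff algebra_simps)
  qed (simp add: vH)
  \<comment> \<open>Over \<complex> a polynomial splits off a factor v - d, which can be cancelled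
    on the right as it is a weight vector outside \<open>L \<tau>\<close>; in the end a non-zero
    constant remains.\<close>
  have pev_notin: "pev v p \<notin> L \<tau>" if "p \<noteq> 0" for p
    using that
  proof (induction "degree p" arbitrary: p rule: less_induct)
    case less
    show ?case
    proof (cases "degree p = 0")
      case True
      then obtain a where "p = [:a:]" by (rule degree_eq_zeroE)
      then show ?thesis
        using less.prems vH unit_notin_L[OF \<tau>] left_ideal_hscale_iff[OF left_ideal_L] by (simp add: pev_pCons)
    next
      case False
      then have "\<not> constant (poly p)" by (simp add: constant_degree)
      then obtain d where "poly p d = 0" using fundamental_theorem_of_algebra by blast
      then obtain q where q: "p = [:-d, 1:] * q" by (auto simp: poly_eq_0_iff_dvd)
      then have "q \<noteq> 0" using less.prems by auto
      then have "degree p = Suc (degree q)" unfolding q by (subst degree_mult_eq) auto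
      then have "pev v q \<notin> L \<tau>" using less.hyps[of q] \<open>q \<noteq> 0\<close> by simp
      then show ?thesis
        unfolding q pev_linear_mult'[OF vH] using irr_mul_cancel[OF irr \<tau> v_c nonscalar] vH by blast
    qed
  qed
  \<comment> \<open>Since v has weight tau, right multiplication by v preserves
    \<open>L \<tau>\<close>, which is a priori only a left ideal.\<close>
  have L_pev: "mul x (pev v p) \<in> L \<tau>" if "x \<in> L \<tau>" for x p
    using that
  proof (induction p arbitrary: x)
    case 0
    then show ?case using left_ideal_subset[OF left_ideal_L 0] left_ideal_zero[OF left_ideal_L] vH by simp
  next
    case (pCons a p)
    have x: "x \<in> Hspace" using left_ideal_subset[OF left_ideal_L pCons.prems] .
    have "mul (mul x v) (pev v p) \<in> L \<tau>"
      using pCons.IH L_mul_wt[OF left_ideal_L v pCons.prems] by blast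
    then have "hscale a x + mul (mul x v) (pev v p) \<in> L \<tau>"
      using left_ideal_add[OF left_ideal_L left_ideal_hscale[OF left_ideal_L pCons.prems]] by blast
    then show ?case using x vH by (simp add: pev_pCons mul_simps mul_assoc)
  qed
  obtain u where u: "\<And>c. u c \<in> Hspace" "\<And>c. mul (u c) (v - hscale c unit_H) - unit_H \<in> L \<tau>"
  proof -
    have "v - hscale c unit_H \<in> Hspace" for c using vH by simp
    then have "\<forall>c. \<exists>h. h \<in> Hspace \<and> mul h (v - hscale c unit_H) - unit_H \<in> L \<tau>"
      using irr_left_inverse[OF irr _ nonscalar] by blast
    from choice[OF this] show thesis using that by blast
  qed
  have independent: "a c0 = 0" if C: "finite C" "c0 \<in> C" "(\<Sum>c\<in>C. hscale (a c) (u c)) = 0" for a C c0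
  proof -
    \<comment> \<open>Clearing denominators: modulo \<open>L \<tau>\<close>, u_c times the product
      of all v - d is the product over d different from c.\<close>
    define P where "P c = (\<Prod>d\<in>C - {c}. [:-d, 1:])" for c :: complex
    define PP where "PP = (\<Prod>d\<in>C. [:-d, 1:])"
    have "mul (u c) (pev v PP) - pev v (P c) \<in> L \<tau>" if "c \<in> C" for c
    proof -
      have "PP = [:-c, 1:] * P c" unfolding PP_def P_def using C(1) that by (rule prod.remove)
      then have "mul (u c) (pev v PP) - pev v (P c)
          = mul (mul (u c) (v - hscale c unit_H) - unit_H) (pev v (P c))"
        using u(1) vH by (simp add: pev_linear_mult mul_diff_left mul_assoc del: mult_pCons_left)
      then show ?thesis using L_pev[OF u(2)] by simp
    qed
    then have "(\<Sum>c\<in>C. hscale (a c) (mul (u c) (pev v PP) - pev v (P c))) \<in> L \<tau>"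
      by (intro left_ideal_sum left_ideal_hscale left_ideal_L)
    moreover have "(\<Sum>c\<in>C. hscale (a c) (mul (u c) (pev v PP))) = mul (\<Sum>c\<in>C. hscale (a c) (u c)) (pev v PP)"
      using C(1) u(1) vH by (induction C) (simp_all add: mul_simps)
    ultimately have "- (\<Sum>c\<in>C. hscale (a c) (pev v (P c))) \<in> L \<tau>"
      using C(3) vH by (simp add: hscale_diff sum_subtractf)
    then have "pev v (\<Sum>c\<in>C. smult (a c) (P c)) \<in> L \<tau>"
      using left_ideal_hscale[OF left_ideal_L, of "- (\<Sum>c\<in>C. hscale (a c) (pev v (P c)))" \<tau> "-1"] vH
      by (simp add: hscale_minus hscale_minus_left pev_sum pev_smult)
    then have "(\<Sum>c\<in>C. smult (a c) (P c)) = 0" using pev_notin by blast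
    then have "(\<Sum>c\<in>C. a c * poly (P c) c0) = 0" by (metis (no_types, lifting) poly_0 poly_smult poly_sum sum.cong)
    \<comment> \<open>As in Lagrange interpolation, every P_c with c different from c0 vanishes at
      c0.\<close>
    moreover have "(\<Sum>c\<in>C. a c * poly (P c) c0) = a c0 * poly (P c0) c0"
    proof -
      have "poly (P c) c0 = 0" if "c \<in> C - {c0}" for c
        using C that by (auto simp: P_def poly_prod)
      then show ?thesis using C by (simp add: sum.remove[of C c0])
    qed
    moreover have "poly (P c0) c0 \<noteq> 0" using C(1) by (auto simp: P_def poly_prod)
    ultimately show ?thesis by simp
  qed
  \<comment> \<open>Pigeonhole on supports: Y x W has countably many finite subsets, so one finite
    support F is shared by infinitely many u_c with c real, and card F + 1 of them are
    dependent.\<close>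
  define key where "key x = Poly_Mapping.keys (u (complex_of_real x))" for x
  have "countable (range key)"
  proof (rule countable_subset)
    show "range key \<subseteq> {A. finite A \<and> A \<subseteq> UNIV \<times> W}"
      using u(1) unfolding key_def Hspace_def by auto
    show "countable {A. finite A \<and> A \<subseteq> (UNIV :: 'y set) \<times> W}"
      by (intro countable_Collect_finite_subset countable_SIGMA countable_Y countable_W)
  qed
  moreover have "UNIV = (\<Union>F\<in>range key. {x. key x = F})" by auto
  ultimately obtain F where F: "\<not> countable {x. key x = F}" "F \<in> range key"
    using uncountable_UNIV_real countable_UN[of "range key" "\<lambda>F. {x. key x = F}"] by metis
  have "finite F" using F(2) by (auto simp: key_def)
  have "infinite {x. key x = F}" using F(1) countable_finite by auto
  from infinite_arbitrarily_large[OF this, of "card F + 1"]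
  obtain X where X: "X \<subseteq> {x. key x = F}" "card X = card F + 1" "finite X" by auto
  define C where "C = complex_of_real ` X"
  have "card C = card F + 1" "finite C" using X by (simp_all add: C_def card_image inj_on_def)
  then obtain a where a: "\<exists>c\<in>C. a c \<noteq> 0"
    "\<forall>k\<in>F. (\<Sum>c\<in>C. a c * Poly_Mapping.lookup (u c) k) = 0"
    using linear_dependence[OF \<open>finite F\<close> \<open>finite C\<close>, of "\<lambda>c. Poly_Mapping.lookup (u c)"] by auto
  have "(\<Sum>c\<in>C. hscale (a c) (u c)) = 0"
  proof (rule poly_mapping_eqI)
    fix k
    have "Poly_Mapping.lookup (u c) k = 0" if "c \<in> C" "k \<notin> F" for c
    proof -
      have "Poly_Mapping.keys (u c) = F" using that(1) X(1) by (auto simp: C_def key_def)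
      then show ?thesis using that(2) by (metis in_keys_iff)
    qed
    then show "Poly_Mapping.lookup (\<Sum>c\<in>C. hscale (a c) (u c)) k = Poly_Mapping.lookup 0 k"
      using a(2) by (cases "k \<in> F") (simp_all add: lookup_sum)
  qed
  then show False using independent[OF \<open>finite C\<close>] a(1) by blast
qed

lemma irr_iff:
  assumes "\<tau> \<in> torus"
  shows "irr \<tau> \<longleftrightarrow> (\<forall>v. wt (L \<tau>) \<tau> v \<longrightarrow> (\<exists>c. v - hscale c unit_H \<in> L \<tau>)) \<and> \<tau> \<in> U_set"
  using irr_imp_scalar[OF _ assms] irr_imp_U[OF _ assms] irr_if_U_and_scalar[OF assms] by blast

end

section \<open>The induced module\<close>

context BL_hecke_algebra begin

lemma H_simps [simp]: "carrier H = Hspace" "\<one>\<^bsub>H\<^esub> = unit_H" "h \<otimes>\<^bsub>H\<^esub> k = mul h k" "h \<oplus>\<^bsub>H\<^esub> k = h + k"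
  by (simp_all add: H_def)

text \<open>\<open>collapse\<close> sends \<open>h \<otimes> c\<close> to \<open>c h\<close>; it identifies the kernel of the tensor product with the elements
  mapped into \<open>L \<tau>\<close>.\<close>

definition collapse :: "(('y hecke \<times> complex) \<Rightarrow>\<^sub>0 int) \<Rightarrow> 'y hecke" where
  "collapse x = (\<Sum>p\<in>Poly_Mapping.keys x. hscale (of_int (Poly_Mapping.lookup x p) * snd p) (fst p))"

lemma collapse_add: "collapse (x + y) = collapse x + collapse y"
  unfolding collapse_def
  by (rule setsum_keys_plus_distrib) (auto simp: distrib_right hscale_add_left)

lemma additive_collapse: "Modules.additive collapse"
  by unfold_locales (rule collapse_add)

lemmas collapse_diff = additive.diff[OF additive_collapse]
  and collapse_minus = additive.minus[OF additive_collapse]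
  and collapse_zero [simp] = additive.zero[OF additive_collapse]

lemma collapse_frag [simp]: "collapse (frag_of (h, c)) = hscale c h"
  by (simp add: collapse_def keys_frag_of)

abbreviation free_H :: "(('y hecke \<times> complex) \<Rightarrow>\<^sub>0 int) monoid" where
  "free_H \<equiv> tensor_free H"

lemma free_H_simps [simp]: "x \<in> carrier free_H \<longleftrightarrow> Poly_Mapping.keys x \<subseteq> Hspace \<times> UNIV"
  "x \<otimes>\<^bsub>free_H\<^esub> y = x + y" "\<one>\<^bsub>free_H\<^esub> = 0"
  by (simp_all add: tensor_free_def)

lemma free_H_group: "group free_H"
  by (simp add: tensor_free_def)

lemma free_H_closed:
  "frag_of (h, c) \<in> carrier free_H \<longleftrightarrow> h \<in> Hspace"
  "x \<in> carrier free_H \<Longrightarrow> y \<in> carrier free_H \<Longrightarrow> x + y \<in> carrier free_H"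
  "x \<in> carrier free_H \<Longrightarrow> y \<in> carrier free_H \<Longrightarrow> x - y \<in> carrier free_H"
  "x \<in> carrier free_H \<Longrightarrow> - x \<in> carrier free_H"
  using Poly_Mapping.keys_add[of x y] keys_diff[of x y] by (auto simp: keys_frag_of)

lemma free_H_inv: "x \<in> carrier free_H \<Longrightarrow> inv\<^bsub>free_H\<^esub> x = - x"
  unfolding tensor_free_def by (rule inv_free_Abelian_group) simp

lemma free_H_induct [consumes 1, case_names frag diff]:
  assumes "x \<in> carrier free_H" "\<And>h c. h \<in> Hspace \<Longrightarrow> P (frag_of (h, c))"
    "\<And>x y. P x \<Longrightarrow> P y \<Longrightarrow> x \<in> carrier free_H \<Longrightarrow> y \<in> carrier free_H \<Longrightarrow> P (x - y)"
  shows "P x"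
proof -
  have "x \<in> carrier free_H \<and> P x"
  proof (rule frag_induction[of x "Hspace \<times> UNIV"])
    show "Poly_Mapping.keys x \<subseteq> Hspace \<times> UNIV" using assms(1) by simp
    \<comment> \<open>Zero arises as the difference of a generator with itself, so the difference
      case covers it.\<close>
    have "frag_of (0, 0) \<in> carrier free_H" by (simp only: free_H_closed Hspace_zero)
    then show "0 \<in> carrier free_H \<and> P 0" using assms(3)[of "frag_of (0, 0)" "frag_of (0, 0)"] assms(2)[of 0 0]
      by (simp del: free_H_simps) simp
    show "frag_of a \<in> carrier free_H \<and> P (frag_of a)" if "a \<in> Hspace \<times> UNIV" for a
      using that assms(2) by (cases a) (simp add: free_H_closed del: free_H_simps)
    show "a - b \<in> carrier free_H \<and> P (a - b)"
      if "a \<in> carrier free_H \<and> P a" "b \<in> carrier free_H \<and> P b" for a b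
      using that assms(3) free_H_closed(3) by blast
  qed
  then show ?thesis by blast
qed

lemma collapse_in: "x \<in> carrier free_H \<Longrightarrow> collapse x \<in> Hspace"
  by (induction rule: free_H_induct) (simp_all add: collapse_diff)

definition lmul :: "'y hecke \<Rightarrow> (('y hecke \<times> complex) \<Rightarrow>\<^sub>0 int) \<Rightarrow> (('y hecke \<times> complex) \<Rightarrow>\<^sub>0 int)" where
  "lmul h = frag_extend (\<lambda>(h', n). frag_of (mul h h', n))"

lemma lmul_simps: "lmul h (frag_of (k, c)) = frag_of (mul h k, c)" "lmul h (x - y) = lmul h x - lmul h y"
  "lmul h (x + y) = lmul h x + lmul h y" "lmul h (- x) = - lmul h x" "lmul h 0 = 0"
  by (simp_all add: lmul_def frag_extend_diff frag_extend_add frag_extend_minus)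

lemma lmul_in: assumes "h \<in> Hspace" "x \<in> carrier free_H" shows "lmul h x \<in> carrier free_H"
  using assms(2)
proof (induction rule: free_H_induct)
  case (frag k c)
  then show ?case using assms(1) by (simp only: lmul_simps free_H_closed mul_in)
next
  case (diff x y)
  then show ?case by (simp only: lmul_simps free_H_closed)
qed

lemma collapse_lmul: assumes "h \<in> Hspace" "x \<in> carrier free_H" shows "collapse (lmul h x) = mul h (collapse x)"
  using assms(2)
proof (induction rule: free_H_induct)
  case (frag k c)
  then show ?case using assms(1) by (simp add: lmul_simps mul_simps)
next
  case (diff x y)
  then show ?case using assms(1) by (simp add: lmul_simps collapse_diff mul_simps collapse_in del: free_H_simps)
qed

section \<open>The tensor product identified with the quotient by \<open>L \<tau>\<close>\<close>

context
  fixes \<tau> :: "'y \<Rightarrow> complex"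
  assumes \<tau>: "\<tau> \<in> torus"
begin

abbreviation tens_rel where
  "tens_rel \<equiv> tensor_relators H (\<lambda>h P. mul h (emb P)) (\<lambda>P c. evalt \<tau> P * c)"

abbreviation tens_ker where
  "tens_ker \<equiv> tensor_kernel H (\<lambda>h P. mul h (emb P)) (\<lambda>P c. evalt \<tau> P * c)"

lemma tens_rel_cases:
  assumes "x \<in> tens_rel"
  obtains (left) h h' c where "h \<in> Hspace" "h' \<in> Hspace" "x = frag_of (h + h', c) - frag_of (h, c) - frag_of (h', c)"
  | (right) h c c' where "h \<in> Hspace" "x = frag_of (h, c + c') - frag_of (h, c) - frag_of (h, c')"
  | (mid) h P c where "h \<in> Hspace" "x = frag_of (mul h (emb P), c) - frag_of (h, evalt \<tau> P * c)"
  using assms unfolding tensor_relators_def by auto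

lemma tens_rel_carrier: assumes "x \<in> tens_rel" shows "x \<in> carrier free_H"
  using assms
proof (cases rule: tens_rel_cases)
  case left
  then show ?thesis by (simp only: free_H_closed Hspace_add)
next
  case right
  then show ?thesis by (simp only: free_H_closed)
next
  case mid
  then show ?thesis by (simp only: free_H_closed mul_in Hspace_emb)
qed

lemma tens_ker_subgroup: "subgroup tens_ker free_H"
  unfolding tensor_kernel_def
  by (rule group.generate_is_subgroup[OF free_H_group]) (use tens_rel_carrier in blast)

lemma tens_ker_rel: "x \<in> tens_rel \<Longrightarrow> x \<in> tens_ker"
  unfolding tensor_kernel_def by (rule generate.incl)

lemma tens_ker_carrier: "x \<in> tens_ker \<Longrightarrow> x \<in> carrier free_H"
  using subgroup.subset[OF tens_ker_subgroup] by blast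

lemma tens_ker_zero: "0 \<in> tens_ker"
  using subgroup.one_closed[OF tens_ker_subgroup] by simp

lemma tens_ker_add: "x \<in> tens_ker \<Longrightarrow> y \<in> tens_ker \<Longrightarrow> x + y \<in> tens_ker"
  using subgroup.m_closed[OF tens_ker_subgroup, of x y] by simp

lemma tens_ker_minus: "x \<in> tens_ker \<Longrightarrow> - x \<in> tens_ker"
  using subgroup.m_inv_closed[OF tens_ker_subgroup, of x] free_H_inv[OF tens_ker_carrier] by simp

lemma tens_ker_diff: "x \<in> tens_ker \<Longrightarrow> y \<in> tens_ker \<Longrightarrow> x - y \<in> tens_ker"
  using tens_ker_add[of x "- y"] tens_ker_minus[of y] by simp

lemma tens_ker_induct [consumes 1, case_names zero rel minus add]:
  assumes "x \<in> tens_ker" "P 0" "\<And>x. x \<in> tens_rel \<Longrightarrow> P x" "\<And>x. x \<in> tens_rel \<Longrightarrow> P (- x)"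
    "\<And>x y. P x \<Longrightarrow> P y \<Longrightarrow> P (x + y)"
  shows "P x"
  using assms(1) unfolding tensor_kernel_def
proof (induction rule: generate.induct)
  case (inv h)
  then show ?case using assms(4) free_H_inv[OF tens_rel_carrier] by simp
qed (use assms in auto)

lemma collapse_rel: assumes "x \<in> tens_rel" shows "collapse x \<in> L \<tau>"
  using assms
proof (cases rule: tens_rel_cases)
  case left
  then show ?thesis by (simp add: collapse_diff hscale_add left_ideal_zero[OF left_ideal_L])
next
  case right
  then show ?thesis by (simp add: collapse_diff hscale_add_left left_ideal_zero[OF left_ideal_L])
next
  case (mid h P c)
  have "hscale c (mul h (mul (emb P) unit_H - hscale (evalt \<tau> P) unit_H)) \<in> L \<tau>"
    using mid(1) by (intro left_ideal_hscale left_ideal_mul wt_emb left_ideal_L wt_L)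
  then show ?thesis using mid by (simp add: collapse_diff mul_simps hscale_diff mult.commute)
qed

lemma collapse_ker: "x \<in> tens_ker \<Longrightarrow> collapse x \<in> L \<tau>"
proof (induction rule: tens_ker_induct)
  case (minus x)
  then show ?case
    using left_ideal_diff[OF left_ideal_L left_ideal_zero[OF left_ideal_L] collapse_rel]
    by (simp add: collapse_minus)
qed (simp_all add: left_ideal_zero[OF left_ideal_L] collapse_rel collapse_add left_ideal_add[OF left_ideal_L])

lemma frag_add_ker:
  assumes "h \<in> Hspace" "h' \<in> Hspace"
  shows "frag_of (h + h', c) - frag_of (h, c) - frag_of (h', c) \<in> tens_ker"
  using assms by (intro tens_ker_rel) (force simp: tensor_relators_def)

lemma frag_mid_ker:
  assumes "h \<in> Hspace"
  shows "frag_of (mul h (emb P), c) - frag_of (h, evalt \<tau> P * c) \<in> tens_ker"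
  using assms by (intro tens_ker_rel) (force simp: tensor_relators_def)

text \<open>Every tensor has the form h (x) 1, because a scalar c crosses the tensor sign as the
  constant c of \<complex>[Y].\<close>

lemma frag_collapse: assumes "x \<in> carrier free_H" shows "x - frag_of (collapse x, 1) \<in> tens_ker"
  using assms
proof (induction rule: free_H_induct)
  case (frag h c)
  have "frag_of (mul h (emb (gscal c)), 1) - frag_of (h, evalt \<tau> (gscal c) * 1) \<in> tens_ker"
    by (rule frag_mid_ker) (rule frag)
  then have "frag_of (hscale c h, 1) - frag_of (h, c) \<in> tens_ker"
    using frag \<tau> by (simp add: emb_gscal mul_simps)
  from tens_ker_minus[OF this] show ?case by simp
next
  case (diff x y)
  have "frag_of ((collapse x - collapse y) + collapse y, 1) - frag_of (collapse x - collapse y, 1)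
      - frag_of (collapse y, 1) \<in> tens_ker"
    by (rule frag_add_ker) (use diff(3,4) collapse_in in auto)
  from tens_ker_add[OF this tens_ker_diff[OF diff(1,2)]] show ?case
    by (simp add: collapse_diff algebra_simps)
qed

lemma lmul_ker: assumes h: "h \<in> Hspace" and "x \<in> tens_ker" shows "lmul h x \<in> tens_ker"
proof -
  have rel: "lmul h x \<in> tens_rel" if "x \<in> tens_rel" for x
    using that
  proof (cases rule: tens_rel_cases)
    case (left k k' c)
    then show ?thesis using h by (force simp: lmul_simps mul_simps tensor_relators_def)
  next
    case (right k c c')
    then show ?thesis using h by (force simp: lmul_simps tensor_relators_def)
  next
    case (mid k P c)
    then have "lmul h x = frag_of (mul (mul h k) (emb P), c) - frag_of (mul h k, evalt \<tau> P * c)"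
      using h by (simp add: lmul_simps mul_assoc)
    then show ?thesis using h mid(1) unfolding tensor_relators_def by force
  qed
  from assms(2) show ?thesis
    by (induction rule: tens_ker_induct)
      (simp_all add: lmul_simps tens_ker_zero tens_ker_add tens_ker_minus tens_ker_rel rel)
qed

text \<open>The h with h (x) 1 = 0 form a left ideal that contains each Z^mu - tau(mu), and
  \<open>L \<tau>\<close> is the least such.\<close>

lemma frag_L_ker: assumes "l \<in> L \<tau>" shows "frag_of (l, 1) \<in> tens_ker"
proof -
  let ?N = "{l \<in> Hspace. frag_of (l, 1) \<in> tens_ker}"
  have "left_ideal ?N"
  proof (rule left_idealI)
    show "0 \<in> ?N" using tens_ker_minus[OF frag_add_ker[of 0 0 1]] by simp
    show "h + k \<in> ?N" if "h \<in> ?N" "k \<in> ?N" for h k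
      using that tens_ker_add[OF frag_add_ker[of h k 1] tens_ker_add[of "frag_of (h, 1)" "frag_of (k, 1)"]] by simp
    show "mul h k \<in> ?N" if "h \<in> Hspace" "k \<in> ?N" for h k
      using that lmul_ker[of h "frag_of (k, 1)"] by (simp add: lmul_simps)
  qed blast
  moreover have "wt ?N \<tau> unit_H"
    unfolding wt_def
  proof (intro conjI allI)
    fix \<mu>
    \<comment> \<open>\<open>x\<close> is a relator and \<open>collapse x\<close> is Z^mu - tau(mu);
      \<open>frag_collapse\<close> passes from one to the other.\<close>
    define x where "x = frag_of (Z \<mu>, 1) - frag_of (unit_H, \<tau> \<mu>)"
    have "x \<in> carrier free_H" unfolding x_def by (simp only: free_H_closed Hspace_bas id_in_W)
    moreover have "x \<in> tens_ker"
      using frag_mid_ker[of unit_H "Zmon \<mu>" 1] by (simp add: x_def emb_Zmon)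
    ultimately have "frag_of (collapse x, 1) \<in> tens_ker"
      using tens_ker_diff[OF _ frag_collapse, of x x] by simp
    then show "mul (Z \<mu>) unit_H - hscale (\<tau> \<mu>) unit_H \<in> ?N" by (simp add: x_def collapse_diff)
  qed simp
  ultimately show ?thesis using assms unfolding L_def by blast
qed

lemma tens_ker_iff: "x \<in> tens_ker \<longleftrightarrow> x \<in> carrier free_H \<and> collapse x \<in> L \<tau>"
proof
  assume x: "x \<in> carrier free_H \<and> collapse x \<in> L \<tau>"
  then have "x - frag_of (collapse x, 1) + frag_of (collapse x, 1) \<in> tens_ker"
    by (intro tens_ker_add frag_collapse frag_L_ker) auto
  then show "x \<in> tens_ker" by simp
qed (use tens_ker_carrier collapse_ker in blast)

text \<open>The coset h (x) 1 written out through \<open>collapse\<close>, so that equality of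
  classes becomes membership of a difference in \<open>L \<tau>\<close>.\<close>

definition cls :: "'y hecke \<Rightarrow> 'y induced" where
  "cls h = {x \<in> carrier free_H. collapse x - h \<in> L \<tau>}"

lemma frag_in_cls: assumes "h \<in> Hspace" shows "frag_of (h, 1) \<in> cls h"
proof -
  have "frag_of (h, 1) \<in> carrier free_H" using assms by (simp only: free_H_closed)
  then show ?thesis unfolding cls_def by (simp add: left_ideal_zero[OF left_ideal_L] del: free_H_simps)
qed

lemma coset_eq_cls: assumes "x \<in> carrier free_H" shows "tens_ker #>\<^bsub>free_H\<^esub> x = cls (collapse x)"
proof -
  have "y \<in> cls (collapse x) \<longleftrightarrow> y - x \<in> tens_ker" for y
    using assms free_H_closed(2)[of "y - x" x] free_H_closed(3)[of y x]
    unfolding cls_def tens_ker_iff by (auto simp: collapse_diff simp del: free_H_simps)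
  moreover have "y \<in> tens_ker #>\<^bsub>free_H\<^esub> x \<longleftrightarrow> y - x \<in> tens_ker" for y
    unfolding r_coset_def by (auto intro!: bexI[of _ "y - x"])
  ultimately show ?thesis by blast
qed

lemma cls_eq_iff: assumes "h \<in> Hspace" "k \<in> Hspace" shows "cls h = cls k \<longleftrightarrow> h - k \<in> L \<tau>"
proof
  assume "cls h = cls k"
  then have "frag_of (h, 1) \<in> cls k" using frag_in_cls[OF assms(1)] by simp
  then show "h - k \<in> L \<tau>" by (simp add: cls_def)
next
  assume d: "h - k \<in> L \<tau>"
  have "collapse x - h \<in> L \<tau> \<longleftrightarrow> collapse x - k \<in> L \<tau>" for x
    using left_ideal_add[OF left_ideal_L _ d, of "collapse x - h"]
      left_ideal_diff[OF left_ideal_L _ d, of "collapse x - k"] by auto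
  then show "cls h = cls k" by (simp add: cls_def)
qed

lemma rcosets_eq: "rcosets\<^bsub>free_H\<^esub> tens_ker = cls ` Hspace"
proof
  show "rcosets\<^bsub>free_H\<^esub> tens_ker \<subseteq> cls ` Hspace"
    using coset_eq_cls collapse_in unfolding RCOSETS_def by blast
  show "cls ` Hspace \<subseteq> rcosets\<^bsub>free_H\<^esub> tens_ker"
  proof
    fix C assume "C \<in> cls ` Hspace"
    then obtain h where h: "h \<in> Hspace" "C = cls h" by blast
    then have f: "frag_of (h, 1) \<in> carrier free_H" by (simp only: free_H_closed)
    then have "C = tens_ker #>\<^bsub>free_H\<^esub> frag_of (h, 1)" using coset_eq_cls h by simp
    then show "C \<in> rcosets\<^bsub>free_H\<^esub> tens_ker" using f unfolding RCOSETS_def by blast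
  qed
qed

lemma cls_set_mult: assumes "h \<in> Hspace" "k \<in> Hspace" shows "cls h <#>\<^bsub>free_H\<^esub> cls k = cls (h + k)"
proof
  show "cls h <#>\<^bsub>free_H\<^esub> cls k \<subseteq> cls (h + k)"
  proof
    fix z assume "z \<in> cls h <#>\<^bsub>free_H\<^esub> cls k"
    then obtain x y where xy: "z = x + y" "x \<in> carrier free_H" "y \<in> carrier free_H"
      "collapse x - h \<in> L \<tau>" "collapse y - k \<in> L \<tau>" unfolding set_mult_def cls_def by auto
    have "collapse z - (h + k) = (collapse x - h) + (collapse y - k)"
      by (simp add: xy(1) collapse_add)
    then have "collapse z - (h + k) \<in> L \<tau>"
      using left_ideal_add[OF left_ideal_L xy(4,5)] by (simp only:)
    then show "z \<in> cls (h + k)" using free_H_closed(2)[OF xy(2,3)] xy(1) by (simp add: cls_def)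
  qed
  show "cls (h + k) \<subseteq> cls h <#>\<^bsub>free_H\<^esub> cls k"
  proof
    fix z assume z: "z \<in> cls (h + k)"
    have f: "frag_of (k, 1) \<in> carrier free_H" using assms by (simp only: free_H_closed)
    have "z - frag_of (k, 1) \<in> cls h"
      using z free_H_closed(3)[OF _ f, of z] by (simp add: cls_def collapse_diff algebra_simps)
    moreover have "z = (z - frag_of (k, 1)) \<otimes>\<^bsub>free_H\<^esub> frag_of (k, 1)" by simp
    ultimately show "z \<in> cls h <#>\<^bsub>free_H\<^esub> cls k" using frag_in_cls[OF assms(2)]
      unfolding set_mult_def by blast
  qed
qed

lemma I_mod_carrier: "carrier (I_mod \<tau>) = cls ` Hspace"
  by (simp add: I_mod_def tensor_module_def Let_def FactGroup_def rcosets_eq)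

lemma I_mod_add: "h \<in> Hspace \<Longrightarrow> k \<in> Hspace \<Longrightarrow> cls h \<oplus>\<^bsub>I_mod \<tau>\<^esub> cls k = cls (h + k)"
  by (simp add: I_mod_def tensor_module_def Let_def FactGroup_def cls_set_mult)

lemma I_mod_zero: "\<zero>\<^bsub>I_mod \<tau>\<^esub> = cls 0"
proof -
  have "tens_ker = cls 0" using tens_ker_iff by (auto simp: cls_def)
  then show ?thesis by (simp add: I_mod_def tensor_module_def Let_def FactGroup_def)
qed

text \<open>All cosets in the union that defines \<open>smult\<close> coincide since
  \<open>L \<tau>\<close> is a left ideal, and the union is not empty because \<open>cls k\<close>
  contains a representative.\<close>

lemma I_mod_smult: assumes h: "h \<in> Hspace" and k: "k \<in> Hspace"
  shows "h \<odot>\<^bsub>I_mod \<tau>\<^esub> cls k = cls (mul h k)"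
proof -
  have "tens_ker #>\<^bsub>free_H\<^esub> lmul h x = cls (mul h k)" if "x \<in> cls k" for x
  proof -
    have x: "x \<in> carrier free_H" "collapse x - k \<in> L \<tau>" using that by (simp_all add: cls_def)
    have "mul h (collapse x) - mul h k \<in> L \<tau>"
      using left_ideal_mul[OF left_ideal_L h x(2)] h k collapse_in[OF x(1)] by (simp add: mul_simps)
    then have "cls (mul h (collapse x)) = cls (mul h k)"
      using h k collapse_in[OF x(1)] by (simp add: cls_eq_iff)
    then show ?thesis using coset_eq_cls[OF lmul_in[OF h x(1)]] collapse_lmul[OF h x(1)] by simp
  qed
  then have "(\<Union>x\<in>cls k. tens_ker #>\<^bsub>free_H\<^esub> lmul h x) = cls (mul h k)"
    using frag_in_cls[OF k] by blast
  then show ?thesis by (simp add: I_mod_def tensor_module_def Let_def lmul_def)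
qed

lemma one_tensor_one_eq: "one_tensor_one \<tau> = cls unit_H"
proof -
  have "frag_of (unit_H, 1) \<in> carrier free_H" by (simp only: free_H_closed Hspace_bas id_in_W)
  from coset_eq_cls[OF this] show ?thesis by (simp add: one_tensor_one_def pure_tensor_def)
qed

lemma cscale_cls: "h \<in> Hspace \<Longrightarrow> cscale \<tau> c (cls h) = cls (hscale c h)"
  by (simp add: cscale_def I_mod_smult mul_simps)

lemma I_mod_add_group: "group (add_monoid (I_mod \<tau>))"
proof (rule groupI)
  fix x assume "x \<in> carrier (add_monoid (I_mod \<tau>))"
  then obtain h where h: "h \<in> Hspace" "x = cls h" by (auto simp: I_mod_carrier)
  then show "\<one>\<^bsub>add_monoid (I_mod \<tau>)\<^esub> \<otimes>\<^bsub>add_monoid (I_mod \<tau>)\<^esub> x = x"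
    by (simp add: I_mod_zero I_mod_add)
  show "\<exists>y\<in>carrier (add_monoid (I_mod \<tau>)). y \<otimes>\<^bsub>add_monoid (I_mod \<tau>)\<^esub> x = \<one>\<^bsub>add_monoid (I_mod \<tau>)\<^esub>"
    using h by (intro bexI[of _ "cls (- h)"]) (simp_all add: I_mod_zero I_mod_add I_mod_carrier)
qed (auto simp: I_mod_carrier I_mod_zero I_mod_add add.assoc)

lemma I_mod_add_inv: "h \<in> Hspace \<Longrightarrow> inv\<^bsub>add_monoid (I_mod \<tau>)\<^esub> cls h = cls (- h)"
  by (rule group.inv_equality[OF I_mod_add_group]) (simp_all add: I_mod_add I_mod_zero I_mod_carrier)

section \<open>Submodules, weight vectors and endomorphisms of I_tau\<close>

lemma submodule_cls: assumes N: "left_ideal N" shows "submodule (cls ` N) H (I_mod \<tau>)"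
proof (intro submodule.intro subgroup.intro submodule_axioms.intro)
  have sub: "h \<in> Hspace" if "h \<in> N" for h using left_ideal_subset[OF N that] .
  show "cls ` N \<subseteq> carrier (add_monoid (I_mod \<tau>))" using sub by (auto simp: I_mod_carrier)
  show "x \<otimes>\<^bsub>add_monoid (I_mod \<tau>)\<^esub> y \<in> cls ` N" if xy: "x \<in> cls ` N" "y \<in> cls ` N" for x y
    using xy sub left_ideal_add[OF N] by (auto simp: I_mod_add)
  show "\<one>\<^bsub>add_monoid (I_mod \<tau>)\<^esub> \<in> cls ` N" using left_ideal_zero[OF N] by (auto simp: I_mod_zero)
  show "inv\<^bsub>add_monoid (I_mod \<tau>)\<^esub> x \<in> cls ` N" if x: "x \<in> cls ` N" for x
  proof -
    obtain h where h: "h \<in> N" "x = cls h" using x by blast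
    have "- h \<in> N" using left_ideal_diff[OF N left_ideal_zero[OF N] h(1)] by simp
    then show ?thesis using h sub by (simp add: I_mod_add_inv)
  qed
  show "a \<odot>\<^bsub>I_mod \<tau>\<^esub> x \<in> cls ` N" if ax: "a \<in> carrier H" "x \<in> cls ` N" for a x
    using ax sub left_ideal_mul[OF N] by (auto simp: I_mod_smult)
qed

lemma irreducible_iff_irr: "irreducible_module H (I_mod \<tau>) \<longleftrightarrow> irr \<tau>"
proof
  assume irr: "irreducible_module H (I_mod \<tau>)"
  show "irr \<tau>" unfolding irr_def
  proof (intro allI impI)
    fix N assume N: "left_ideal N" "L \<tau> \<subseteq> N"
    have sub: "h \<in> Hspace" if "h \<in> N" for h using left_ideal_subset[OF N(1) that] .
    have "cls ` N = {cls 0} \<or> cls ` N = cls ` Hspace"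
      using irr submodule_cls[OF N(1)] unfolding irreducible_module_def I_mod_carrier I_mod_zero by blast
    then show "N = L \<tau> \<or> N = Hspace"
    proof
      assume *: "cls ` N = {cls 0}"
      have "h \<in> L \<tau>" if h: "h \<in> N" for h
      proof -
        have "cls h = cls 0" using * h by blast
        then show ?thesis using cls_eq_iff[OF sub[OF h] Hspace_zero] by simp
      qed
      then show ?thesis using N(2) by blast
    next
      assume *: "cls ` N = cls ` Hspace"
      have "h \<in> N" if h: "h \<in> Hspace" for h
      proof -
        obtain k where k: "k \<in> N" "cls h = cls k" using * h by blast
        then have "h - k \<in> N" using cls_eq_iff[OF h sub[OF k(1)]] N(2) by blast
        then show ?thesis using left_ideal_add[OF N(1) _ k(1), of "h - k"] by simp
      qed
      then show ?thesis using sub by blast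
    qed
  qed
next
  assume irr: "irr \<tau>"
  show "irreducible_module H (I_mod \<tau>)"
    unfolding irreducible_module_def
  proof (intro conjI allI impI)
    have u: "unit_H \<in> Hspace" by simp
    then have "cls unit_H \<noteq> cls 0" using cls_eq_iff[of unit_H 0] unit_notin_L[OF \<tau>] by simp
    moreover have "cls unit_H \<in> carrier (I_mod \<tau>)" unfolding I_mod_carrier using u by (rule imageI)
    ultimately show "carrier (I_mod \<tau>) \<noteq> {\<zero>\<^bsub>I_mod \<tau>\<^esub>}"
      using I_mod_zero by auto
    fix S assume S: "submodule S H (I_mod \<tau>)"
    interpret S: submodule S H "I_mod \<tau>" by fact
    have S_sub: "S \<subseteq> cls ` Hspace" using S.subset by (simp add: I_mod_carrier)
    define N where "N = {h \<in> Hspace. cls h \<in> S}"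
    have zero: "cls 0 \<in> S" using S.one_closed by (simp add: I_mod_zero)
    have "left_ideal N"
    proof (rule left_idealI)
      show "0 \<in> N" using zero by (simp add: N_def)
      show "h + k \<in> N" if "h \<in> N" "k \<in> N" for h k
        using that S.m_closed[of "cls h" "cls k"] by (simp add: N_def I_mod_add)
      show "mul h k \<in> N" if "h \<in> Hspace" "k \<in> N" for h k
        using that S.smult_closed[of h "cls k"] by (simp add: N_def I_mod_smult)
    qed (auto simp: N_def)
    moreover have "L \<tau> \<subseteq> N"
    proof
      fix l assume l: "l \<in> L \<tau>"
      then have "cls l = cls 0" "l \<in> Hspace" using cls_eq_iff[of l 0] left_ideal_subset[OF left_ideal_L l] by simp_all
      then show "l \<in> N" using zero by (simp add: N_def)
    qed
    ultimately have "N = L \<tau> \<or> N = Hspace" using irr unfolding irr_def by blast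
    then show "S = {\<zero>\<^bsub>I_mod \<tau>\<^esub>} \<or> S = carrier (I_mod \<tau>)"
    proof
      assume N: "N = L \<tau>"
      have "x = cls 0" if x: "x \<in> S" for x
      proof -
        obtain h where h: "h \<in> Hspace" "x = cls h" using S_sub x by blast
        then have "h \<in> L \<tau>" using x N by (auto simp: N_def)
        then show ?thesis using cls_eq_iff[of h 0] h by simp
      qed
      then have "S = {cls 0}" using zero by blast
      then show ?thesis by (simp add: I_mod_zero)
    next
      assume "N = Hspace"
      then show ?thesis using S_sub by (auto simp: N_def I_mod_carrier)
    qed
  qed
qed

lemma weight_space_eq: "weight_space \<tau> = {cls v | v. wt (L \<tau>) \<tau> v}"
proof -
  have "(\<forall>P. emb P \<odot>\<^bsub>I_mod \<tau>\<^esub> cls v = cscale \<tau> (evalt \<tau> P) (cls v)) \<longleftrightarrow> wt (L \<tau>) \<tau> v" if v: "v \<in> Hspace" for v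
  proof -
    have "(\<forall>P. emb P \<odot>\<^bsub>I_mod \<tau>\<^esub> cls v = cscale \<tau> (evalt \<tau> P) (cls v)) \<longleftrightarrow>
        (\<forall>P. mul (emb P) v - hscale (evalt \<tau> P) v \<in> L \<tau>)"
      using v by (simp add: I_mod_smult cscale_cls cls_eq_iff)
    also have "\<dots> \<longleftrightarrow> wt (L \<tau>) \<tau> v"
    proof
      assume *: "\<forall>P. mul (emb P) v - hscale (evalt \<tau> P) v \<in> L \<tau>"
      have "mul (Z \<mu>) v - hscale (\<tau> \<mu>) v \<in> L \<tau>" for \<mu>
        using *[rule_format, of "Zmon \<mu>"] by (simp add: emb_Zmon)
      then show "wt (L \<tau>) \<tau> v" using v by (simp add: wt_def)
    qed (use wt_emb[OF left_ideal_L] in blast)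
    finally show ?thesis .
  qed
  moreover have "v \<in> Hspace" if "wt (L \<tau>) \<tau> v" for v using that by (simp add: wt_def)
  ultimately show ?thesis unfolding weight_space_def I_mod_carrier by blast
qed

lemma wt_scalar: "wt (L \<tau>) \<tau> (hscale c unit_H)"
  unfolding wt_def
proof (intro conjI allI)
  fix \<mu>
  have "mul (Z \<mu>) unit_H - hscale (\<tau> \<mu>) unit_H \<in> L \<tau>" using wt_L unfolding wt_def by blast
  from left_ideal_hscale[OF left_ideal_L this, of c]
  show "mul (Z \<mu>) (hscale c unit_H) - hscale (\<tau> \<mu>) (hscale c unit_H) \<in> L \<tau>"
    by (simp add: mul_simps hscale_diff mult.commute)
qed simp

lemma weight_space_scalar_iff:
  "weight_space \<tau> = C_one_tensor_one \<tau> \<longleftrightarrow> (\<forall>v. wt (L \<tau>) \<tau> v \<longrightarrow> (\<exists>c. v - hscale c unit_H \<in> L \<tau>))"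
proof -
  have C: "C_one_tensor_one \<tau> = {cls (hscale c unit_H) | c. True}"
    by (simp add: C_one_tensor_one_def one_tensor_one_eq cscale_cls)
  have eq: "cls v = cls (hscale c unit_H) \<longleftrightarrow> v - hscale c unit_H \<in> L \<tau>" if "wt (L \<tau>) \<tau> v" for v c
    using that by (intro cls_eq_iff) (simp_all add: wt_def)
  have "C_one_tensor_one \<tau> \<subseteq> weight_space \<tau>" unfolding C weight_space_eq using wt_scalar by blast
  then have "weight_space \<tau> = C_one_tensor_one \<tau> \<longleftrightarrow> weight_space \<tau> \<subseteq> C_one_tensor_one \<tau>" by blast
  also have "\<dots> \<longleftrightarrow> (\<forall>v. wt (L \<tau>) \<tau> v \<longrightarrow> (\<exists>c. cls v = cls (hscale c unit_H)))"
    unfolding C weight_space_eq by blast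
  also have "\<dots> \<longleftrightarrow> (\<forall>v. wt (L \<tau>) \<tau> v \<longrightarrow> (\<exists>c. v - hscale c unit_H \<in> L \<tau>))"
    using eq by blast
  finally show ?thesis .
qed

text \<open>Frobenius reciprocity: the endomorphisms of \<open>I\<^sub>\<tau>\<close> are the right multiplications by weight vectors.\<close>

lemma module_End_right_mul:
  assumes v: "wt (L \<tau>) \<tau> v"
  shows "\<exists>f\<in>module_End H (I_mod \<tau>). \<forall>h\<in>Hspace. f (cls h) = cls (mul h v)"
proof -
  have vH: "v \<in> Hspace" using v by (simp add: wt_def)
  \<comment> \<open>A representative of each class is chosen; by \<open>L_mul_wt\<close> another
    choice gives the same value, because v has weight tau.\<close>
  define f where "f = (\<lambda>x\<in>carrier (I_mod \<tau>). cls (mul (SOME h. h \<in> Hspace \<and> x = cls h) v))"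
  have f: "f (cls h) = cls (mul h v)" if h: "h \<in> Hspace" for h
  proof -
    define k where "k = (SOME k. k \<in> Hspace \<and> cls h = cls k)"
    have k: "k \<in> Hspace \<and> cls h = cls k" unfolding k_def by (rule someI[of _ h]) (use h in simp)
    then have "k - h \<in> L \<tau>" using cls_eq_iff[of k h] h by simp
    then have "mul (k - h) v \<in> L \<tau>" by (rule L_mul_wt[OF left_ideal_L v])
    then have "cls (mul k v) = cls (mul h v)" using k h vH by (simp add: cls_eq_iff mul_simps)
    moreover have "f (cls h) = cls (mul k v)" using h by (simp add: f_def k_def I_mod_carrier)
    ultimately show ?thesis by simp
  qed
  have "f \<in> module_End H (I_mod \<tau>)"
    unfolding module_End_def
  proof (intro CollectI conjI ballI)
    show "f \<in> carrier (I_mod \<tau>) \<rightarrow>\<^sub>E carrier (I_mod \<tau>)"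
    proof (rule PiE_I)
      show "f x \<in> carrier (I_mod \<tau>)" if "x \<in> carrier (I_mod \<tau>)" for x
        using that f vH by (auto simp: I_mod_carrier)
      show "f x = undefined" if "x \<notin> carrier (I_mod \<tau>)" for x using that by (simp add: f_def)
    qed
    fix x y assume "x \<in> carrier (I_mod \<tau>)" "y \<in> carrier (I_mod \<tau>)"
    then obtain h k where "h \<in> Hspace" "x = cls h" "k \<in> Hspace" "y = cls k" by (auto simp: I_mod_carrier)
    then show "f (x \<oplus>\<^bsub>I_mod \<tau>\<^esub> y) = f x \<oplus>\<^bsub>I_mod \<tau>\<^esub> f y"
      using vH by (simp add: I_mod_add f mul_simps)
  next
    fix h x assume h: "h \<in> carrier H" and "x \<in> carrier (I_mod \<tau>)"
    then obtain k where "k \<in> Hspace" "x = cls k" by (auto simp: I_mod_carrier)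
    then show "f (h \<odot>\<^bsub>I_mod \<tau>\<^esub> x) = h \<odot>\<^bsub>I_mod \<tau>\<^esub> f x"
      using h vH by (simp add: I_mod_smult f mul_assoc)
  qed
  then show ?thesis using f by blast
qed

text \<open>An endomorphism is determined by the image v of 1 (x) 1, and v inherits the weight tau
  from it.\<close>

lemma module_End_weight:
  assumes f: "f \<in> module_End H (I_mod \<tau>)"
  shows "\<exists>v. wt (L \<tau>) \<tau> v \<and> (\<forall>h\<in>Hspace. f (cls h) = cls (mul h v))"
proof -
  have f_smult: "f (h \<odot>\<^bsub>I_mod \<tau>\<^esub> x) = h \<odot>\<^bsub>I_mod \<tau>\<^esub> f x" if "h \<in> Hspace" "x \<in> carrier (I_mod \<tau>)" for h x
    using f that unfolding module_End_def by simp
  have f_fun: "f x \<in> carrier (I_mod \<tau>)" if "x \<in> carrier (I_mod \<tau>)" for x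
    using f that unfolding module_End_def by blast
  have unit: "cls unit_H \<in> carrier (I_mod \<tau>)" by (simp add: I_mod_carrier)
  obtain v where v: "v \<in> Hspace" "f (cls unit_H) = cls v" using f_fun[OF unit] by (auto simp: I_mod_carrier)
  have fv: "f (cls h) = cls (mul h v)" if "h \<in> Hspace" for h
    using f_smult[OF that unit] that v by (simp add: I_mod_smult)
  have "mul (Z \<mu>) v - hscale (\<tau> \<mu>) v \<in> L \<tau>" for \<mu>
  proof -
    have "cls (Z \<mu>) = cls (hscale (\<tau> \<mu>) unit_H)"
      using wt_L[of \<tau>] by (simp add: cls_eq_iff wt_def)
    then have "cls (mul (Z \<mu>) v) = cls (hscale (\<tau> \<mu>) v)"
      using fv[of "Z \<mu>"] fv[of "hscale (\<tau> \<mu>) unit_H"] v by (simp add: mul_simps)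
    then show ?thesis using v by (simp add: cls_eq_iff)
  qed
  then show ?thesis using v fv by (auto simp: wt_def)
qed

lemma End_scalar_iff:
  "module_End H (I_mod \<tau>) = scalar_End \<tau> \<longleftrightarrow> (\<forall>v. wt (L \<tau>) \<tau> v \<longrightarrow> (\<exists>c. v - hscale c unit_H \<in> L \<tau>))"
proof
  assume E: "module_End H (I_mod \<tau>) = scalar_End \<tau>"
  show "\<forall>v. wt (L \<tau>) \<tau> v \<longrightarrow> (\<exists>c. v - hscale c unit_H \<in> L \<tau>)"
  proof (intro allI impI)
    fix v assume v: "wt (L \<tau>) \<tau> v"
    then have vH: "v \<in> Hspace" by (simp add: wt_def)
    obtain f where f: "f \<in> scalar_End \<tau>" "\<forall>h\<in>Hspace. f (cls h) = cls (mul h v)"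
      using module_End_right_mul[OF v] E by blast
    then obtain c where "f = (\<lambda>x\<in>carrier (I_mod \<tau>). cscale \<tau> c x)" unfolding scalar_End_def by blast
    then have "f (cls unit_H) = cls (hscale c unit_H)" by (simp add: I_mod_carrier cscale_cls)
    moreover have "f (cls unit_H) = cls v" using f(2) vH by simp
    ultimately show "\<exists>c. v - hscale c unit_H \<in> L \<tau>" using vH cls_eq_iff[of v "hscale c unit_H"] by auto
  qed
next
  assume S: "\<forall>v. wt (L \<tau>) \<tau> v \<longrightarrow> (\<exists>c. v - hscale c unit_H \<in> L \<tau>)"
  show "module_End H (I_mod \<tau>) = scalar_End \<tau>"
  proof
    show "module_End H (I_mod \<tau>) \<subseteq> scalar_End \<tau>"
    proof
      fix f assume f: "f \<in> module_End H (I_mod \<tau>)"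
      obtain v where v: "wt (L \<tau>) \<tau> v" "\<forall>h\<in>Hspace. f (cls h) = cls (mul h v)"
        using module_End_weight[OF f] by blast
      have vH: "v \<in> Hspace" using v by (simp add: wt_def)
      obtain c where c: "v - hscale c unit_H \<in> L \<tau>" using S v by blast
      have "f x = (\<lambda>x\<in>carrier (I_mod \<tau>). cscale \<tau> c x) x" for x
      proof (cases "x \<in> carrier (I_mod \<tau>)")
        case True
        then obtain h where h: "h \<in> Hspace" "x = cls h" by (auto simp: I_mod_carrier)
        have "mul h v - hscale c h \<in> L \<tau>"
          using left_ideal_mul[OF left_ideal_L h(1) c] h vH by (simp add: mul_simps)
        then show ?thesis using True h v(2) vH by (simp add: cscale_cls cls_eq_iff)
      next
        case False
        then show ?thesis using f unfolding module_End_def by auto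
      qed
      then show "f \<in> scalar_End \<tau>" unfolding scalar_End_def by blast
    qed
    show "scalar_End \<tau> \<subseteq> module_End H (I_mod \<tau>)"
    proof
      fix f assume "f \<in> scalar_End \<tau>"
      then obtain c where c: "f = (\<lambda>x\<in>carrier (I_mod \<tau>). cscale \<tau> c x)" unfolding scalar_End_def by blast
      \<comment> \<open>Multiplication by the scalar c is right multiplication by the weight vector
        c 1, hence an endomorphism.\<close>
      obtain g where g: "g \<in> module_End H (I_mod \<tau>)" "\<forall>h\<in>Hspace. g (cls h) = cls (mul h (hscale c unit_H))"
        using module_End_right_mul[OF wt_scalar] by blast
      have "f x = g x" for x
      proof (cases "x \<in> carrier (I_mod \<tau>)")
        case True
        then show ?thesis using g(2) by (auto simp: c I_mod_carrier cscale_cls mul_simps)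
      next
        case False
        then show ?thesis using g(1) c unfolding module_End_def by auto
      qed
      then have "f = g" by blast
      then show "f \<in> module_End H (I_mod \<tau>)" using g(1) by simp
    qed
  qed
qed

lemma irreducible_criterion:
  "(irreducible_module H (I_mod \<tau>) \<longleftrightarrow> weight_space \<tau> = C_one_tensor_one \<tau> \<and> \<tau> \<in> U_set) \<and>
   (irreducible_module H (I_mod \<tau>) \<longleftrightarrow> module_End H (I_mod \<tau>) = scalar_End \<tau> \<and> \<tau> \<in> U_set)"
  unfolding irreducible_iff_irr weight_space_scalar_iff End_scalar_iff using irr_iff[OF \<tau>] by blast

end

end

theorem theorem4p8:
  fixes I :: "'i set"
    and A :: "'i \<Rightarrow> 'i \<Rightarrow> int"
    and \<alpha> :: "'i \<Rightarrow> 'y::ab_group_add \<Rightarrow> int"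
    and \<alpha>v :: "'i \<Rightarrow> 'y"
    and \<sigma> \<sigma>' :: "'i \<Rightarrow> complex"
    and mul :: "'y hecke \<Rightarrow> 'y hecke \<Rightarrow> 'y hecke"
    and \<tau> :: "'y \<Rightarrow> complex"
  assumes "BL_hecke_algebra I A \<alpha> \<alpha>v \<sigma> \<sigma>' mul"
    and "\<tau> \<in> torus"
  defines "\<H> \<equiv> BL_hecke_algebra.H I \<alpha> \<alpha>v mul"
    and "M \<equiv> BL_hecke_algebra.I_mod I \<alpha> \<alpha>v mul \<tau>"
    and "U \<equiv> hecke_parameters.U_set I \<alpha> \<alpha>v \<sigma> \<sigma>'"
  shows "(irreducible_module \<H> M \<longleftrightarrow>
            BL_hecke_algebra.weight_space I \<alpha> \<alpha>v mul \<tau> =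
              BL_hecke_algebra.C_one_tensor_one I \<alpha> \<alpha>v mul \<tau> \<and> \<tau> \<in> U) \<and>
         (irreducible_module \<H> M \<longleftrightarrow>
            module_End \<H> M = BL_hecke_algebra.scalar_End I \<alpha> \<alpha>v mul \<tau> \<and> \<tau> \<in> U)"
  unfolding \<H>_def M_def U_def
  by (rule BL_hecke_algebra.irreducible_criterion[OF assms(1,2)])

end
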